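(* Let $\mathbb{F}$ be a field of characteristic $0$ and let $\mathcal{A}=(E,V,L)$ be a linear space over $\mathbb{F}$ with Gale dual $\mathcal{A}^!=(E,V^*,L^\perp)$. Then $$\operatorname{Sym} L^* = \mathcal{P}_-(\mathcal{A})\oplus \mathcal{K}(\mathcal{A}^!).$$ Equivalently, the compositions $$\mathcal{P}_-(\mathcal{A})\hookrightarrow \operatorname{Sym} L^*\twoheadrightarrow \overline{\operatorname{OT}}(\mathcal{A}^!)\qquad\text{and}\qquad \mathcal{E}(\mathcal{A}^!)\hookrightarrow \operatorname{Sym} L\twoheadrightarrow \mathcal{R}_-(\mathcal{A})$$ are isomorphisms, and the graded vector spaces $\mathcal{P}_-(\mathcal{A})\cong\overline{\operatorname{OT}}(\mathcal{A}^!)$ are dual to $\mathcal{E}(\mathcal{A}^!)\cong\mathcal{R}_-(\mathcal{A})$.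
   Context: A linear space over $\mathbb{F}$ is a triple $\mathcal{A}=(E,V,L)$, where $E$ is a finite set, $V=\bigoplus_{e\in E}V_e$ is a vector space over $\mathbb{F}$ equipped with a decomposition into lines indexed by $E$, and $L\subset V$ is a linear subspace. Its Gale dual is $\mathcal{A}^!:=(E,V^*,L^\perp)$, where $V^*=\bigoplus_{e\in E}V_e^*$ and $L^\perp\subset V^*$ is the annihilator of $L$. For $\alpha\in L$, let $m(\alpha)$ be the number of $e\in E$ such that the projection $\alpha_e\in V_e$ is nonzero. The internal zonotopal algebra is $$\mathcal{R}_-(\mathcal{A}):=\operatorname{Sym} L\big/\langle \alpha^{m(\alpha)-1}\mid 0\neq\alpha\in L\rangle.$$ Elements of $\operatorname{Sym}L^*$ are regarded as polynomials on $L$ and elements of $\operatorname{Sym}L$ as constant-coefficient differential operators; the pairing between $\operatorname{Sym}L^*$ and $\operatorname{Sym} L$ applies the operator to the polynomial and evaluates at $0\in L$. The linear dual of $\mathcal{R}_-(\mathcal{A})$ is $$\mathcal{P}_-(\mathcal{A}):=\{f\in\operatorname{Sym}L^*\mid \alpha^{m(\alpha)-1}\cdot f=0\text{ for all }0\neq\alpha\in L\}.$$ Orlik--Terao algebra of $\mathcal{A}^!$: for each $e\in E$ fix a nonzero $v_e\in V_e$ and let $w_e\in V_e^*$ be the dual basis vector. Let $\psi_e\in(L^\perp)^*$ be the linear functional on $L^\perp$ obtained by projecting to $V_e^*$ and pairing with $v_e$. If all $\psi_e$ are nonzero, $\operatorname{OT}(\mathcal{A}^!)$ is the subalgebra of the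 field of rational functions on $L^\perp$ generated by $\{\psi_e^{-1}\mid e\in E\}$; if some $\psi_e=0$, then $\operatorname{OT}(\mathcal{A}^!):=0$. There is a surjection $\operatorname{Sym}V^*\to\operatorname{OT}(\mathcal{A}^!)$, $w_e\mapsto\psi_e^{-1}$ (independent of the choices), so $\operatorname{OT}(\mathcal{A}^!)$ is an algebra over $\operatorname{Sym}L^\perp$ via $L^\perp\subset V^*$. The reduced Orlik--Terao algebra $\overline{\operatorname{OT}}(\mathcal{A}^!)$ is the quotient of $\operatorname{OT}(\mathcal{A}^!)$ by the ideal generated by the image of $L^\perp$; it is a quotient of $\operatorname{Sym}(V^*/L^\perp)\cong\operatorname{Sym}L^*$. Let $\mathcal{K}(\mathcal{A}^!)\subset\operatorname{Sym}L^*$ be the kernel of $\operatorname{Sym}L^*\to\overline{\operatorname{OT}}(\mathcal{A}^!)$, and let $\mathcal{E}(\mathcal{A}^!)\subset\operatorname{Sym}L$ be its Macaulay inverse system, consisting of the differential operators in $\operatorname{Sym}L$ that pair trivially with all polynomials in $\mathcal{K}(\mathcal{A}^!)$. Grading convention: $\operatorname{Sym}L^*$ is generated in degree $1$, $\operatorname{Sym}L$ in degree $-1$, and nontrivial pairings occur between classes of opposite degrees. *)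

theory Defs
  imports
    "HOL.Vector_Spaces"
    "HOL-Library.Poly_Mapping"
    "HOL-Library.FuncSet"
    "HOL-Computational_Algebra.Fraction_Field"
    "HOL-Algebra.QuotRing"
begin

section \<open>Linear spaces\<close>

text \<open>
  The ambient vector space V is the whole type \<open>'v\<close> with scalar multiplication \<open>smul A\<close>;
  \<open>edges A\<close> is E, \<open>line A e\<close> is the line indexed by e, and \<open>sub A\<close> is L.
\<close>

record ('f, 'v, 'e) linspace =
  smul :: "'f \<Rightarrow> 'v \<Rightarrow> 'v"
  edges :: "'e set"
  line :: "'e \<Rightarrow> 'v set"
  sub :: "'v set"

definition linear_space :: "('f::field, 'v::ab_group_add, 'e) linspace \<Rightarrow> bool" where
  "linear_space A \<longleftrightarrow>
     vector_space (smul A) \<and>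
     finite (edges A) \<and>
     (\<forall>e\<in>edges A. \<exists>v. v \<noteq> 0 \<and> line A e = module.span (smul A) {v}) \<and>
     (\<forall>x. \<exists>!a. a \<in> (\<Pi>\<^sub>E e\<in>edges A. line A e) \<and> x = (\<Sum>e\<in>edges A. a e)) \<and>
     module.subspace (smul A) (sub A)"

definition component :: "('f::field, 'v::ab_group_add, 'e) linspace \<Rightarrow> 'e \<Rightarrow> 'v \<Rightarrow> 'v" where
  "component A e x =
     (THE a. a \<in> (\<Pi>\<^sub>E e\<in>edges A. line A e) \<and> x = (\<Sum>e\<in>edges A. a e)) e"

definition mult_num :: "('f::field, 'v::ab_group_add, 'e) linspace \<Rightarrow> 'v \<Rightarrow> nat" where
  "mult_num A \<alpha> = card {e \<in> edges A. component A e \<alpha> \<noteq> 0}"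

definition annihilator :: "('f::field, 'v::ab_group_add, 'e) linspace \<Rightarrow> ('v \<Rightarrow> 'f) set" where
  "annihilator A = {\<phi>. Vector_Spaces.linear (smul A) (*) \<phi> \<and> (\<forall>x\<in>sub A. \<phi> x = 0)}"

text \<open>
  Auxiliary choices: \<open>vec X e\<close> spans the line of e, \<open>bas X\<close> is a basis of L, and
  \<open>pbas X j\<close> for \<open>j < pdim X\<close> enumerates a basis of the annihilator of L.
  The last one is enumerated by natural numbers because the polynomial ring of which we take the
  fraction field needs linearly ordered variables to be an instance of \<open>idom\<close>.
\<close>

record ('f, 'v, 'e) frame =
  vec :: "'e \<Rightarrow> 'v"
  bas :: "'v set"
  pbas :: "nat \<Rightarrow> 'v \<Rightarrow> 'f"
  pdim :: nat

definition frame_of ::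
  "('f::field, 'v::ab_group_add, 'e) linspace \<Rightarrow> ('f, 'v, 'e) frame \<Rightarrow> bool" where
  "frame_of A X \<longleftrightarrow>
     (\<forall>e\<in>edges A. vec X e \<in> line A e \<and> vec X e \<noteq> 0) \<and>
     \<not> module.dependent (smul A) (bas X) \<and> module.span (smul A) (bas X) = sub A \<and>
     (\<forall>j<pdim X. pbas X j \<in> annihilator A) \<and>
     (\<forall>\<phi>\<in>annihilator A. \<exists>!a. a \<in> {..<pdim X} \<rightarrow>\<^sub>E UNIV \<and> \<phi> = (\<lambda>x. \<Sum>j<pdim X. a j * pbas X j x))"

text \<open>The functional \<open>w\<^sub>e\<close> on V dual to \<open>v\<^sub>e\<close>.\<close>

definition dual_vec ::
  "('f::field, 'v::ab_group_add, 'e) linspace \<Rightarrow> ('f, 'v, 'e) frame \<Rightarrow> 'e \<Rightarrow> 'v \<Rightarrow> 'f" where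
  "dual_vec A X e x = (THE c. component A e x = smul A c (vec X e))"


section \<open>Polynomials\<close>

text \<open>The symmetric algebra of a vector space is the polynomial ring on a basis of it.\<close>

type_synonym ('x, 'f) mpol = "('x \<Rightarrow>\<^sub>0 nat) \<Rightarrow>\<^sub>0 'f"

definition Cst :: "'f \<Rightarrow> ('x, 'f::comm_ring_1) mpol" where
  "Cst c = Poly_Mapping.single 0 c"

definition Vr :: "'x \<Rightarrow> ('x, 'f::comm_ring_1) mpol" where
  "Vr x = Poly_Mapping.single (Poly_Mapping.single x 1) 1"

definition mon_deg :: "('x \<Rightarrow>\<^sub>0 nat) \<Rightarrow> nat" where
  "mon_deg m = (\<Sum>x\<in>Poly_Mapping.keys m. Poly_Mapping.lookup m x)"

definition polys :: "'x set \<Rightarrow> ('x, 'f::comm_ring_1) mpol set" where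
  "polys I = {p. \<forall>m\<in>Poly_Mapping.keys p. Poly_Mapping.keys m \<subseteq> I}"

definition poly_ring :: "'x set \<Rightarrow> ('x, 'f::comm_ring_1) mpol ring" where
  "poly_ring I = \<lparr>carrier = polys I, mult = (*), one = 1, zero = 0, add = (+)\<rparr>"

text \<open>The value of p at s, with coefficients mapped along h.\<close>

definition eval_poly ::
  "('f::comm_ring_1 \<Rightarrow> 'r::comm_ring_1) \<Rightarrow> ('x \<Rightarrow> 'r) \<Rightarrow> ('x, 'f) mpol \<Rightarrow> 'r" where
  "eval_poly h s p =
     (\<Sum>m\<in>Poly_Mapping.keys p.
        h (Poly_Mapping.lookup p m) * (\<Prod>x\<in>Poly_Mapping.keys m. s x ^ Poly_Mapping.lookup m x))"

text \<open>
  \<open>diff_op D f\<close> applies D to f, where the variable x of D acts as the partial derivative with respect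
  to the variable x of f: the monomial m sends the monomial n to n - m times the product of the
  falling factorials \<open>n\<^sub>x (n\<^sub>x - 1) \<dots> (n\<^sub>x - m\<^sub>x + 1) = m\<^sub>x! (n\<^sub>x choose m\<^sub>x)\<close>,
  which is zero unless m divides n.
\<close>

definition diff_op :: "('x, 'f::comm_ring_1) mpol \<Rightarrow> ('x, 'f) mpol \<Rightarrow> ('x, 'f) mpol" where
  "diff_op D f =
     (\<Sum>m\<in>Poly_Mapping.keys D. \<Sum>n\<in>Poly_Mapping.keys f.
        Poly_Mapping.single (n - m)
          (Poly_Mapping.lookup D m * Poly_Mapping.lookup f n *
           (\<Prod>x\<in>Poly_Mapping.keys m.
              of_nat (fact (Poly_Mapping.lookup m x) *
                      (Poly_Mapping.lookup n x choose Poly_Mapping.lookup m x)))))"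

definition sym_pairing :: "('x, 'f::comm_ring_1) mpol \<Rightarrow> ('x, 'f) mpol \<Rightarrow> 'f" where
  "sym_pairing f D = Poly_Mapping.lookup (diff_op D f) 0"


section \<open>The algebras attached to a linear space\<close>

text \<open>
  Both Sym L and \<open>Sym L\<^sup>*\<close> are \<open>poly_ring (bas X)\<close>: in Sym L the variable \<open>b\<close> is the basis vector
  b itself, in \<open>Sym L\<^sup>*\<close> it is the functional dual to b. \<open>Sym V\<^sup>*\<close> is \<open>poly_ring (edges A)\<close>, the
  variable e being \<open>w\<^sub>e\<close>.
\<close>

definition sym_vec ::
  "('f::field, 'v::ab_group_add, 'e) linspace \<Rightarrow> ('f, 'v, 'e) frame \<Rightarrow> 'v \<Rightarrow> ('v, 'f) mpol" where
  "sym_vec A X \<alpha> = (\<Sum>b\<in>bas X. Cst (module.representation (smul A) (bas X) \<alpha> b) * Vr b)"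

definition sym_covec ::
  "('f::field, 'v::ab_group_add, 'e) linspace \<Rightarrow> ('f, 'v, 'e) frame \<Rightarrow> ('v \<Rightarrow> 'f) \<Rightarrow> ('e, 'f) mpol" where
  "sym_covec A X \<phi> = (\<Sum>e\<in>edges A. Cst (\<phi> (vec X e)) * Vr e)"

text \<open>The projection from \<open>Sym V\<^sup>*\<close> to \<open>Sym (V\<^sup>* / L\<^sup>\<bottom>) = Sym L\<^sup>*\<close> restricts functionals to L.\<close>

definition restr ::
  "('f::field, 'v::ab_group_add, 'e) linspace \<Rightarrow> ('f, 'v, 'e) frame \<Rightarrow> ('e, 'f) mpol \<Rightarrow> ('v, 'f) mpol" where
  "restr A X = eval_poly Cst (\<lambda>e. \<Sum>b\<in>bas X. Cst (dual_vec A X e b) * Vr b)"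

text \<open>Grading: \<open>Sym L\<^sup>*\<close> is generated in degree 1 and Sym L in degree -1.\<close>

definition deg_SymLd :: "('f::field, 'v, 'e) frame \<Rightarrow> int \<Rightarrow> ('v, 'f) mpol set" where
  "deg_SymLd X k = {f \<in> polys (bas X). \<forall>m\<in>Poly_Mapping.keys f. int (mon_deg m) = k}"

definition deg_SymL :: "('f::field, 'v, 'e) frame \<Rightarrow> int \<Rightarrow> ('v, 'f) mpol set" where
  "deg_SymL X k = {D \<in> polys (bas X). \<forall>m\<in>Poly_Mapping.keys D. - int (mon_deg m) = k}"

subsection \<open>The internal zonotopal algebra and its dual\<close>

definition R_ideal ::
  "('f::field, 'v::ab_group_add, 'e) linspace \<Rightarrow> ('f, 'v, 'e) frame \<Rightarrow> ('v, 'f) mpol set" where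
  "R_ideal A X =
     Idl\<^bsub>poly_ring (bas X)\<^esub> {sym_vec A X \<alpha> ^ (mult_num A \<alpha> - 1) | \<alpha>. \<alpha> \<in> sub A \<and> \<alpha> \<noteq> 0}"

definition R_minus ::
  "('f::field, 'v::ab_group_add, 'e) linspace \<Rightarrow> ('f, 'v, 'e) frame \<Rightarrow> ('v, 'f) mpol set ring" where
  "R_minus A X = poly_ring (bas X) Quot R_ideal A X"

definition SymL_to_R ::
  "('f::field, 'v::ab_group_add, 'e) linspace \<Rightarrow> ('f, 'v, 'e) frame \<Rightarrow> ('v, 'f) mpol \<Rightarrow> ('v, 'f) mpol set" where
  "SymL_to_R A X D = R_ideal A X +>\<^bsub>poly_ring (bas X)\<^esub> D"

definition P_minus ::
  "('f::field, 'v::ab_group_add, 'e) linspace \<Rightarrow> ('f, 'v, 'e) frame \<Rightarrow> ('v, 'f) mpol set" where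
  "P_minus A X =
     {f \<in> polys (bas X).
        \<forall>\<alpha>\<in>sub A. \<alpha> \<noteq> 0 \<longrightarrow> diff_op (sym_vec A X \<alpha> ^ (mult_num A \<alpha> - 1)) f = 0}"

subsection \<open>The Orlik-Terao algebra of the Gale dual\<close>

text \<open>
  Rational functions on the annihilator of L: the variable j is the j-th coordinate with respect
  to the basis \<open>pbas X\<close>.
\<close>

type_synonym 'f ratfun = "(nat, 'f) mpol fract"

definition rat_const :: "'f::field \<Rightarrow> 'f ratfun" where
  "rat_const c = Fract (Cst c) 1"

definition psi :: "('f::field, 'v, 'e) frame \<Rightarrow> 'e \<Rightarrow> 'f ratfun" where
  "psi X e = Fract (\<Sum>j<pdim X. Cst (pbas X j (vec X e)) * Vr j) 1"

inductive_set subalgebra_gen :: "('f \<Rightarrow> 'r::comm_ring_1) \<Rightarrow> 'r set \<Rightarrow> 'r set"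
  for h :: "'f \<Rightarrow> 'r::comm_ring_1" and G :: "'r set" where
  const: "h c \<in> subalgebra_gen h G"
| gen: "g \<in> G \<Longrightarrow> g \<in> subalgebra_gen h G"
| add: "a \<in> subalgebra_gen h G \<Longrightarrow> b \<in> subalgebra_gen h G \<Longrightarrow> a + b \<in> subalgebra_gen h G"
| mult: "a \<in> subalgebra_gen h G \<Longrightarrow> b \<in> subalgebra_gen h G \<Longrightarrow> a * b \<in> subalgebra_gen h G"

definition OT ::
  "('f::field, 'v::ab_group_add, 'e) linspace \<Rightarrow> ('f, 'v, 'e) frame \<Rightarrow> 'f ratfun ring" where
  "OT A X =
     (if \<forall>e\<in>edges A. psi X e \<noteq> 0
      then \<lparr>carrier = subalgebra_gen rat_const ((\<lambda>e. inverse (psi X e)) ` edges A),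
            mult = (*), one = 1, zero = 0, add = (+)\<rparr>
      else \<lparr>carrier = {0}, mult = (*), one = 0, zero = 0, add = (+)\<rparr>)"

definition SymVd_to_OT ::
  "('f::field, 'v::ab_group_add, 'e) linspace \<Rightarrow> ('f, 'v, 'e) frame \<Rightarrow> ('e, 'f) mpol \<Rightarrow> 'f ratfun" where
  "SymVd_to_OT A X p =
     (if \<forall>e\<in>edges A. psi X e \<noteq> 0 then eval_poly rat_const (\<lambda>e. inverse (psi X e)) p else 0)"

definition OT_ideal ::
  "('f::field, 'v::ab_group_add, 'e) linspace \<Rightarrow> ('f, 'v, 'e) frame \<Rightarrow> 'f ratfun set" where
  "OT_ideal A X = Idl\<^bsub>OT A X\<^esub> ((\<lambda>\<phi>. SymVd_to_OT A X (sym_covec A X \<phi>)) ` annihilator A)"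

definition OTbar ::
  "('f::field, 'v::ab_group_add, 'e) linspace \<Rightarrow> ('f, 'v, 'e) frame \<Rightarrow> 'f ratfun set ring" where
  "OTbar A X = OT A X Quot OT_ideal A X"

definition SymVd_to_OTbar ::
  "('f::field, 'v::ab_group_add, 'e) linspace \<Rightarrow> ('f, 'v, 'e) frame \<Rightarrow> ('e, 'f) mpol \<Rightarrow> 'f ratfun set" where
  "SymVd_to_OTbar A X p = OT_ideal A X +>\<^bsub>OT A X\<^esub> SymVd_to_OT A X p"

text \<open>The map induced by \<open>SymVd_to_OTbar\<close> on the quotient \<open>Sym L\<^sup>*\<close> of \<open>Sym V\<^sup>*\<close>.\<close>

definition SymLd_to_OTbar ::
  "('f::field, 'v::ab_group_add, 'e) linspace \<Rightarrow> ('f, 'v, 'e) frame \<Rightarrow> ('v, 'f) mpol \<Rightarrow> 'f ratfun set" where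
  "SymLd_to_OTbar A X f =
     (THE y. \<exists>p\<in>polys (edges A). restr A X p = f \<and> y = SymVd_to_OTbar A X p)"

definition K_dual ::
  "('f::field, 'v::ab_group_add, 'e) linspace \<Rightarrow> ('f, 'v, 'e) frame \<Rightarrow> ('v, 'f) mpol set" where
  "K_dual A X = {f \<in> polys (bas X). SymLd_to_OTbar A X f = \<zero>\<^bsub>OTbar A X\<^esub>}"

definition E_dual ::
  "('f::field, 'v::ab_group_add, 'e) linspace \<Rightarrow> ('f, 'v, 'e) frame \<Rightarrow> ('v, 'f) mpol set" where
  "E_dual A X = {D \<in> polys (bas X). \<forall>f\<in>K_dual A X. sym_pairing f D = 0}"


section \<open>Graded vector spaces\<close>

text \<open>
  A vector space over \<open>'f\<close> is here a subset W of a ring S, on which the scalar c acts as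
  multiplication by \<open>h c\<close>; a grading is a family \<open>W\<^sub>k\<close> of subspaces indexed by the integers.
\<close>

definition F_subspace :: "'s ring \<Rightarrow> ('f \<Rightarrow> 's) \<Rightarrow> 's set \<Rightarrow> bool" where
  "F_subspace S h W \<longleftrightarrow>
     W \<subseteq> carrier S \<and> \<zero>\<^bsub>S\<^esub> \<in> W \<and> (\<forall>x\<in>W. \<forall>y\<in>W. x \<oplus>\<^bsub>S\<^esub> y \<in> W) \<and>
     (\<forall>c. \<forall>x\<in>W. h c \<otimes>\<^bsub>S\<^esub> x \<in> W)"

definition internal_direct_sum :: "'s ring \<Rightarrow> ('f \<Rightarrow> 's) \<Rightarrow> 's set \<Rightarrow> 's set \<Rightarrow> 's set \<Rightarrow> bool" where
  "internal_direct_sum S h W W1 W2 \<longleftrightarrow>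
     F_subspace S h W1 \<and> F_subspace S h W2 \<and>
     W1 \<inter> W2 = {\<zero>\<^bsub>S\<^esub>} \<and> W = {x \<oplus>\<^bsub>S\<^esub> y | x y. x \<in> W1 \<and> y \<in> W2}"

definition graded_space :: "'s ring \<Rightarrow> ('f \<Rightarrow> 's) \<Rightarrow> 's set \<Rightarrow> (int \<Rightarrow> 's set) \<Rightarrow> bool" where
  "graded_space S h W Wg \<longleftrightarrow>
     F_subspace S h W \<and> (\<forall>k. F_subspace S h (Wg k) \<and> Wg k \<subseteq> W) \<and>
     (\<forall>x\<in>W. \<exists>!u. (\<forall>k. u k \<in> Wg k) \<and> finite {k. u k \<noteq> \<zero>\<^bsub>S\<^esub>} \<and>
        x = (\<Oplus>\<^bsub>S\<^esub>k\<in>{k. u k \<noteq> \<zero>\<^bsub>S\<^esub>}. u k))"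

definition graded_iso ::
  "'s ring \<Rightarrow> ('f \<Rightarrow> 's) \<Rightarrow> 's set \<Rightarrow> (int \<Rightarrow> 's set) \<Rightarrow>
   't ring \<Rightarrow> ('f \<Rightarrow> 't) \<Rightarrow> 't set \<Rightarrow> (int \<Rightarrow> 't set) \<Rightarrow> ('s \<Rightarrow> 't) \<Rightarrow> bool" where
  "graded_iso S h W Wg T i U Ug g \<longleftrightarrow>
     graded_space S h W Wg \<and> graded_space T i U Ug \<and> bij_betw g W U \<and>
     (\<forall>x\<in>W. \<forall>y\<in>W. g (x \<oplus>\<^bsub>S\<^esub> y) = g x \<oplus>\<^bsub>T\<^esub> g y) \<and>
     (\<forall>c. \<forall>x\<in>W. g (h c \<otimes>\<^bsub>S\<^esub> x) = i c \<otimes>\<^bsub>T\<^esub> g x) \<and>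
     (\<forall>k. g ` Wg k = Ug k)"

definition linear_form :: "'s ring \<Rightarrow> ('f::field \<Rightarrow> 's) \<Rightarrow> 's set \<Rightarrow> ('s \<Rightarrow> 'f) \<Rightarrow> bool" where
  "linear_form S h W l \<longleftrightarrow>
     (\<forall>x\<in>W. \<forall>y\<in>W. l (x \<oplus>\<^bsub>S\<^esub> y) = l x + l y) \<and> (\<forall>c. \<forall>x\<in>W. l (h c \<otimes>\<^bsub>S\<^esub> x) = c * l x)"

text \<open>The bilinear form \<open>\<beta>\<close> identifies W with the full dual of U and U with the full dual of W.\<close>

definition perfect_pairing ::
  "'s ring \<Rightarrow> ('f::field \<Rightarrow> 's) \<Rightarrow> 's set \<Rightarrow> 't ring \<Rightarrow> ('f \<Rightarrow> 't) \<Rightarrow> 't set \<Rightarrow>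
   ('s \<Rightarrow> 't \<Rightarrow> 'f) \<Rightarrow> bool" where
  "perfect_pairing S h W T i U \<beta> \<longleftrightarrow>
     (\<forall>x\<in>W. linear_form T i U (\<beta> x)) \<and> (\<forall>y\<in>U. linear_form S h W (\<lambda>x. \<beta> x y)) \<and>
     (\<forall>l. linear_form T i U l \<longrightarrow> (\<exists>!x. x \<in> W \<and> (\<forall>y\<in>U. l y = \<beta> x y))) \<and>
     (\<forall>l. linear_form S h W l \<longrightarrow> (\<exists>!y. y \<in> U \<and> (\<forall>x\<in>W. l x = \<beta> x y)))"

definition graded_dual ::
  "'s ring \<Rightarrow> ('f::field \<Rightarrow> 's) \<Rightarrow> 's set \<Rightarrow> (int \<Rightarrow> 's set) \<Rightarrow>
   't ring \<Rightarrow> ('f \<Rightarrow> 't) \<Rightarrow> 't set \<Rightarrow> (int \<Rightarrow> 't set) \<Rightarrow> ('s \<Rightarrow> 't \<Rightarrow> 'f) \<Rightarrow> bool" where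
  "graded_dual S h W Wg T i U Ug \<beta> \<longleftrightarrow>
     graded_space S h W Wg \<and> graded_space T i U Ug \<and>
     perfect_pairing S h W T i U \<beta> \<and>
     (\<forall>k. perfect_pairing S h (Wg k) T i (Ug (- k)) \<beta>) \<and>
     (\<forall>k l. k + l \<noteq> 0 \<longrightarrow> (\<forall>x\<in>Wg k. \<forall>y\<in>Ug l. \<beta> x y = 0))"

subsection \<open>Scalars, gradings and pairings of the four spaces\<close>

definition R_const ::
  "('f::field, 'v::ab_group_add, 'e) linspace \<Rightarrow> ('f, 'v, 'e) frame \<Rightarrow> 'f \<Rightarrow> ('v, 'f) mpol set" where
  "R_const A X c = SymL_to_R A X (Cst c)"

definition OTbar_const ::
  "('f::field, 'v::ab_group_add, 'e) linspace \<Rightarrow> ('f, 'v, 'e) frame \<Rightarrow> 'f \<Rightarrow> 'f ratfun set" where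
  "OTbar_const A X c = SymVd_to_OTbar A X (Cst c)"

definition P_deg ::
  "('f::field, 'v::ab_group_add, 'e) linspace \<Rightarrow> ('f, 'v, 'e) frame \<Rightarrow> int \<Rightarrow> ('v, 'f) mpol set" where
  "P_deg A X k = P_minus A X \<inter> deg_SymLd X k"

definition E_deg ::
  "('f::field, 'v::ab_group_add, 'e) linspace \<Rightarrow> ('f, 'v, 'e) frame \<Rightarrow> int \<Rightarrow> ('v, 'f) mpol set" where
  "E_deg A X k = E_dual A X \<inter> deg_SymL X k"

definition OTbar_deg ::
  "('f::field, 'v::ab_group_add, 'e) linspace \<Rightarrow> ('f, 'v, 'e) frame \<Rightarrow> int \<Rightarrow> 'f ratfun set set" where
  "OTbar_deg A X k = SymLd_to_OTbar A X ` deg_SymLd X k"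

definition R_deg ::
  "('f::field, 'v::ab_group_add, 'e) linspace \<Rightarrow> ('f, 'v, 'e) frame \<Rightarrow> int \<Rightarrow> ('v, 'f) mpol set set" where
  "R_deg A X k = SymL_to_R A X ` deg_SymL X k"

text \<open>
  The pairings induced on a quotient are computed on arbitrary representatives; \<open>the_elem\<close> is
  meaningful only if the result does not depend on them.
\<close>

definition P_R_pairing :: "('v, 'f::field) mpol \<Rightarrow> ('v, 'f) mpol set \<Rightarrow> 'f" where
  "P_R_pairing f y = the_elem ((\<lambda>D. sym_pairing f D) ` y)"

definition OTbar_E_pairing ::
  "('f::field, 'v::ab_group_add, 'e) linspace \<Rightarrow> ('f, 'v, 'e) frame \<Rightarrow> 'f ratfun set \<Rightarrow> ('v, 'f) mpol \<Rightarrow> 'f" where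
  "OTbar_E_pairing A X y D =
     the_elem ((\<lambda>f. sym_pairing f D) ` {f \<in> polys (bas X). SymLd_to_OTbar A X f = y})"

end

theory Submission
  imports Defs "HOL-Library.Function_Algebras" "HOL-Computational_Algebra.Polynomial"
begin

text \<open>
  In the coordinates given by the \<open>v\<^sub>e\<close>, let \<open>D\<close> be the subspace of
  coordinate vectors of the functionals in \<open>L\<^sup>\<bottom>\<close>. The coordinatewise inverses
  of its points without zero coordinates form the reciprocal plane. The Orlik-Terao algebra is the
  algebra of polynomial functions on the reciprocal plane, so the kernel of the map from \<open>Sym
  V\<^sup>*\<close> is the ideal of polynomials vanishing there, and \<open>K\<close> is the restriction
  of this ideal to \<open>L\<close> (lemma \<open>K_eq\<close>).

  The idea is to prove the decomposition on \<open>V\<close> before restricting to \<open>L\<close>. A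
  power \<open>\<alpha> ^ k\<close> annihilates a polynomial if and only if the polynomial has degree
  less than \<open>k\<close> on every line in direction \<open>\<alpha>\<close>. Call a polynomial on
  \<open>V\<close> zonotopal if its degree is less than \<open>m(\<alpha>) - 1\<close> on every line in
  direction \<open>\<alpha>\<close>, for all nonzero \<open>\<alpha>\<close> in \<open>L\<close>. These
  polynomials restrict to elements of \<open>P_minus\<close>, pullbacks of elements of
  \<open>P_minus\<close> along a projection are zonotopal, and multiplying with a form in
  \<open>L\<^sup>\<bottom>\<close>, which is constant on the lines in question, preserves them. The
  claim is that \<open>Sym V\<^sup>*\<close> is the direct sum of the zonotopal polynomials and the
  ideal of the reciprocal plane.

  Existence (\<open>zonotopal_surjective\<close>). Modulo the ideal, every polynomial is a combination
  of squarefree monomials of independent sets with products of forms of \<open>L\<^sup>\<bottom>\<close>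
  as coefficients. By an identity of Euler type (\<open>euler_identity\<close>), such a monomial is, up
  to the size of a flat, a sum of monomials of smaller independent sets times forms truncated to that
  flat. Iterating this gives products of truncated forms along flags of flats, which are zonotopal
  (\<open>flag_span_line\<close>).

  Uniqueness (\<open>zonotopal_injective\<close>). A zonotopal polynomial that vanishes on the
  reciprocal plane is zero. This goes by induction on the number of coordinates, by deletion and
  contraction: contraction is controlled by the order of the pole along a hyperplane
  (\<open>pole_zero\<close>), and both are combined by a comparison of dimensions
  (\<open>injective_if_comparable_image\<close>) that uses the existence part.

  Restricting to \<open>L\<close> gives \<open>Sym L\<^sup>* = P_minus + K\<close> at once. If an
  element \<open>f\<close> of \<open>P_minus\<close> is also the restriction of some \<open>p\<close> in
  the ideal, then \<open>p\<close> minus the pullback of \<open>f\<close> is a combination of forms in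
  \<open>L\<^sup>\<bottom>\<close>, whose coefficients may be taken to be zonotopal; uniqueness then
  shows that \<open>f = 0\<close> (\<open>P_inter_K\<close>).

  The statements about isomorphisms and duality follow formally (\<open>dual_decomposition\<close>).
  Both the ideal that defines \<open>R_minus\<close> and \<open>K\<close> are homogeneous and contain
  everything of high degree, so taking orthogonal spaces is a duality, which turns the decomposition of
  \<open>Sym L\<^sup>*\<close> into the one of \<open>Sym L\<close> into \<open>E_dual\<close> and the
  ideal of \<open>R_minus\<close>.
\<close>

section \<open>Injectivity by comparison of dimensions\<close>

text \<open>
  A dimension count. Take a linear map that agrees with \<open>T\<close> on the kernel of
  \<open>T1\<close> and with \<open>T1\<close> on a complement of it. By \<open>sep\<close> it is
  injective on \<open>U\<close>, and by \<open>sub\<close> it sends a basis of \<open>U\<close> into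
  \<open>T ` U\<close>. So \<open>T ` U\<close> has at least the dimension of \<open>U\<close>, and
  \<open>T\<close> is injective. The point is that \<open>sep\<close> only concerns elements on which
  \<open>T1\<close> already vanishes.
\<close>

lemma (in vector_space) injective_if_comparable_image:
  fixes T T1 :: "'b \<Rightarrow> 'b"
  assumes U: "subspace U" "U \<subseteq> span M" "finite M"
    and T: "Vector_Spaces.linear scale scale T" and T1: "Vector_Spaces.linear scale scale T1"
    and sub: "T1 ` U \<subseteq> T ` U"
    and sep: "\<And>u0 u. u0 \<in> U \<Longrightarrow> u \<in> U \<Longrightarrow> T1 u0 = 0 \<Longrightarrow> T u0 = T1 u \<Longrightarrow> u0 = 0"
    and u: "u \<in> U" "T u = 0"
  shows "u = 0"
proof (rule ccontr)
  assume "u \<noteq> 0"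
  interpret p: vector_space_pair scale scale by unfold_locales
  interpret T: Vector_Spaces.linear scale scale T by (rule T)
  interpret T1: Vector_Spaces.linear scale scale T1 by (rule T1)
  define U0 where "U0 = {u \<in> U. T1 u = 0}"
  have U0: "subspace U0"
    using U(1) unfolding U0_def by (auto simp: subspace_def T1.add T1.scale)
  obtain B0 where B0: "B0 \<subseteq> U0" "independent B0" "U0 \<subseteq> span B0"
    using maximal_independent_subset by blast
  obtain B where B: "B0 \<subseteq> B" "B \<subseteq> U" "independent B" "U \<subseteq> span B"
    using maximal_independent_subset_extend[of B0 U] B0 unfolding U0_def by blast
  have spB: "span B = U" using B U(1) by (metis span_minimal subset_antisym)
  have finB: "finite B" using independent_span_bound[OF U(3) B(3)] B(2) U(2) by blast
  define C where "C = B - B0"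
  have spB0: "span B0 = U0" using B0 U0 by (metis span_minimal subset_antisym)
  (* The comparison map: B0 is a basis of the kernel of T1, extended to the basis B of U. *)
  obtain S where S: "Vector_Spaces.linear scale scale S" "\<And>b. b \<in> B \<Longrightarrow> S b = (if b \<in> B0 then T b else T1 b)"
    using p.linear_independent_extend[OF B(3), of "\<lambda>b. if b \<in> B0 then T b else T1 b"] by blast
  interpret S: Vector_Spaces.linear scale scale S by (rule S(1))
  have S0: "S x = T x" if "x \<in> span B0" for x
    by (rule p.linear_eq_on[OF S(1) T that]) (use S(2) B(1) in auto)
  have S1: "S x = T1 x" if "x \<in> span C" for x
    by (rule p.linear_eq_on[OF S(1) T1 that]) (use S(2) in \<open>auto simp: C_def\<close>)
  have BC: "B = B0 \<union> C" using B(1) C_def by auto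
  obtain g where g: "Vector_Spaces.linear scale scale g" "\<And>b. b \<in> B \<Longrightarrow> g b = (if b \<in> B0 then b else 0)"
    using p.linear_independent_extend[OF B(3), of "\<lambda>b. if b \<in> B0 then b else 0"] by blast
  have id: "Vector_Spaces.linear scale scale (\<lambda>x. x)" by (rule linear_id[unfolded id_def])
  have zr: "Vector_Spaces.linear scale scale (\<lambda>x. 0)" by (rule p.linear_zero)
  have disj: "x = 0" if "x \<in> span B0" "x \<in> span C" for x
  proof -
    have "g x = x"
      by (rule p.linear_eq_on[OF g(1) id that(1)]) (use g(2) B(1) in auto)
    moreover have "g x = 0"
      by (rule p.linear_eq_on[OF g(1) zr that(2)]) (use g(2) in \<open>auto simp: C_def\<close>)
    ultimately show ?thesis by simp
  qed
  have Sinj: "x = 0" if xB: "x \<in> span B" and "S x = 0" for x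
  proof -
    obtain a c where ac: "x = a + c" "a \<in> span B0" "c \<in> span C"
      using xB unfolding BC span_Un by auto
    have aU: "a \<in> U" "T1 a = 0" using ac(2) spB0 U0_def by auto
    have cU: "c \<in> U" using ac(3) BC spB span_mono[of C B] by auto
    have "T a = T1 (- c)" using \<open>S x = 0\<close> ac S0 S1 by (simp add: S.add T1.neg eq_neg_iff_add_eq_0)
    then have a0: "a = 0" using sep[OF aU(1) _ aU(2)] U(1) cU by (metis subspace_neg)
    then have "T1 c = 0" using \<open>S x = 0\<close> ac S1 by (simp add: S.zero)
    then have "c \<in> span B0" using cU spB0 U0_def by auto
    then show ?thesis using disj[OF _ ac(3)] a0 ac(1) by simp
  qed
  have Sinj': "inj_on S (span B)" using Sinj S.inj_on_iff_eq_0[OF subspace_span] by blast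
  have indS: "independent (S ` B)"
    using p.linear_independent_injective_image[OF S(1) B(3) Sinj'] .
  have cardS: "card (S ` B) = card B"
    using Sinj' by (intro card_image) (meson inj_on_subset span_superset)
  (* If u were nonzero, it could start a basis B' of U, and T ` U would be spanned by the
      images of the other elements of B', too few for the independent set S ` B. *)
  have nd: "independent {u}" using \<open>u \<noteq> 0\<close> by simp
  obtain B' where B': "{u} \<subseteq> B'" "B' \<subseteq> U" "independent B'" "U \<subseteq> span B'"
    using maximal_independent_subset_extend[of "{u}" U] nd u(1) by blast
  have finB': "finite B'" "card B' \<le> card B"
    using independent_span_bound[OF finB B'(3)] B'(2) B(4) by auto
  have "S b \<in> T ` U" if "b \<in> B" for b
    using S(2)[OF that] that B(2) sub by (cases "b \<in> B0") auto
  then have "S ` B \<subseteq> T ` U" by auto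
  also have "T ` U \<subseteq> span (T ` (B' - {u}))"
  proof -
    have "T ` U \<subseteq> T ` span B'" using B'(4) by blast
    also have "\<dots> = span (T ` B')" by (rule T.span_image[symmetric])
    also have "T ` B' = insert 0 (T ` (B' - {u}))" using B'(1) u(2) by (auto simp: image_iff)
    finally show ?thesis by simp
  qed
  finally have "card (S ` B) \<le> card (T ` (B' - {u}))"
    using independent_span_bound[OF _ indS] finB'(1) by auto
  also have "\<dots> \<le> card (B' - {u})" using finB'(1) by (intro card_image_le) auto
  also have "\<dots> < card B'" using B'(1) finB'(1) by (intro psubset_card_mono) auto
  finally show False using cardS finB'(2) by simp
qed

section \<open>Polynomial functions\<close>

text \<open>
  Polynomial functions with coordinates in \<open>E\<close>, and a bound on the degree. Functions are
  more convenient than formal polynomials as long as the arguments restrict them to lines and substitute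
  into them; over an infinite field nothing is lost.
\<close>

inductive is_pol :: "'e set \<Rightarrow> nat \<Rightarrow> (('e \<Rightarrow> 'f::comm_ring_1) \<Rightarrow> 'f) \<Rightarrow> bool" for E :: "'e set" where
  const: "is_pol E k (\<lambda>w. c)"
| add: "is_pol E k f \<Longrightarrow> is_pol E k g \<Longrightarrow> is_pol E k (\<lambda>w. f w + g w)"
| var: "e \<in> E \<Longrightarrow> is_pol E k f \<Longrightarrow> is_pol E (Suc k) (\<lambda>w. w e * f w)"

definition pol :: "'e set \<Rightarrow> nat \<Rightarrow> (('e \<Rightarrow> 'f::comm_ring_1) \<Rightarrow> 'f) set" where
  "pol E k = {f. is_pol E k f}"

lemma pol_const: "(\<lambda>w. c) \<in> pol E k"
  and pol_add: "f \<in> pol E k \<Longrightarrow> g \<in> pol E k \<Longrightarrow> (\<lambda>w. f w + g w) \<in> pol E k"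
  and pol_var: "e \<in> E \<Longrightarrow> f \<in> pol E k \<Longrightarrow> (\<lambda>w. w e * f w) \<in> pol E (Suc k)"
  by (auto simp: pol_def intro: is_pol.intros)

lemmas pol_intros = pol_const pol_add pol_var

lemma pol_induct [consumes 1, case_names const add var]:
  assumes "f \<in> pol E k" and "\<And>k c. P k (\<lambda>w. c)"
    and "\<And>k f g. f \<in> pol E k \<Longrightarrow> P k f \<Longrightarrow> g \<in> pol E k \<Longrightarrow> P k g \<Longrightarrow> P k (\<lambda>w. f w + g w)"
    and "\<And>k e f. e \<in> E \<Longrightarrow> f \<in> pol E k \<Longrightarrow> P k f \<Longrightarrow> P (Suc k) (\<lambda>w. w e * f w)"
  shows "P k f"
proof -
  have "is_pol E k f" using assms(1) by (simp add: pol_def)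
  then show ?thesis
    by (induction rule: is_pol.induct) (use assms(2-) in \<open>auto simp: pol_def\<close>)
qed

definition polyfun :: "'e set \<Rightarrow> (('e \<Rightarrow> 'f::comm_ring_1) \<Rightarrow> 'f) set" where
  "polyfun E = (\<Union>k. pol E k)"

lemma polyfunI: "f \<in> pol E k \<Longrightarrow> f \<in> polyfun E"
  by (auto simp: polyfun_def)

lemma polyfunE: assumes "f \<in> polyfun E" obtains k where "f \<in> pol E k"
  using assms by (auto simp: polyfun_def)

lemma pol_Suc: "f \<in> pol E k \<Longrightarrow> f \<in> pol E (Suc k)"
  by (induction rule: pol_induct) (auto intro: pol_intros)

lemma pol_mono: "f \<in> pol E k \<Longrightarrow> k \<le> l \<Longrightarrow> f \<in> pol E l"
  by (rule dec_induct[of k l]) (auto intro: pol_Suc)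

lemma pol_cmult: "f \<in> pol E k \<Longrightarrow> (\<lambda>w. c * f w) \<in> pol E k"
proof (induction rule: pol_induct)
  case (const k d)
  then show ?case by (rule pol_const)
next
  case (add k f g)
  then show ?case using pol_add by (fastforce simp: distrib_left)
next
  case (var k e f)
  have "(\<lambda>w. w e * (c * f w)) \<in> pol E (Suc k)" using var by (intro pol_var)
  then show ?case by (simp add: mult.left_commute)
qed

lemma pol_mult: "f \<in> pol E k \<Longrightarrow> g \<in> pol E l \<Longrightarrow> (\<lambda>w. f w * g w) \<in> pol E (k + l)"
proof (induction rule: pol_induct)
  case (const k d)
  then show ?case by (intro pol_mono[OF pol_cmult[of g E l]]) auto
next
  case (add k f f')
  have "(\<lambda>w. f w * g w + f' w * g w) \<in> pol E (k + l)" using add by (intro pol_add)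
  then show ?case by (simp add: distrib_right)
next
  case (var k e f)
  have "(\<lambda>w. w e * (f w * g w)) \<in> pol E (Suc (k + l))" using var by (intro pol_var)
  then show ?case by (simp add: mult.assoc)
qed

lemma pol_sum: "finite I \<Longrightarrow> (\<And>i. i \<in> I \<Longrightarrow> f i \<in> pol E k) \<Longrightarrow> (\<lambda>w. \<Sum>i\<in>I. f i w) \<in> pol E k"
proof (induction I rule: finite_induct)
  case empty
  show ?case by (simp add: pol_const)
next
  case (insert i I)
  then have "(\<lambda>w. f i w + (\<Sum>i\<in>I. f i w)) \<in> pol E k" by (intro pol_add) auto
  then show ?case using insert(1,2) by simp
qed

lemma pol_cong_coords: "f \<in> pol E k \<Longrightarrow> (\<And>e. e \<in> E \<Longrightarrow> w e = w' e) \<Longrightarrow> f w = f w'"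
  by (induction rule: pol_induct) auto

lemma pol_coord: "e \<in> E \<Longrightarrow> (\<lambda>w. w e) \<in> pol E (Suc 0)"
  using pol_var[of e E "\<lambda>w. 1" 0] by (simp add: pol_const)

lemma polyfun_const: "(\<lambda>w. c) \<in> polyfun E"
  by (rule polyfunI[of _ _ 0]) (rule pol_const)

lemma polyfun_coord: "e \<in> E \<Longrightarrow> (\<lambda>w. w e) \<in> polyfun E"
  by (rule polyfunI) (rule pol_coord)

lemma polyfun_add:
  assumes "f \<in> polyfun E" "g \<in> polyfun E"
  shows "(\<lambda>w. f w + g w) \<in> polyfun E"
proof -
  obtain k l where "f \<in> pol E k" "g \<in> pol E l" using assms polyfun_def by blast
  then have "f \<in> pol E (max k l)" "g \<in> pol E (max k l)" by (auto intro: pol_mono)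
  then show ?thesis by (intro polyfunI[OF pol_add])
qed

lemma polyfun_mult: "f \<in> polyfun E \<Longrightarrow> g \<in> polyfun E \<Longrightarrow> (\<lambda>w. f w * g w) \<in> polyfun E"
  by (elim polyfunE) (rule polyfunI, rule pol_mult)

lemma polyfun_sum: "finite I \<Longrightarrow> (\<And>i. i \<in> I \<Longrightarrow> f i \<in> polyfun E) \<Longrightarrow> (\<lambda>w. \<Sum>i\<in>I. f i w) \<in> polyfun E"
proof (induction I rule: finite_induct)
  case empty
  show ?case by (simp add: polyfun_const)
next
  case (insert i I)
  then have "(\<lambda>w. f i w + (\<Sum>i\<in>I. f i w)) \<in> polyfun E" by (intro polyfun_add) auto
  then show ?case using insert(1,2) by simp
qed

lemma polyfun_diff: "f \<in> polyfun E \<Longrightarrow> g \<in> polyfun E \<Longrightarrow> (\<lambda>w. f w - g w) \<in> polyfun E"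
  using polyfun_add[of f E "\<lambda>w. (-1) * g w"] polyfun_mult[OF polyfun_const[of "-1"], of g E] by simp

lemma polyfun_induct [consumes 1, case_names const coord add mult]:
  assumes "f \<in> polyfun E" and "\<And>c. P (\<lambda>w. c)" and "\<And>e. e \<in> E \<Longrightarrow> P (\<lambda>w. w e)"
    and "\<And>f g. f \<in> polyfun E \<Longrightarrow> g \<in> polyfun E \<Longrightarrow> P f \<Longrightarrow> P g \<Longrightarrow> P (\<lambda>w. f w + g w)"
    and "\<And>f g. f \<in> polyfun E \<Longrightarrow> g \<in> polyfun E \<Longrightarrow> P f \<Longrightarrow> P g \<Longrightarrow> P (\<lambda>w. f w * g w)"
  shows "P f"
proof -
  obtain k where "f \<in> pol E k" using assms(1) polyfun_def by blast
  then show ?thesis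
  proof (induction rule: pol_induct)
    case (const k c) then show ?case by (rule assms(2))
  next
    case (add k f g)
    have "f \<in> polyfun E" "g \<in> polyfun E" using add by (auto simp: polyfun_def)
    then show ?case using add by (intro assms(4)) auto
  next
    case (var k e f)
    have "f \<in> polyfun E" using var by (auto simp: polyfun_def)
    with polyfun_coord[OF var(1)] show ?case using assms(3)[OF var(1)] var(3) by (rule assms(5))
  qed
qed

lemma polyfun_cong_coords: "f \<in> polyfun E \<Longrightarrow> (\<And>e. e \<in> E \<Longrightarrow> w e = w' e) \<Longrightarrow> f w = f w'"
  by (elim polyfunE) (rule pol_cong_coords)

lemma polyfun_subst:
  assumes "f \<in> polyfun E" and a: "\<And>e. e \<in> E \<Longrightarrow> a e \<in> polyfun E'"
  shows "(\<lambda>w. f (\<lambda>e. a e w)) \<in> polyfun E'"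
  using assms(1)
proof (induction rule: polyfun_induct)
  case (const c)
  show ?case by (rule polyfun_const)
next
  case (coord e)
  then show ?case using a by simp
next
  case (add f g)
  show ?case by (rule polyfun_add[OF add(3,4)])
next
  case (mult f g)
  show ?case by (rule polyfun_mult[OF mult(3,4)])
qed

interpretation fs: vector_space "\<lambda>(c::'f::field) (g :: 'x \<Rightarrow> 'f) x. c * g x"
  by unfold_locales (auto simp: fun_eq_iff algebra_simps)

text \<open>
  The bound on the degree is there for the sake of this finiteness, on which the dimension count in the
  proof of injectivity rests.
\<close>

lemma pol_finite_dimensional:
  assumes "finite E"
  shows "\<exists>M. finite M \<and> (pol E k :: (('e \<Rightarrow> 'f::field) \<Rightarrow> 'f) set) \<subseteq> fs.span M"
proof (induction k)
  case 0
  have "f \<in> fs.span {\<lambda>w. 1}" if "f \<in> pol E l" "l = 0" for f :: "('e \<Rightarrow> 'f) \<Rightarrow> 'f" and l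
    using that
  proof (induction rule: pol_induct)
    case (const k c)
    have "(\<lambda>w. c * (\<lambda>w. 1) w) \<in> fs.span {\<lambda>w. 1}" by (intro fs.span_scale fs.span_base) auto
    then show ?case by simp
  next
    case (add k f g)
    then show ?case using fs.span_add[of f _ g] by (auto simp: plus_fun_def)
  qed auto
  then show ?case by blast
next
  case (Suc k)
  then obtain M :: "(('e \<Rightarrow> 'f) \<Rightarrow> 'f) set" where M: "finite M" "pol E k \<subseteq> fs.span M" by blast
  define M' where "M' = M \<union> (\<lambda>(e, m). \<lambda>w. w e * m w) ` (E \<times> M)"
  have mult: "(\<lambda>w. w e * f w) \<in> fs.span M'" if "e \<in> E" "f \<in> fs.span M" for e f
    using that(2)
  proof (induction rule: fs.span_induct_alt)
    case base
    then show ?case using fs.span_zero[of M'] by (simp add: zero_fun_def)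
  next
    case (step c x y)
    have "(\<lambda>w. w e * x w) \<in> M'" using step(1) that(1) unfolding M'_def by force
    then have "(\<lambda>w. c * (w e * x w)) + (\<lambda>w. w e * y w) \<in> fs.span M'"
      using fs.span_scale[OF fs.span_base] step(2) by (intro fs.span_add) auto
    then show ?case by (simp add: plus_fun_def algebra_simps)
  qed
  have "f \<in> fs.span M'" if "f \<in> pol E l" "l = Suc k" for f l
    using that
  proof (induction rule: pol_induct)
    case (const l c)
    have "(\<lambda>w. c) \<in> fs.span M" using M(2) pol_const by blast
    then show ?case using fs.span_mono[of M M'] M'_def by blast
  next
    case (add l f g)
    then show ?case using fs.span_add[of f _ g] by (auto simp: plus_fun_def)
  next
    case (var l e f)
    then show ?case using mult M(2) by auto
  qed
  moreover have "finite M'" using M(1) assms M'_def by auto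
  ultimately show ?case by blast
qed

text \<open>
  Collecting powers of a new variable \<open>z\<close>. With \<open>b\<close> a constant direction this
  is the expansion along a line; with \<open>a\<close> and \<open>b\<close> chosen to replace one
  coordinate it expands in powers of a linear form.
\<close>

lemma polyfun_expand:
  assumes "g \<in> polyfun E" "\<And>e. e \<in> E \<Longrightarrow> a e \<in> polyfun E'" "\<And>e. e \<in> E \<Longrightarrow> b e \<in> polyfun E'"
  shows "\<exists>J G. (\<forall>j. G j \<in> polyfun E') \<and> (\<forall>w z. g (\<lambda>e. a e w + b e w * z) = (\<Sum>j\<le>J. G j w * z ^ j))"
  using assms(1)
proof (induction rule: polyfun_induct)
  case (const c)
  show ?case
    by (rule exI[of _ 0], rule exI[of _ "\<lambda>j w. c"]) (auto intro: polyfun_const)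
next
  case (coord e)
  show ?case
    by (rule exI[of _ 1], rule exI[of _ "\<lambda>j. if j = 0 then a e else b e"]) (use coord assms in auto)
next
  case (add f g)
  then obtain J G J' G' where *: "\<And>j. G j \<in> polyfun E'" "\<And>w z. f (\<lambda>e. a e w + b e w * z) = (\<Sum>j\<le>J. G j w * z ^ j)"
    "\<And>j. G' j \<in> polyfun E'" "\<And>w z. g (\<lambda>e. a e w + b e w * z) = (\<Sum>j\<le>J'. G' j w * z ^ j)" by metis
  define H where "H j w = (if j \<le> J then G j w else 0) + (if j \<le> J' then G' j w else 0)" for j w
  have "H j \<in> polyfun E'" for j
    unfolding H_def using *(1,3) by (cases "j \<le> J"; cases "j \<le> J'") (auto intro: polyfun_const polyfun_add)
  moreover have "f (\<lambda>e. a e w + b e w * z) + g (\<lambda>e. a e w + b e w * z) = (\<Sum>j\<le>max J J'. H j w * z ^ j)" for w z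
  proof -
    have "(\<Sum>j\<le>J. G j w * z ^ j) = (\<Sum>j\<le>max J J'. (if j \<le> J then G j w else 0) * z ^ j)"
      by (rule sum.mono_neutral_cong_left) auto
    moreover have "(\<Sum>j\<le>J'. G' j w * z ^ j) = (\<Sum>j\<le>max J J'. (if j \<le> J' then G' j w else 0) * z ^ j)"
      by (rule sum.mono_neutral_cong_left) auto
    ultimately show ?thesis by (simp add: * H_def distrib_right sum.distrib)
  qed
  ultimately show ?case by blast
next
  case (mult f g)
  then obtain J G J' G' where *: "\<And>j. G j \<in> polyfun E'" "\<And>w z. f (\<lambda>e. a e w + b e w * z) = (\<Sum>j\<le>J. G j w * z ^ j)"
    "\<And>j. G' j \<in> polyfun E'" "\<And>w z. g (\<lambda>e. a e w + b e w * z) = (\<Sum>j\<le>J'. G' j w * z ^ j)" by metis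
  define H where "H k w = (\<Sum>(i,j)\<in>{(i,j). i \<le> J \<and> j \<le> J' \<and> i + j = k}. G i w * G' j w)" for k w
  have fin: "finite {(i,j). i \<le> J \<and> j \<le> J' \<and> i + j = k}" for k
    by (rule finite_subset[of _ "{..J} \<times> {..J'}"]) auto
  have "H k \<in> polyfun E'" for k
  proof -
    have "(\<lambda>w. \<Sum>x\<in>{(i,j). i \<le> J \<and> j \<le> J' \<and> i + j = k}. G (fst x) w * G' (snd x) w) \<in> polyfun E'"
      using *(1,3) by (intro polyfun_sum[OF fin] polyfun_mult) auto
    then show ?thesis by (simp add: H_def[abs_def] case_prod_unfold)
  qed
  moreover have "f (\<lambda>e. a e w + b e w * z) * g (\<lambda>e. a e w + b e w * z) = (\<Sum>j\<le>J+J'. H j w * z ^ j)" for w z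
  proof -
    have "(\<Sum>i\<le>J. G i w * z ^ i) * (\<Sum>j\<le>J'. G' j w * z ^ j)
      = (\<Sum>(i,j)\<in>{..J} \<times> {..J'}. G i w * G' j w * z ^ (i + j))"
      by (simp add: sum_product sum.cartesian_product power_add mult.assoc mult.left_commute)
    also have "\<dots> = (\<Sum>k\<le>J+J'. \<Sum>(i,j)\<in>{x \<in> {..J} \<times> {..J'}. (case x of (i,j) \<Rightarrow> i + j) = k}. G i w * G' j w * z ^ (i + j))"
      by (rule sum.group[symmetric]) auto
    also have "\<dots> = (\<Sum>k\<le>J+J'. H k w * z ^ k)"
    proof (rule sum.cong[OF refl])
      fix k
      have "{x \<in> {..J} \<times> {..J'}. (case x of (i,j) \<Rightarrow> i + j) = k} = {(i,j). i \<le> J \<and> j \<le> J' \<and> i + j = k}" by auto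
      then show "(\<Sum>(i,j)\<in>{x \<in> {..J} \<times> {..J'}. (case x of (i,j) \<Rightarrow> i + j) = k}. G i w * G' j w * z ^ (i + j)) = H k w * z ^ k"
        unfolding H_def sum_distrib_right by (auto intro!: sum.cong)
    qed
    finally show ?thesis by (simp add: *)
  qed
  ultimately show ?case by blast
qed

section \<open>Zonotopal polynomials of a subspace of coordinate space\<close>

definition perp :: "'e set \<Rightarrow> ('e \<Rightarrow> 'f::field) set \<Rightarrow> ('e \<Rightarrow> 'f) set" where
  "perp E D = {\<alpha>. \<forall>t\<in>D. (\<Sum>e\<in>E. \<alpha> e * t e) = 0}"

definition supp :: "'e set \<Rightarrow> ('e \<Rightarrow> 'f::zero) \<Rightarrow> 'e set" where
  "supp E \<alpha> = {e \<in> E. \<alpha> e \<noteq> 0}"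

text \<open>
  The reciprocal plane of \<open>D\<close>: coordinatewise inverses of the points of \<open>D\<close>
  that have no zero coordinate in \<open>E\<close>. It is empty if some coordinate vanishes on all of
  \<open>D\<close>.
\<close>

definition recip :: "'e set \<Rightarrow> ('e \<Rightarrow> 'f::field) set \<Rightarrow> ('e \<Rightarrow> 'f) set" where
  "recip E D = {w. \<exists>t\<in>D. \<forall>e\<in>E. w e * t e = 1}"

definition deg_less :: "nat \<Rightarrow> ('f::field_char_0 \<Rightarrow> 'f) \<Rightarrow> bool" where
  "deg_less k r \<longleftrightarrow> (\<exists>q. (\<forall>s. r s = poly q s) \<and> (\<forall>i\<ge>k. coeff q i = 0))"

text \<open>
  For \<open>E' = E\<close> these are the polynomials on the whole coordinate space that behave, along
  the lines in directions orthogonal to \<open>D\<close>, as the elements of the internal space do: on a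
  line in direction \<open>\<alpha>\<close> the degree is smaller than the size of the support of
  \<open>\<alpha>\<close> minus one, and a support of size one forces the value zero. Allowing a smaller
  \<open>E'\<close> is needed for the quotient of such a polynomial by a coordinate, whose degree bounds
  no longer count that coordinate.
\<close>

definition zonotopal_rel :: "'e set \<Rightarrow> 'e set \<Rightarrow> ('e \<Rightarrow> 'f::field_char_0) set \<Rightarrow> (('e \<Rightarrow> 'f) \<Rightarrow> 'f) set" where
  "zonotopal_rel E E' D = {F \<in> polyfun E. \<forall>\<alpha>\<in>perp E D. supp E' \<alpha> \<noteq> {} \<longrightarrow>
     (\<forall>w. deg_less (card (supp E' \<alpha>) - 1) (\<lambda>s. F (\<lambda>e. w e + \<alpha> e * s)))}"

abbreviation zonotopal :: "'e set \<Rightarrow> ('e \<Rightarrow> 'f::field_char_0) set \<Rightarrow> (('e \<Rightarrow> 'f) \<Rightarrow> 'f) set" where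
  "zonotopal E D \<equiv> zonotopal_rel E E D"

lemma deg_less_0: "deg_less 0 r \<longleftrightarrow> (\<forall>s. r s = 0)"
proof -
  have "q = 0" if "\<forall>i. coeff q i = 0" for q :: "'a poly" using that by (simp add: poly_eqI)
  then show ?thesis unfolding deg_less_def by (metis coeff_0 poly_0 le0)
qed

lemma deg_less_zero: "deg_less k (\<lambda>s. 0)"
  unfolding deg_less_def by (rule exI[of _ 0]) simp

lemma deg_less_const: "deg_less (Suc k) (\<lambda>s. c)"
  unfolding deg_less_def by (rule exI[of _ "[:c:]"]) (auto simp: coeff_pCons split: nat.splits)

lemma deg_less_mono: "deg_less k r \<Longrightarrow> k \<le> l \<Longrightarrow> deg_less l r"
  unfolding deg_less_def by (meson order_trans)

lemma deg_less_add: "deg_less k r \<Longrightarrow> deg_less k r' \<Longrightarrow> deg_less k (\<lambda>s. r s + r' s)"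
  unfolding deg_less_def
  by (elim exE, rename_tac q q', rule_tac x = "q + q'" in exI) auto

lemma deg_less_cmult: "deg_less k r \<Longrightarrow> deg_less k (\<lambda>s. c * r s)"
  unfolding deg_less_def
  by (elim exE, rename_tac q, rule_tac x = "smult c q" in exI) auto

lemma deg_less_affine: "deg_less k r \<Longrightarrow> deg_less (Suc k) (\<lambda>s. r s * (a + b * s))"
  unfolding deg_less_def
proof (elim exE conjE)
  fix q assume q: "\<forall>s. r s = poly q s" "\<forall>i\<ge>k. coeff q i = 0"
  show "\<exists>q. (\<forall>s. r s * (a + b * s) = poly q s) \<and> (\<forall>i\<ge>Suc k. coeff q i = 0)"
    by (rule exI[of _ "[:a, b:] * q"])
       (use q in \<open>auto simp: algebra_simps coeff_pCons split: nat.splits\<close>)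
qed

lemma deg_less_unaffine:
  assumes "deg_less (Suc k) (\<lambda>s. (a + b * s) * r s)" "b \<noteq> 0" "\<And>s. r s = poly q s"
  shows "deg_less k r"
proof -
  obtain p where p: "\<And>s. (a + b * s) * r s = poly p s" "\<And>i. i \<ge> Suc k \<Longrightarrow> coeff p i = 0"
    using assms(1) unfolding deg_less_def by blast
  have "poly ([:a, b:] * q) s = poly p s" for s
    using p(1)[of s] assms(3) by (simp add: algebra_simps)
  then have eq: "[:a, b:] * q = p" by (simp add: poly_eq_poly_eq_iff[symmetric] fun_eq_iff)
  have "coeff q i = 0" if "i \<ge> k" for i
  proof (cases "q = 0")
    case False
    then have "degree p = Suc (degree q)"
      using assms(2) degree_mult_eq[of "[:a, b:]" q] unfolding eq by simp
    moreover have "p \<noteq> 0" using calculation by auto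
    ultimately have "Suc (degree q) < Suc k"
      using p(2)[of "degree p"] leading_coeff_0_iff[of p] by (cases "Suc k \<le> degree p") (auto simp del: leading_coeff_0_iff)
    then show ?thesis using that by (auto intro!: coeff_eq_0)
  qed auto
  then show ?thesis unfolding deg_less_def using assms(3) by blast
qed

lemma polyfun_line: "F \<in> polyfun E \<Longrightarrow> \<exists>q. \<forall>s. F (\<lambda>e. w e + \<alpha> e * s) = poly q s"
proof (induction rule: polyfun_induct)
  case (const c)
  show ?case by (rule exI[of _ "[:c:]"]) simp
next
  case (coord e)
  show ?case by (rule exI[of _ "[:w e, \<alpha> e:]"]) (simp add: mult.commute)
next
  case (add f g)
  then show ?case by (metis poly_add)
next
  case (mult f g)
  then show ?case by (metis poly_mult)
qed

lemma sum_powers_eq_0: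
  fixes c :: "nat \<Rightarrow> 'f::field_char_0"
  assumes "\<And>z. (\<Sum>j\<le>J. c j * z ^ j) = 0" "j \<le> J"
  shows "c j = 0"
proof -
  have "poly (\<Sum>j\<le>J. monom (c j) j) z = 0" for z
    using assms(1) by (simp add: poly_sum poly_monom)
  then have "(\<Sum>j\<le>J. monom (c j) j) = 0" using poly_all_0_iff_0 by blast
  then have "coeff (\<Sum>j\<le>J. monom (c j) j) j = 0" by simp
  then show ?thesis using assms(2) by (simp add: coeff_sum)
qed

lemma zonotopal_relI:
  assumes "F \<in> polyfun E"
    and "\<And>\<alpha> w. \<alpha> \<in> perp E D \<Longrightarrow> supp E' \<alpha> \<noteq> {} \<Longrightarrow> deg_less (card (supp E' \<alpha>) - 1) (\<lambda>s. F (\<lambda>e. w e + \<alpha> e * s))"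
  shows "F \<in> zonotopal_rel E E' D"
  using assms unfolding zonotopal_rel_def by blast

lemma zonotopal_relD:
  assumes "F \<in> zonotopal_rel E E' D" "\<alpha> \<in> perp E D" "supp E' \<alpha> \<noteq> {}"
  shows "deg_less (card (supp E' \<alpha>) - 1) (\<lambda>s. F (\<lambda>e. w e + \<alpha> e * s))"
  using assms unfolding zonotopal_rel_def by blast

lemma zonotopal_rel_polyfun: "F \<in> zonotopal_rel E E' D \<Longrightarrow> F \<in> polyfun E"
  unfolding zonotopal_rel_def by blast

lemma zonotopal_rel_zero: "(\<lambda>w. 0) \<in> zonotopal_rel E E' D"
  by (auto intro!: zonotopal_relI polyfun_const deg_less_zero)

lemma zonotopal_rel_add: "F \<in> zonotopal_rel E E' D \<Longrightarrow> G \<in> zonotopal_rel E E' D \<Longrightarrow> (\<lambda>w. F w + G w) \<in> zonotopal_rel E E' D"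
  by (rule zonotopal_relI, rule polyfun_add, erule zonotopal_rel_polyfun, erule zonotopal_rel_polyfun, rule deg_less_add, erule (2) zonotopal_relD, erule (2) zonotopal_relD)

lemma zonotopal_rel_cmult: "F \<in> zonotopal_rel E E' D \<Longrightarrow> (\<lambda>w. c * F w) \<in> zonotopal_rel E E' D"
  by (rule zonotopal_relI, rule polyfun_mult[OF polyfun_const], erule zonotopal_rel_polyfun, rule deg_less_cmult, erule (2) zonotopal_relD)

text \<open>
  A linear form with coefficient vector in \<open>D\<close> is constant on lines orthogonal to
  \<open>D\<close>. So zonotopal polynomials are a module over the polynomials in these forms.
\<close>

lemma zonotopal_rel_mult_form:
  assumes "finite E" "F \<in> zonotopal_rel E E' D" "p \<in> D"
  shows "(\<lambda>w. (\<Sum>e\<in>E. p e * w e) * F w) \<in> zonotopal_rel E E' D"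
proof (rule zonotopal_relI)
  show "(\<lambda>w. (\<Sum>e\<in>E. p e * w e) * F w) \<in> polyfun E"
    using assms by (intro polyfun_mult polyfun_sum polyfun_const polyfun_coord zonotopal_rel_polyfun[of F]) auto
next
  fix \<alpha> w assume *: "\<alpha> \<in> perp E D" "supp E' \<alpha> \<noteq> {}"
  have "(\<Sum>e\<in>E. p e * (w e + \<alpha> e * s)) = (\<Sum>e\<in>E. p e * w e)" for s
  proof -
    have "(\<Sum>e\<in>E. p e * (w e + \<alpha> e * s)) = (\<Sum>e\<in>E. p e * w e) + (\<Sum>e\<in>E. \<alpha> e * p e) * s"
      by (simp add: algebra_simps sum.distrib sum_distrib_left)
    then show ?thesis using *(1) assms(3) by (simp add: perp_def)
  qed
  then show "deg_less (card (supp E' \<alpha>) - 1) (\<lambda>s. (\<Sum>e\<in>E. p e * (w e + \<alpha> e * s)) * F (\<lambda>e. w e + \<alpha> e * s))"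
    using deg_less_cmult[OF zonotopal_relD[OF assms(2) *]] by simp
qed

section \<open>Zonotopal representatives on the reciprocal plane\<close>

subsection \<open>Closure and independence\<close>

text \<open>
  Elements of \<open>D\<close> are read as points whose coordinates are linear forms on
  \<open>D\<close>. This is the closure operator of the matroid of these forms.
\<close>

definition cl :: "'e set \<Rightarrow> ('e \<Rightarrow> 'f::field) set \<Rightarrow> 'e set \<Rightarrow> 'e set" where
  "cl E D Y = {f \<in> E. \<exists>c. \<forall>t\<in>D. t f = (\<Sum>y\<in>Y. c y * t y)}"

text \<open>
  Points of \<open>D\<close> dual to the coordinates in \<open>Y\<close>; such a family exists exactly
  if these coordinates are linearly independent as forms on \<open>D\<close>. Independence is expressed
  by the existence of the family because all later computations use its members.
\<close>

definition dual_family :: "'e set \<Rightarrow> ('e \<Rightarrow> 'f::field) set \<Rightarrow> 'e set \<Rightarrow> ('e \<Rightarrow> 'e \<Rightarrow> 'f) \<Rightarrow> bool" where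
  "dual_family E D Y p \<longleftrightarrow> Y \<subseteq> E \<and> (\<forall>y\<in>Y. p y \<in> D \<and> (\<forall>z\<in>Y. p y z = (if y = z then 1 else 0)))"

definition indep :: "'e set \<Rightarrow> ('e \<Rightarrow> 'f::field) set \<Rightarrow> 'e set \<Rightarrow> bool" where
  "indep E D Y \<longleftrightarrow> (\<exists>p. dual_family E D Y p)"

lemma fs_sum_apply: "(\<Sum>i\<in>I. (g i :: 'x \<Rightarrow> 'f::comm_monoid_add)) x = (\<Sum>i\<in>I. g i x)"
  by (induction I rule: infinite_finite_induct) auto

locale arrangement =
  fixes E :: "'e set" and D :: "('e \<Rightarrow> 'f::field_char_0) set"
  assumes finE: "finite E" and subD: "fs.subspace D" and nz: "\<And>e. e \<in> E \<Longrightarrow> \<exists>t\<in>D. t e \<noteq> 0"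
begin

abbreviation "C \<equiv> cl E D"
abbreviation "I \<equiv> indep E D"
abbreviation "R \<equiv> recip E D"

text \<open>
  The linear form \<open>\<Sum>e. p e * w e\<close> of a point \<open>p\<close>, truncated to the
  coordinates in \<open>F\<close>.
\<close>

definition trunc :: "'e set \<Rightarrow> ('e \<Rightarrow> 'f) \<Rightarrow> ('e \<Rightarrow> 'f) \<Rightarrow> 'f" where
  "trunc F p w = (\<Sum>e\<in>F. p e * w e)"

lemma C_I: "f \<in> E \<Longrightarrow> (\<And>t. t \<in> D \<Longrightarrow> t f = (\<Sum>y\<in>Y. c y * t y)) \<Longrightarrow> f \<in> C Y"
  unfolding cl_def by auto

lemma C_E:
  assumes "f \<in> C Y"
  obtains c where "\<And>t. t \<in> D \<Longrightarrow> t f = (\<Sum>y\<in>Y. c y * t y)"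
  using assms unfolding cl_def by auto

lemma C_subset: "C Y \<subseteq> E" by (auto simp: cl_def)

lemma finite_C: "finite (C Y)" using C_subset finE finite_subset by blast

lemma C_member: "y \<in> Y \<Longrightarrow> Y \<subseteq> E \<Longrightarrow> y \<in> C Y"
proof -
  assume *: "y \<in> Y" "Y \<subseteq> E"
  then have "finite Y" using finE finite_subset by blast
  then have "t y = (\<Sum>z\<in>Y. (if z = y then 1 else 0) * t z)" for t :: "'e \<Rightarrow> 'f"
    using *(1) by (subst sum.remove[of _ y]) (auto intro!: sum.neutral)
  then show ?thesis using * by (intro C_I) auto
qed

lemma C_superset: "Y \<subseteq> E \<Longrightarrow> Y \<subseteq> C Y"
  using C_member by blast

lemma C_trans: "f \<in> C Y \<Longrightarrow> Y \<subseteq> C Z \<Longrightarrow> f \<in> C Z"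
proof -
  assume f: "f \<in> C Y" and YZ: "Y \<subseteq> C Z"
  obtain c where c: "\<And>t. t \<in> D \<Longrightarrow> t f = (\<Sum>y\<in>Y. c y * t y)" using C_E[OF f] by blast
  obtain d where d: "\<And>y t. y \<in> Y \<Longrightarrow> t \<in> D \<Longrightarrow> t y = (\<Sum>z\<in>Z. d y z * t z)"
  proof -
    have "\<forall>y\<in>Y. \<exists>d. \<forall>t\<in>D. t y = (\<Sum>z\<in>Z. d z * t z)" using YZ unfolding cl_def by auto
    then show thesis using that by (metis (no_types))
  qed
  have "t f = (\<Sum>z\<in>Z. (\<Sum>y\<in>Y. c y * d y z) * t z)" if t: "t \<in> D" for t
  proof -
    have "t f = (\<Sum>y\<in>Y. c y * (\<Sum>z\<in>Z. d y z * t z))" using c[OF t] d[OF _ t] by simp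
    also have "\<dots> = (\<Sum>y\<in>Y. \<Sum>z\<in>Z. c y * d y z * t z)" by (simp add: sum_distrib_left mult.assoc)
    also have "\<dots> = (\<Sum>z\<in>Z. \<Sum>y\<in>Y. c y * d y z * t z)" by (rule sum.swap)
    finally show ?thesis by (simp add: sum_distrib_right)
  qed
  then show ?thesis using f C_subset by (intro C_I) auto
qed

lemma C_mono: "Y \<subseteq> C Z \<Longrightarrow> C Y \<subseteq> C Z"
  using C_trans by blast

lemma C_subset_mono: "Y \<subseteq> Z \<Longrightarrow> Z \<subseteq> E \<Longrightarrow> C Y \<subseteq> C Z"
  using C_mono C_superset by blast

lemma dual_family_subset: "dual_family E D Y p \<Longrightarrow> Y' \<subseteq> Y \<Longrightarrow> dual_family E D Y' p"
  unfolding dual_family_def by blast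

lemma dual_family_C: "dual_family E D Y p \<Longrightarrow> f \<in> C Y \<Longrightarrow> t \<in> D \<Longrightarrow> t f = (\<Sum>y\<in>Y. p y f * t y)"
proof -
  assume p: "dual_family E D Y p" and f: "f \<in> C Y" and t: "t \<in> D"
  have fin: "finite Y" using p finE finite_subset unfolding dual_family_def by blast
  obtain c where c: "\<And>t. t \<in> D \<Longrightarrow> t f = (\<Sum>y\<in>Y. c y * t y)" using C_E[OF f] by blast
  have "p y f = c y" if "y \<in> Y" for y
  proof -
    have "p y f = (\<Sum>z\<in>Y. c z * p y z)" using p that c unfolding dual_family_def by blast
    also have "\<dots> = (\<Sum>z\<in>Y. if z = y then c z else 0)"
      using p that unfolding dual_family_def by (intro sum.cong) auto
    finally show ?thesis using fin that by simp
  qed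
  then show ?thesis using c[OF t] by simp
qed

lemma D_diff: "s \<in> D \<Longrightarrow> t \<in> D \<Longrightarrow> (\<lambda>e. s e - t e) \<in> D"
  using fs.subspace_diff[OF subD] by (simp add: fun_diff_def)

lemma D_scale: "t \<in> D \<Longrightarrow> (\<lambda>e. c * t e) \<in> D"
  using fs.subspace_scale[OF subD] by simp

lemma D_sum: "(\<And>i. i \<in> S \<Longrightarrow> g i \<in> D) \<Longrightarrow> (\<lambda>e. \<Sum>i\<in>S. g i e) \<in> D"
proof -
  assume "\<And>i. i \<in> S \<Longrightarrow> g i \<in> D"
  then have "(\<Sum>i\<in>S. g i) \<in> D" by (rule fs.subspace_sum[OF subD])
  moreover have "(\<Sum>i\<in>S. g i) = (\<lambda>e. \<Sum>i\<in>S. g i e)" by (simp add: fun_eq_iff fs_sum_apply)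
  ultimately show ?thesis by simp
qed

text \<open>
  The new dual point is a point of \<open>D\<close> on which all coordinates in \<open>Y\<close> vanish
  but the coordinate \<open>f\<close> does not; it exists since \<open>f\<close> is outside the closure.
\<close>

lemma indep_insert:
  assumes "I Y" "f \<in> E" "f \<notin> C Y"
  shows "I (insert f Y)"
proof -
  obtain p where p: "dual_family E D Y p" using assms(1) indep_def by metis
  have YE: "Y \<subseteq> E" using p dual_family_def by metis
  have fin: "finite Y" using YE finE finite_subset by blast
  have fY: "f \<notin> Y" using assms(3) C_member YE by blast
  obtain t where t: "t \<in> D" "t f \<noteq> (\<Sum>y\<in>Y. p y f * t y)"
    using assms(2,3) C_I[where f = f and Y = Y and c = "\<lambda>y. p y f"] by blast
  define u where "u = (\<lambda>e. t e - (\<Sum>y\<in>Y. t y * p y e))"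
  have uD: "u \<in> D"
    unfolding u_def using t(1) p unfolding dual_family_def by (intro D_diff D_sum D_scale) auto
  have uY: "u z = 0" if "z \<in> Y" for z
  proof -
    have "(\<Sum>y\<in>Y. t y * p y z) = (\<Sum>y\<in>Y. if y = z then t y else 0)"
      using p that unfolding dual_family_def by (intro sum.cong) auto
    then show ?thesis using fin that by (simp add: u_def)
  qed
  have uf: "u f \<noteq> 0" using t(2) by (simp add: u_def mult.commute)
  define q where "q = (\<lambda>e. u e / u f)"
  have qD: "q \<in> D" using D_scale[OF uD, of "1 / u f"] by (simp add: q_def)
  define p' where "p' y = (if y = f then q else (\<lambda>e. p y e - p y f * q e))" for y
  have "dual_family E D (insert f Y) p'"
    unfolding dual_family_def
  proof (intro conjI ballI)
    show "insert f Y \<subseteq> E" using assms(2) YE by simp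
    show "p' y \<in> D" if "y \<in> insert f Y" for y
      using that p qD unfolding p'_def dual_family_def by (auto intro!: D_diff D_scale)
    show "p' y z = (if y = z then 1 else 0)" if "y \<in> insert f Y" "z \<in> insert f Y" for y z
      using that p fY uY uf unfolding p'_def dual_family_def q_def by auto
  qed
  then show ?thesis unfolding indep_def by blast
qed

text \<open>
  The condition \<open>p c e \<noteq> 0\<close> says that \<open>c\<close> occurs in the expression of
  \<open>e\<close> by \<open>Y\<close>, so the expression can be solved for \<open>c\<close>.
\<close>

lemma exchange:
  assumes p: "dual_family E D Y p" and c: "c \<in> Y" and e: "e \<in> C Y" "p c e \<noteq> 0"
  shows "e \<notin> C (Y - {c})" "I (insert e (Y - {c}))" "Y \<subseteq> C (insert e (Y - {c}))"
proof -
  have YE: "Y \<subseteq> E" using p dual_family_def by metis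
  have fin: "finite Y" using YE finE finite_subset by blast
  have eE: "e \<in> E" using e C_subset by blast
  have p': "dual_family E D (Y - {c}) p" using dual_family_subset[OF p] by blast
  show n: "e \<notin> C (Y - {c})"
  proof
    assume "e \<in> C (Y - {c})"
    then have "p c e = (\<Sum>y\<in>Y - {c}. p y e * p c y)"
      using dual_family_C[OF p'] p c unfolding dual_family_def by blast
    also have "\<dots> = 0" using p c unfolding dual_family_def by (intro sum.neutral) auto
    finally show False using e by simp
  qed
  show "I (insert e (Y - {c}))" using indep_insert[OF _ eE n] p' indep_def by metis
  have enot: "e \<notin> Y - {c}" using n C_member[of e "Y - {c}"] YE by blast
  have "t c = (\<Sum>z\<in>insert e (Y - {c}). (if z = e then 1 / p c e else - p z e / p c e) * t z)" if "t \<in> D" for t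
  proof -
    have "t e = p c e * t c + (\<Sum>y\<in>Y-{c}. p y e * t y)"
      using dual_family_C[OF p e(1) that] c fin by (simp add: sum.remove)
    then have "t c = (1 / p c e) * t e - (\<Sum>y\<in>Y-{c}. p y e * t y) / p c e"
      using e(2) by (simp add: field_simps)
    also have "\<dots> = (1 / p c e) * t e + (\<Sum>y\<in>Y-{c}. - p y e / p c e * t y)"
      by (simp add: sum_divide_distrib sum_negf)
    also have "(\<Sum>y\<in>Y-{c}. - p y e / p c e * t y)
        = (\<Sum>z\<in>Y - {c}. (if z = e then 1 / p c e else - p z e / p c e) * t z)"
      using enot by (intro sum.cong) auto
    finally show ?thesis using enot fin by simp
  qed
  then have "c \<in> C (insert e (Y - {c}))" using c YE by (intro C_I) auto
  moreover have "insert e (Y - {c}) \<subseteq> E" using YE eE by auto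
  then have "insert e (Y - {c}) \<subseteq> C (insert e (Y - {c}))" by (rule C_superset)
  ultimately show "Y \<subseteq> C (insert e (Y - {c}))" by blast
qed

lemma indep_finite: "I Y \<Longrightarrow> finite Y \<and> Y \<subseteq> E"
  unfolding indep_def dual_family_def using finE finite_subset by blast

text \<open>
  The coordinates, cut off to zero outside \<open>D\<close>, are elements of a vector space of
  functions, where the usual comparison of an independent family with a spanning family applies.
\<close>

lemma indep_card_le:
  assumes "I Z" "finite Y" "Z \<subseteq> C Y"
  shows "card Z \<le> card Y"
proof -
  define psi where "psi f t = (if t \<in> D then t f else 0)" for f and t :: "'e \<Rightarrow> 'f"
  obtain p where p: "dual_family E D Z p" using assms(1) indep_def by metis
  have finZ: "finite Z" using assms(1) indep_finite by blast
  have psi1: "psi y (p z) = (if z = y then 1 else 0)" if "y \<in> Z" "z \<in> Z" for y z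
    using p that unfolding psi_def dual_family_def by auto
  have inj: "inj_on psi Z"
  proof (rule inj_onI)
    fix y z assume yz: "y \<in> Z" "z \<in> Z" "psi y = psi z"
    then have "psi y (p z) = psi z (p z)" by simp
    then have "(if z = y then 1 else 0) = (1::'f)" unfolding psi1[OF yz(1,2)] psi1[OF yz(2,2)] by simp
    then show "y = z" by (simp split: if_splits)
  qed
  have scalars: "g x = 0" if s: "(\<Sum>x\<in>psi ` Z. (\<lambda>t. g x * x t)) = 0" and x: "x \<in> psi ` Z" for g x
  proof -
    obtain z where z: "x = psi z" "z \<in> Z" using x by blast
    have h1: "(\<Sum>x\<in>psi ` Z. g x * x (p z)) = 0"
      using fun_cong[OF s, of "p z"] unfolding fs_sum_apply zero_fun_apply .
    have h2: "(\<Sum>x\<in>psi ` Z. g x * x (p z)) = (\<Sum>y\<in>Z. g (psi y) * psi y (p z))"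
      by (rule sum.reindex_cong[OF inj refl]) (rule refl)
    have h3: "(\<Sum>y\<in>Z. g (psi y) * psi y (p z)) = (\<Sum>y\<in>Z. if y = z then g (psi y) else 0)"
      by (rule sum.cong[OF refl]) (simp add: psi1 z(2))
    have h4: "(\<Sum>y\<in>Z. if y = z then g (psi y) else 0) = g (psi z)"
      using finZ z(2) by (simp only: sum.delta if_True)
    show "g x = 0" unfolding z(1) by (rule trans[OF h4[symmetric] trans[OF h3[symmetric] trans[OF h2[symmetric] h1]]])
  qed
  have ind: "fs.independent (psi ` Z)"
    apply (rule fs.independent_if_scalars_zero)
    subgoal using finZ by simp
    subgoal for g x using scalars[of g x] by blast
    done
  have "psi f \<in> fs.span (psi ` Y)" if f: "f \<in> C Y" for f
  proof -
    obtain c where c: "\<And>t. t \<in> D \<Longrightarrow> t f = (\<Sum>y\<in>Y. c y * t y)" using C_E[OF f] by blast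
    have "psi f = (\<Sum>y\<in>Y. (\<lambda>t. c y * psi y t))"
    proof (rule ext)
      fix t show "psi f t = (\<Sum>y\<in>Y. (\<lambda>t. c y * psi y t)) t"
        unfolding fs_sum_apply psi_def using c[of t] by simp
    qed
    moreover have "(\<Sum>y\<in>Y. (\<lambda>t. c y * psi y t)) \<in> fs.span (psi ` Y)" by (intro fs.span_sum fs.span_scale fs.span_base) auto
    ultimately show ?thesis by simp
  qed
  then have "psi ` Z \<subseteq> fs.span (psi ` Y)" using assms(3) by blast
  then have "card (psi ` Z) \<le> card (psi ` Y)"
    using fs.independent_span_bound[OF _ ind] assms(2) by simp
  also have "\<dots> \<le> card Y" using assms(2) by (rule card_image_le)
  finally show ?thesis using card_image[OF inj] by simp
qed

lemma C_eq_if_card_le: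
  assumes "I Y" "I Z" "card Z \<le> card Y" "Y \<subseteq> C Z"
  shows "C Z \<subseteq> C Y"
proof (rule subsetI, rule ccontr)
  fix z assume z: "z \<in> C Z" "z \<notin> C Y"
  then have "I (insert z Y)" using indep_insert assms(1) C_subset by blast
  moreover have "insert z Y \<subseteq> C Z" using z assms(4) by simp
  ultimately have "card (insert z Y) \<le> card Z" using indep_card_le indep_finite assms(2) by blast
  moreover have "z \<notin> Y" using z C_member indep_finite[OF assms(1)] by blast
  ultimately show False using assms(3) indep_finite[OF assms(1)] by simp
qed

subsection \<open>Reduction of monomials to independent sets\<close>

definition mon :: "'e set \<Rightarrow> ('e \<Rightarrow> 'f) \<Rightarrow> 'f" where
  "mon Y w = (\<Prod>y\<in>Y. w y)"

text \<open>
  At a point \<open>w\<close> with \<open>w e = 1 / t e\<close>, removing \<open>c\<close> from the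
  monomial of \<open>Y\<close> multiplies it by \<open>t c\<close>, and \<open>\<Sum>c\<in>Y. p c f * t
  c = t f\<close> for every \<open>f\<close> in the closure of \<open>Y\<close>. So the right-hand side
  is the sum of \<open>w f * t f = 1\<close> over the closure, times the monomial. This is the analogue
  on the reciprocal plane of the identity of Euler for homogeneous functions. It expresses a monomial by
  smaller ones after division by the size of a flat, which is where characteristic zero enters.
\<close>

lemma euler_identity:
  assumes p: "dual_family E D Y p" and w: "w \<in> R"
  shows "of_nat (card (C Y)) * mon Y w = (\<Sum>c\<in>Y. mon (Y - {c}) w * trunc (C Y) (p c) w)"
proof -
  have YE: "Y \<subseteq> E" using p dual_family_def by metis
  have fin: "finite Y" using YE finE finite_subset by blast
  obtain t where t: "t \<in> D" "\<And>e. e \<in> E \<Longrightarrow> w e * t e = 1" using w unfolding recip_def by blast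
  have m: "mon (Y - {c}) w = mon Y w * t c" if "c \<in> Y" for c
  proof -
    have "mon Y w = w c * mon (Y - {c}) w" unfolding mon_def using fin that by (rule prod.remove)
    moreover have "w c * t c = 1" using t(2) that YE by blast
    ultimately show ?thesis by (metis mult.assoc mult.commute mult.left_neutral)
  qed
  have "(\<Sum>c\<in>Y. mon (Y - {c}) w * trunc (C Y) (p c) w) = (\<Sum>c\<in>Y. \<Sum>f\<in>C Y. mon Y w * (w f * (p c f * t c)))"
    unfolding trunc_def by (intro sum.cong refl) (simp add: m sum_distrib_left mult_ac)
  also have "\<dots> = (\<Sum>f\<in>C Y. mon Y w * (w f * (\<Sum>c\<in>Y. p c f * t c)))"
    by (subst sum.swap) (simp add: sum_distrib_left)
  also have "\<dots> = (\<Sum>f\<in>C Y. mon Y w)"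
  proof (rule sum.cong[OF refl])
    fix f assume f: "f \<in> C Y"
    then have "w f * t f = 1" using t(2) C_subset by blast
    then show "mon Y w * (w f * (\<Sum>c\<in>Y. p c f * t c)) = mon Y w"
      unfolding dual_family_C[OF p f t(1), symmetric] by simp
  qed
  finally show ?thesis by simp
qed

text \<open>
  The functions that agree on the reciprocal plane with a combination of monomials of independent sets
  whose closure contains \<open>G\<close>, with products of the forms of \<open>D\<close> as
  coefficients; \<open>k\<close> bounds the degree. Keeping track of \<open>G\<close> makes it possible
  to multiply by truncated forms.
\<close>

inductive standard :: "'e set \<Rightarrow> nat \<Rightarrow> (('e \<Rightarrow> 'f) \<Rightarrow> 'f) \<Rightarrow> bool" where
  gen: "I Y \<Longrightarrow> G \<subseteq> C Y \<Longrightarrow> card Y \<le> k \<Longrightarrow> standard G k (mon Y)"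
| zero: "standard G k (\<lambda>w. 0)"
| add: "standard G k f \<Longrightarrow> standard G k g \<Longrightarrow> standard G k (\<lambda>w. f w + g w)"
| cmult: "standard G k f \<Longrightarrow> standard G k (\<lambda>w. c * f w)"
| theta: "standard G k f \<Longrightarrow> p \<in> D \<Longrightarrow> standard G (Suc k) (\<lambda>w. trunc E p w * f w)"
| cg: "standard G k f \<Longrightarrow> (\<And>w. w \<in> R \<Longrightarrow> g w = f w) \<Longrightarrow> standard G k g"

lemma standard_sum: "finite S \<Longrightarrow> (\<And>i. i \<in> S \<Longrightarrow> standard G k (g i)) \<Longrightarrow> standard G k (\<lambda>w. \<Sum>i\<in>S. g i w)"
  by (induction S rule: finite_induct) (auto intro: standard.zero standard.add)

lemma standard_diff: "standard G k f \<Longrightarrow> standard G k g \<Longrightarrow> standard G k (\<lambda>w. f w - g w)"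
  using standard.add[of G k f "\<lambda>w. (-1) * g w"] standard.cmult[of G k g "-1"] by simp

lemma standard_mono: "standard G k f \<Longrightarrow> G' \<subseteq> G \<Longrightarrow> standard G' k f"
  by (induction rule: standard.induct) (auto intro: standard.intros)

lemma standard_insert:
  assumes "I Y" "G \<subseteq> C (insert f Y)" "card Y \<le> k" "f \<in> E" "f \<notin> C Y"
  shows "standard G (Suc k) (\<lambda>w. w f * mon Y w)"
proof -
  have fin: "finite Y" "Y \<subseteq> E" using indep_finite assms(1) by auto
  have "f \<notin> Y" using assms(5) C_member fin by blast
  then have "mon (insert f Y) = (\<lambda>w. w f * mon Y w)" "card (insert f Y) = Suc (card Y)"
    using fin by (auto simp: mon_def fun_eq_iff)
  then show ?thesis using standard.gen[of "insert f Y" G "Suc k"] indep_insert assms by auto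
qed

text \<open>
  The truncation of the form of \<open>p\<close> to the closure of \<open>Y\<close> differs from the
  full form by multiples of coordinates \<open>w f\<close> outside the closure, and each of these turns
  \<open>Y\<close> into the larger independent set \<open>insert f Y\<close>.
\<close>

lemma standard_theta_flat:
  assumes "I Y" "card Y \<le> k" "p \<in> D"
  shows "standard (C Y) (Suc k) (\<lambda>w. mon Y w * trunc (C Y) p w)"
proof -
  have split: "trunc E p w = trunc (C Y) p w + trunc (E - C Y) p w" for w
    unfolding trunc_def using C_subset finE by (metis sum.subset_diff add.commute)
  have "standard (C Y) (Suc k) (\<lambda>w. trunc E p w * mon Y w)"
    using assms by (intro standard.theta standard.gen) auto
  moreover have "standard (C Y) (Suc k) (\<lambda>w. \<Sum>f\<in>E - C Y. p f * (w f * mon Y w))"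
  proof (intro standard_sum standard.cmult standard_insert)
    show "finite (E - C Y)" using finE by simp
    fix f assume f: "f \<in> E - C Y"
    show "C Y \<subseteq> C (insert f Y)" using f indep_finite[OF assms(1)] by (intro C_subset_mono) auto
  qed (use assms in auto)
  ultimately have "standard (C Y) (Suc k) (\<lambda>w. trunc E p w * mon Y w - (\<Sum>f\<in>E - C Y. p f * (w f * mon Y w)))"
    by (rule standard_diff)
  then show ?thesis
    by (rule standard.cg) (simp add: split, simp add: trunc_def sum_distrib_left sum_distrib_right algebra_simps)
qed

text \<open>
  The point \<open>p c\<close> vanishes on the closure of \<open>Y - {c}\<close>. Let \<open>Z\<close>
  be an independent set whose closure contains that flat. If its closure contains all of
  \<open>Y\<close>, it is equal to that of \<open>Y\<close>, by the bound on its size, and the factor is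
  a truncation to its own closure. Otherwise every \<open>f\<close> that occurs in the factor lies
  outside the closure of \<open>Z\<close>, and adding \<open>f\<close> to \<open>Z\<close> captures
  \<open>Y\<close> by exchange.
\<close>

lemma standard_times_dual:
  assumes p: "dual_family E D Y p" and c: "c \<in> Y"
  shows "standard G k g \<Longrightarrow> G = C (Y - {c}) \<Longrightarrow> k \<le> card Y \<Longrightarrow> standard (C Y) (Suc k) (\<lambda>w. g w * trunc (C Y) (p c) w)"
proof (induction rule: standard.induct)
  case (gen Z G k)
  have YE: "Y \<subseteq> E" using p dual_family_def by metis
  have IY: "I Y" using p indep_def by metis
  have pc: "p c \<in> D" using p c dual_family_def by metis
  show ?case
  proof (cases "C Y \<subseteq> C Z")
    case True
    then have YZ: "Y \<subseteq> C Z" using C_superset[OF YE] by blast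
    have "C Z \<subseteq> C Y" using C_eq_if_card_le[OF IY gen(1) _ YZ] gen by simp
    then have "C Z = C Y" using True by blast
    then show ?thesis using standard_theta_flat[OF gen(1,3) pc] by simp
  next
    case False
    have notin: "f \<notin> C Z" and sub: "C Y \<subseteq> C (insert f Z)" if f: "f \<in> C Y" "p c f \<noteq> 0" for f
    proof -
      note ex = exchange[OF p c f]
      have YcG: "Y - {c} \<subseteq> C Z" using gen C_superset[of "Y - {c}"] YE by auto
      have ins: "insert f Z \<subseteq> E" using f C_subset indep_finite[OF gen(1)] by blast
      show "f \<notin> C Z"
      proof
        assume "f \<in> C Z"
        then have "insert f (Y - {c}) \<subseteq> C Z" using YcG by simp
        then have "Y \<subseteq> C Z" using ex(3) C_mono by blast
        then show False using False C_mono by blast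
      qed
      have "Z \<subseteq> insert f Z" by auto
      then have "insert f (Y - {c}) \<subseteq> C (insert f Z)"
        using YcG C_subset_mono[OF _ ins] C_member[OF _ ins] by blast
      then have "Y \<subseteq> C (insert f Z)" using ex(3) C_mono by blast
      then show "C Y \<subseteq> C (insert f Z)" by (rule C_mono)
    qed
    have "standard (C Y) (Suc k) (\<lambda>w. p c f * (w f * mon Z w))" if f: "f \<in> C Y" for f
    proof (cases "p c f = 0")
      case True
      then show ?thesis using standard.zero by simp
    next
      case nz: False
      moreover have "f \<in> E" using f C_subset by blast
      ultimately show ?thesis using f notin sub gen by (intro standard.cmult standard_insert) auto
    qed
    then have "standard (C Y) (Suc k) (\<lambda>w. \<Sum>f\<in>C Y. p c f * (w f * mon Z w))"
      using finite_C by (intro standard_sum) auto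
    then show ?thesis
      by (rule standard.cg) (simp add: trunc_def sum_distrib_left mult_ac)
  qed
next
  case (zero G k)
  then show ?case using standard.zero by simp
next
  case (add G k f g)
  then show ?case using standard.add[of "C Y" "Suc k"] by (simp add: distrib_right)
next
  case (cmult G k f d)
  then have "standard (C Y) (Suc k) (\<lambda>w. d * (f w * trunc (C Y) (p c) w))" by (intro standard.cmult) auto
  then show ?case by (simp add: mult.assoc)
next
  case (theta G k f q)
  then have "standard (C Y) (Suc (Suc k)) (\<lambda>w. trunc E q w * (f w * trunc (C Y) (p c) w))" by (intro standard.theta) auto
  then show ?case by (simp add: mult.assoc)
next
  case (cg G k f g)
  then show ?case using standard.cg[of "C Y" "Suc k" "\<lambda>w. f w * trunc (C Y) (p c) w"] by simp
qed

text \<open>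
  The monomial of \<open>insert e Y\<close>, a dependent set, is reduced by induction on
  \<open>Y\<close>. The Euler identity replaces the monomial of \<open>Y\<close> by those of \<open>Y -
  {c}\<close>, times truncated forms. If \<open>c\<close> occurs in the expression of \<open>e\<close>,
  then \<open>insert e (Y - {c})\<close> is independent with the same closure; if not, \<open>e\<close>
  lies in the closure of \<open>Y - {c}\<close>, and the induction hypothesis applies.
\<close>

lemma standard_circuit:
  assumes "dual_family E D Y p" "e \<in> C Y"
  shows "standard (C Y) (Suc (card Y)) (\<lambda>w. w e * mon Y w)"
  using assms
proof (induction "card Y" arbitrary: Y rule: less_induct)
  case less
  note p = less(2) and e = less(3)
  have YE: "Y \<subseteq> E" using p dual_family_def by metis
  have fin: "finite Y" using YE finE finite_subset by blast
  have eE: "e \<in> E" using e C_subset by blast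
  have "C Y \<noteq> {}" using e by auto
  then have cardC: "of_nat (card (C Y)) \<noteq> (0::'f)" using finite_C by simp
  (* Each summand of the Euler identity for Y, multiplied by w e. *)
  have "standard (C Y) (Suc (card Y)) (\<lambda>w. (w e * mon (Y - {c}) w) * trunc (C Y) (p c) w)" if c: "c \<in> Y" for c
  proof (cases "p c e = 0")
    case False
    note ex = exchange[OF p c e False]
    let ?Z = "insert e (Y - {c})"
    have enot: "e \<notin> Y - {c}" using ex(1) C_member[of e "Y - {c}"] YE by blast
    have cardZ: "card ?Z = card Y" using enot fin c by (simp add: card_Diff_singleton) (metis Suc_pred card_gt_0_iff empty_iff)
    have monZ: "mon ?Z = (\<lambda>w. w e * mon (Y - {c}) w)" unfolding mon_def fun_eq_iff
      by (simp only: prod.insert[OF finite_Diff[OF fin] enot] simp_thms)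
    have "?Z \<subseteq> C Y" using e C_superset[OF YE] by auto
    then have "C ?Z = C Y" using C_mono[OF ex(3)] C_mono by blast
    then show ?thesis using standard_theta_flat[OF ex(2), of "card Y" "p c"] cardZ monZ p c unfolding dual_family_def by simp
  next
    case True
    have "t e = (\<Sum>y\<in>Y - {c}. p y e * t y)" if "t \<in> D" for t
      using dual_family_C[OF p e that] True c fin by (simp add: sum.remove)
    then have e': "e \<in> C (Y - {c})" using eE by (intro C_I)
    have lt: "card (Y - {c}) < card Y" using c fin by (meson card_Diff1_less)
    have "Suc (card (Y - {c})) = card Y" using fin c by (rule card_Suc_Diff1)
    then have "standard (C (Y - {c})) (card Y) (\<lambda>w. w e * mon (Y - {c}) w)"
      using less(1)[OF lt dual_family_subset[OF p] e'] by auto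
    then show ?thesis using standard_times_dual[OF p c] by blast
  qed
  then have "standard (C Y) (Suc (card Y)) (\<lambda>w. (1 / of_nat (card (C Y))) * (\<Sum>c\<in>Y. (w e * mon (Y - {c}) w) * trunc (C Y) (p c) w))"
    using fin by (intro standard.cmult standard_sum) auto
  then show ?case
  proof (rule standard.cg)
    fix w assume w: "w \<in> R"
    have "(\<Sum>c\<in>Y. (w e * mon (Y - {c}) w) * trunc (C Y) (p c) w) = w e * (of_nat (card (C Y)) * mon Y w)"
      unfolding euler_identity[OF p w] by (simp add: sum_distrib_left mult.assoc)
    then show "w e * mon Y w = (1 / of_nat (card (C Y))) * (\<Sum>c\<in>Y. (w e * mon (Y - {c}) w) * trunc (C Y) (p c) w)"
      using cardC by simp
  qed
qed

lemma standard_var: "standard G k f \<Longrightarrow> G = {} \<Longrightarrow> e \<in> E \<Longrightarrow> standard {} (Suc k) (\<lambda>w. w e * f w)"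
proof (induction rule: standard.induct)
  case (gen Y G k)
  obtain p where p: "dual_family E D Y p" using gen(1) indep_def by metis
  show ?case
  proof (cases "e \<in> C Y")
    case True
    have "standard {} (Suc (card Y)) (\<lambda>w. w e * mon Y w)" using standard_mono[OF standard_circuit[OF p True]] by simp
    moreover have "standard G l f \<Longrightarrow> l \<le> m \<Longrightarrow> standard G m f" for G l m f
    proof (induction arbitrary: m rule: standard.induct)
      case (theta G k f p)
      then obtain m' where "m = Suc m'" "k \<le> m'" by (cases m) auto
      then show ?case using theta standard.theta by blast
    qed (auto intro: standard.intros)
    ultimately show ?thesis using gen by blast
  next
    case False
    then show ?thesis using gen by (intro standard_insert) auto
  qed
next
  case (zero G k)
  then show ?case using standard.zero by simp
next
  case (add G k f g)
  then show ?case using standard.add[of "{}" "Suc k"] by (simp add: distrib_left)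
next
  case (cmult G k f d)
  then have "standard {} (Suc k) (\<lambda>w. d * (w e * f w))" by (intro standard.cmult) auto
  then show ?case by (simp add: mult.left_commute)
next
  case (theta G k f q)
  then have "standard {} (Suc (Suc k)) (\<lambda>w. trunc E q w * (w e * f w))" by (intro standard.theta) auto
  then show ?case by (simp add: mult.left_commute)
next
  case (cg G k f g)
  then show ?case using standard.cg[of "{}" "Suc k" "\<lambda>w. w e * f w"] by simp
qed

text \<open>
  So monomials of independent sets generate the coordinate ring of the reciprocal plane over the
  polynomials in the forms of \<open>D\<close>, without any increase of the degree.
\<close>

lemma pol_standard: "f \<in> pol E k \<Longrightarrow> standard {} k f"
proof (induction rule: pol_induct)
  case (const k c)
  have "dual_family E D {} (\<lambda>y z. 0)" unfolding dual_family_def by simp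
  then have "I {}" unfolding indep_def by blast
  then have "standard {} k (\<lambda>w. c * mon {} w)" by (intro standard.cmult standard.gen) auto
  then show ?case by (simp add: mon_def)
next
  case (add k f g)
  then show ?case by (intro standard.add)
next
  case (var k e f)
  then show ?case using standard_var by blast
qed

subsection \<open>Products along flags of flats\<close>

text \<open>
  The flats of the matroid, described by the vectors orthogonal to \<open>D\<close> instead of by the
  closure: a linear relation between coordinates never involves exactly one coordinate outside a flat.
\<close>

definition flat :: "'e set \<Rightarrow> bool" where
  "flat F \<longleftrightarrow> F \<subseteq> E \<and> (\<forall>\<alpha>\<in>perp E D. card (supp E \<alpha> - F) \<noteq> 1)"

lemma flat_empty: "flat {}"
  unfolding flat_def
proof (intro conjI ballI notI)
  fix \<alpha> assume a: "\<alpha> \<in> perp E D" "card (supp E \<alpha> - {}) = 1"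
  then obtain e where e: "supp E \<alpha> = {e}" by (auto simp: card_1_singleton_iff)
  then have "e \<in> E" "\<alpha> e \<noteq> 0" by (auto simp: supp_def)
  obtain t where t: "t \<in> D" "t e \<noteq> 0" using nz \<open>e \<in> E\<close> by blast
  have "0 = (\<Sum>f\<in>E. \<alpha> f * t f)" using a(1) t(1) by (simp add: perp_def)
  also have "\<dots> = (\<Sum>f\<in>{e}. \<alpha> f * t f)"
    using e \<open>e \<in> E\<close> finE by (intro sum.mono_neutral_right) (auto simp: supp_def)
  finally show False using t \<open>\<alpha> e \<noteq> 0\<close> by simp
qed simp

lemma flat_C: assumes "Y \<subseteq> E" shows "flat (C Y)"
  unfolding flat_def
proof (intro conjI ballI notI)
  show "C Y \<subseteq> E" by (rule C_subset)
  fix \<alpha> assume a: "\<alpha> \<in> perp E D" "card (supp E \<alpha> - C Y) = 1"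
  then obtain e where e: "supp E \<alpha> - C Y = {e}" by (auto simp: card_1_singleton_iff)
  then have ee: "e \<in> E" "\<alpha> e \<noteq> 0" "e \<notin> C Y" by (auto simp: supp_def)
  have "t e = (\<Sum>f\<in>C Y. (- \<alpha> f / \<alpha> e) * t f)" if t: "t \<in> D" for t
  proof -
    have "0 = (\<Sum>f\<in>E. \<alpha> f * t f)" using a(1) t by (simp add: perp_def)
    also have "\<dots> = (\<Sum>f\<in>insert e (C Y). \<alpha> f * t f)"
      using e ee(1) finE C_subset by (intro sum.mono_neutral_right) (auto simp: supp_def)
    also have "\<dots> = \<alpha> e * t e + (\<Sum>f\<in>C Y. \<alpha> f * t f)" using ee(3) finite_C by simp
    finally have "t e = - (\<Sum>f\<in>C Y. \<alpha> f * t f) / \<alpha> e" using ee(2) by (simp add: field_simps add_eq_0_iff)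
    then show ?thesis by (simp add: sum_divide_distrib sum_negf)
  qed
  then have "e \<in> C (C Y)" using ee(1) by (intro C_I)
  then show False using C_trans ee(3) by blast
qed

lemma C_empty: "C {} = {}"
  using nz unfolding cl_def by auto

text \<open>
  The span of products of \<open>k\<close> truncated forms along a chain of flats ending in
  \<open>F\<close>, where the form for each flat vanishes on the flat before it. These products are
  zonotopal, while the forms of \<open>D\<close> used in \<open>standard\<close> only preserve zonotopal
  polynomials.
\<close>

inductive flag_span :: "'e set \<Rightarrow> nat \<Rightarrow> (('e \<Rightarrow> 'f) \<Rightarrow> 'f) \<Rightarrow> bool" where
  one: "flag_span {} 0 (\<lambda>w. 1)"
| step: "flag_span F' k g \<Longrightarrow> flat F \<Longrightarrow> F' \<subseteq> F \<Longrightarrow> p \<in> D \<Longrightarrow> (\<And>e. e \<in> F' \<Longrightarrow> p e = 0) \<Longrightarrow>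
     flag_span F (Suc k) (\<lambda>w. g w * trunc F p w)"
| zero: "flat F \<Longrightarrow> flag_span F k (\<lambda>w. 0)"
| add: "flag_span F k f \<Longrightarrow> flag_span F k g \<Longrightarrow> flag_span F k (\<lambda>w. f w + g w)"
| cmult: "flag_span F k f \<Longrightarrow> flag_span F k (\<lambda>w. c * f w)"

lemma flag_span_flat: "flag_span F k g \<Longrightarrow> flat F"
  by (induction rule: flag_span.induct) (auto simp: flat_empty)

lemma trunc_pol: "F \<subseteq> E \<Longrightarrow> trunc F p \<in> pol E (Suc 0)"
proof -
  assume F: "F \<subseteq> E"
  then have "finite F" using finE finite_subset by blast
  then have "(\<lambda>w. \<Sum>e\<in>F. p e * w e) \<in> pol E (Suc 0)"
    using F by (intro pol_sum pol_cmult pol_coord) auto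
  then show ?thesis by (simp add: trunc_def[abs_def])
qed

lemma flag_span_pol: "flag_span F k g \<Longrightarrow> g \<in> pol E k"
proof (induction rule: flag_span.induct)
  case (step F' k g F p)
  then have "(\<lambda>w. g w * trunc F p w) \<in> pol E (k + Suc 0)"
    by (intro pol_mult trunc_pol) (auto simp: flat_def)
  then show ?case by simp
qed (auto intro: pol_const pol_add pol_cmult)

text \<open>
  Let \<open>S\<close> be the support of the direction \<open>\<alpha>\<close>. A new factor is constant
  along \<open>\<alpha>\<close> unless its flat contains more of \<open>S\<close> than the one before;
  so the degree is at most the number of elements of \<open>S\<close> in the last flat. The factor whose
  flat swallows \<open>S\<close> completely is again constant along \<open>\<alpha>\<close>, since there
  the truncated form agrees with the full one, and the flat before it misses at least two elements of
  \<open>S\<close>. This gives the sharper bound.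
\<close>

lemma flag_span_line:
  assumes a: "\<alpha> \<in> perp E D" "supp E \<alpha> \<noteq> {}"
  shows "flag_span F k g \<Longrightarrow> deg_less (Suc (card (supp E \<alpha> \<inter> F))) (\<lambda>s. g (\<lambda>e. w e + \<alpha> e * s)) \<and>
    (supp E \<alpha> \<subseteq> F \<longrightarrow> deg_less (card (supp E \<alpha>) - 1) (\<lambda>s. g (\<lambda>e. w e + \<alpha> e * s)))"
proof (induction rule: flag_span.induct)
  case one
  then show ?case using a(2) deg_less_const by auto
next
  case (step F' k g F p)
  let ?S = "supp E \<alpha>"
  let ?l = "\<lambda>e s. w e + \<alpha> e * s"
  have finS: "finite ?S" using finE by (simp add: supp_def)
  have FE: "F \<subseteq> E" using step by (simp add: flat_def)
  have finF: "finite F" using FE finE finite_subset by blast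
  have F': "flat F'" using step flag_span_flat by blast
  have trunc_line: "trunc F p (\<lambda>e. ?l e s) = trunc F p w + (\<Sum>e\<in>F. p e * \<alpha> e) * s" for s
    by (simp add: trunc_def algebra_simps sum.distrib sum_distrib_left)
  (* The slope of the new factor only involves the elements of the support gained in this step. *)
  have S: "(\<Sum>e\<in>F. p e * \<alpha> e) = (\<Sum>e\<in>?S \<inter> F - F'. p e * \<alpha> e)"
    using finF FE step(5) step.hyps by (intro sum.mono_neutral_right) (auto simp: supp_def)
  have const: "deg_less m (\<lambda>s. g (\<lambda>e. ?l e s) * trunc F p (\<lambda>e. ?l e s))"
    if "(\<Sum>e\<in>F. p e * \<alpha> e) = 0" "deg_less m (\<lambda>s. g (\<lambda>e. ?l e s))" for m
    unfolding trunc_line that(1) using deg_less_cmult[OF that(2), of "trunc F p w"] by (simp add: mult.commute)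
  show ?case
  proof (cases "?S \<inter> F \<subseteq> F'")
    case True
    then have emp: "?S \<inter> F - F' = {}" by blast
    have 0: "(\<Sum>e\<in>F. p e * \<alpha> e) = 0" unfolding S emp by (rule sum.empty)
    have "?S \<inter> F = ?S \<inter> F'" using True step by blast
    moreover have "?S \<subseteq> F \<Longrightarrow> ?S \<subseteq> F'" using True by blast
    ultimately show ?thesis using step.IH const[OF 0] by auto
  next
    case False
    then have "?S \<inter> F' \<subset> ?S \<inter> F" using step by blast
    then have lt: "card (?S \<inter> F') < card (?S \<inter> F)" using finS by (intro psubset_card_mono) auto
    have "deg_less (Suc (Suc (card (?S \<inter> F')))) (\<lambda>s. g (\<lambda>e. ?l e s) * trunc F p (\<lambda>e. ?l e s))"
      unfolding trunc_line using step.IH by (intro deg_less_affine) auto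
    then have 1: "deg_less (Suc (card (?S \<inter> F))) (\<lambda>s. g (\<lambda>e. ?l e s) * trunc F p (\<lambda>e. ?l e s))"
      using lt by (elim deg_less_mono) auto
    have 2: "deg_less (card ?S - 1) (\<lambda>s. g (\<lambda>e. ?l e s) * trunc F p (\<lambda>e. ?l e s))" if SF: "?S \<subseteq> F"
    proof -
      have "(\<Sum>e\<in>F. p e * \<alpha> e) = (\<Sum>e\<in>E. p e * \<alpha> e)"
        using SF FE finE by (intro sum.mono_neutral_left) (auto simp: supp_def)
      also have "\<dots> = 0" using a(1) step by (auto simp: perp_def mult.commute)
      finally have 0: "(\<Sum>e\<in>F. p e * \<alpha> e) = 0" .
      have "?S - F' \<noteq> {}" using False by blast
      then have "card (?S - F') \<noteq> 0" using finS by simp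
      moreover have "card (?S - F') \<noteq> 1" using F' a(1) unfolding flat_def by blast
      moreover have "card ?S = card (?S \<inter> F') + card (?S - F')"
        using finS by (metis card_Int_Diff add.commute)
      ultimately have "Suc (card (?S \<inter> F')) \<le> card ?S - 1" by linarith
      then show ?thesis using const[OF 0] step.IH deg_less_mono by blast
    qed
    show ?thesis using 1 2 by blast
  qed
next
  case (zero F k)
  then show ?case by (simp add: deg_less_zero)
next
  case (add F k f g)
  then show ?case by (auto intro: deg_less_add)
next
  case (cmult F k f c)
  then show ?case by (auto intro: deg_less_cmult)
qed

text \<open>
  If the last flat does not contain the support of \<open>\<alpha>\<close>, it misses at least two
  elements of the support.
\<close>

lemma flag_span_zonotopal: assumes "flag_span F k g" shows "g \<in> zonotopal E D"
proof (rule zonotopal_relI)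
  show "g \<in> polyfun E" using flag_span_pol[OF assms] by (rule polyfunI)
  fix \<alpha> w assume a: "\<alpha> \<in> perp E D" "supp E \<alpha> \<noteq> {}"
  let ?S = "supp E \<alpha>"
  have finS: "finite ?S" using finE by (simp add: supp_def)
  show "deg_less (card ?S - 1) (\<lambda>s. g (\<lambda>e. w e + \<alpha> e * s))"
  proof (cases "?S \<subseteq> F")
    case True
    then show ?thesis using flag_span_line[OF a assms] by blast
  next
    case False
    then have "card (?S - F) \<noteq> 0" using finS by simp
    moreover have "card (?S - F) \<noteq> 1" using flag_span_flat[OF assms] a(1) unfolding flat_def by blast
    moreover have "card ?S = card (?S \<inter> F) + card (?S - F)"
      using finS by (metis card_Int_Diff add.commute)
    ultimately have "Suc (card (?S \<inter> F)) \<le> card ?S - 1" by linarith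
    then show ?thesis using flag_span_line[OF a assms] deg_less_mono by blast
  qed
qed

lemma flag_span_sum: "finite S \<Longrightarrow> flat F \<Longrightarrow> (\<And>i. i \<in> S \<Longrightarrow> flag_span F k (g i)) \<Longrightarrow> flag_span F k (\<lambda>w. \<Sum>i\<in>S. g i w)"
  by (induction S rule: finite_induct) (auto intro: flag_span.zero flag_span.add)

text \<open>
  Iterating the Euler identity: the factor for \<open>c\<close> vanishes on the closure of \<open>Y -
  {c}\<close>, so the resulting products run along flags.
\<close>

lemma mon_flag_span:
  assumes "dual_family E D Y p"
  shows "\<exists>g. flag_span (C Y) (card Y) g \<and> (\<forall>w\<in>R. g w = mon Y w)"
  using assms
proof (induction "card Y" arbitrary: Y rule: less_induct)
  case less
  note p = less(2)
  have YE: "Y \<subseteq> E" using p dual_family_def by metis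
  have fin: "finite Y" using YE finE finite_subset by blast
  show ?case
  proof (cases "Y = {}")
    case True
    then show ?thesis using flag_span.one by (auto simp: C_empty mon_def intro!: exI[of _ "\<lambda>w. 1"])
  next
    case False
    then have "C Y \<noteq> {}" using C_superset[OF YE] by blast
    then have cardC: "of_nat (card (C Y)) \<noteq> (0::'f)" using finite_C by simp
    have "\<exists>g. flag_span (C (Y - {c})) (card (Y - {c})) g \<and> (\<forall>w\<in>R. g w = mon (Y - {c}) w)" if "c \<in> Y" for c
      using that fin by (intro less(1) card_Diff1_less dual_family_subset[OF p]) auto
    then obtain g where g: "\<And>c. c \<in> Y \<Longrightarrow> flag_span (C (Y - {c})) (card (Y - {c})) (g c)"
      "\<And>c w. c \<in> Y \<Longrightarrow> w \<in> R \<Longrightarrow> g c w = mon (Y - {c}) w" by metis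
    have "flag_span (C Y) (card Y) (\<lambda>w. g c w * trunc (C Y) (p c) w)" if c: "c \<in> Y" for c
    proof -
      have p0: "p c e = 0" if e: "e \<in> C (Y - {c})" for e
        using dual_family_C[OF dual_family_subset[OF p] e, of "p c"] p c unfolding dual_family_def by (auto intro!: sum.neutral split: if_splits)
      have "C (Y - {c}) \<subseteq> C Y" using YE by (intro C_subset_mono) auto
      then have "flag_span (C Y) (Suc (card (Y - {c}))) (\<lambda>w. g c w * trunc (C Y) (p c) w)"
        using g(1)[OF c] flat_C[OF YE] p c p0 unfolding dual_family_def by (intro flag_span.step) auto
      then show ?thesis using c fin by (metis card_Suc_Diff1)
    qed
    then have "flag_span (C Y) (card Y) (\<lambda>w. (1 / of_nat (card (C Y))) * (\<Sum>c\<in>Y. g c w * trunc (C Y) (p c) w))"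
      using fin flat_C[OF YE] by (intro flag_span.cmult flag_span_sum) auto
    moreover have "(1 / of_nat (card (C Y))) * (\<Sum>c\<in>Y. g c w * trunc (C Y) (p c) w) = mon Y w" if w: "w \<in> R" for w
    proof -
      have "(\<Sum>c\<in>Y. g c w * trunc (C Y) (p c) w) = (\<Sum>c\<in>Y. mon (Y - {c}) w * trunc (C Y) (p c) w)"
        by (rule sum.cong[OF refl]) (simp add: g(2)[OF _ w])
      also have "\<dots> = of_nat (card (C Y)) * mon Y w" by (rule euler_identity[OF p w, symmetric])
      finally show ?thesis using cardC by simp
    qed
    ultimately show ?thesis by blast
  qed
qed

lemma standard_zonotopal: "standard G k f \<Longrightarrow> \<exists>F\<in>zonotopal E D \<inter> pol E k. \<forall>w\<in>R. F w = f w"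
proof (induction rule: standard.induct)
  case (gen Y G k)
  obtain p where p: "dual_family E D Y p" using gen(1) indep_def by metis
  obtain g where g: "flag_span (C Y) (card Y) g" "\<forall>w\<in>R. g w = mon Y w" using mon_flag_span[OF p] by blast
  then show ?case using flag_span_zonotopal flag_span_pol pol_mono gen(3) by blast
next
  case (zero G k)
  show ?case by (rule bexI[of _ "\<lambda>w. 0"]) (auto intro: zonotopal_rel_zero pol_const)
next
  case (add G k f g)
  then obtain F F' where "F \<in> zonotopal E D \<inter> pol E k" "\<forall>w\<in>R. F w = f w" "F' \<in> zonotopal E D \<inter> pol E k" "\<forall>w\<in>R. F' w = g w" by blast
  then show ?case by (intro bexI[of _ "\<lambda>w. F w + F' w"]) (auto intro: zonotopal_rel_add pol_add)
next
  case (cmult G k f c)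
  then obtain F where "F \<in> zonotopal E D \<inter> pol E k" "\<forall>w\<in>R. F w = f w" by blast
  then show ?case by (intro bexI[of _ "\<lambda>w. c * F w"]) (auto intro: zonotopal_rel_cmult pol_cmult)
next
  case (theta G k f p)
  then obtain F where F: "F \<in> zonotopal E D \<inter> pol E k" "\<forall>w\<in>R. F w = f w" by blast
  have "(\<lambda>w. trunc E p w * F w) \<in> pol E (Suc 0 + k)" using F by (intro pol_mult trunc_pol) auto
  moreover have "(\<lambda>w. trunc E p w * F w) \<in> zonotopal E D"
    unfolding trunc_def using F theta finE by (intro zonotopal_rel_mult_form) auto
  ultimately show ?case using F by (intro bexI[of _ "\<lambda>w. trunc E p w * F w"]) auto
next
  case (cg G k f g)
  then show ?case by metis
qed

text \<open>
  Monomials of independent sets have representatives along flags of flats, and the coefficients of the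
  reduction in \<open>pol_standard\<close> are products of forms that preserve zonotopal polynomials.
\<close>

theorem zonotopal_surjective: "f \<in> pol E k \<Longrightarrow> \<exists>F\<in>zonotopal E D \<inter> pol E k. \<forall>w\<in>R. F w = f w"
  using pol_standard standard_zonotopal by blast

end

section \<open>Injectivity by deletion and contraction\<close>

lemma fs_linearI:
  fixes T :: "('x \<Rightarrow> 'f::field) \<Rightarrow> ('y \<Rightarrow> 'f)"
  assumes "\<And>x y. T (x + y) = T x + T y" "\<And>c x. T (\<lambda>z. c * x z) = (\<lambda>z. c * T x z)"
  shows "Vector_Spaces.linear (\<lambda>c g x. c * g x) (\<lambda>c g x. c * g x) T"
  unfolding Vector_Spaces.linear_iff by (intro conjI allI assms fs.vector_space_axioms)

text \<open>
  A rational function of one variable that is regular at \<open>0\<close>, given as a function on the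
  field. Its values at the zeros of the denominator are arbitrary, so that \<open>1 / (a + b *
  s)\<close> with the convention for division by zero is covered.
\<close>

definition regular0 :: "('f::field_char_0 \<Rightarrow> 'f) \<Rightarrow> bool" where
  "regular0 r \<longleftrightarrow> (\<exists>N R. poly R 0 \<noteq> 0 \<and> (\<forall>s. poly R s \<noteq> 0 \<longrightarrow> r s * poly R s = poly N s))"

lemma regular0I: "poly R 0 \<noteq> 0 \<Longrightarrow> (\<And>s. poly R s \<noteq> 0 \<Longrightarrow> r s * poly R s = poly N s) \<Longrightarrow> regular0 r"
  unfolding regular0_def by blast

lemma regular0E:
  assumes "regular0 r"
  obtains N R where "poly R 0 \<noteq> 0" "\<And>s. poly R s \<noteq> 0 \<Longrightarrow> r s * poly R s = poly N s"
  using assms unfolding regular0_def by blast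

lemma regular0_const: "regular0 (\<lambda>s. c)"
  by (rule regular0I[of 1 _ "[:c:]"]) auto

lemma regular0_id: "regular0 (\<lambda>s. s)"
  by (rule regular0I[of 1 _ "[:0, 1:]"]) auto

lemma regular0_add: assumes "regular0 r" "regular0 r'" shows "regular0 (\<lambda>s. r s + r' s)"
proof -
  obtain N R where 1: "poly R 0 \<noteq> 0" "\<And>s. poly R s \<noteq> 0 \<Longrightarrow> r s * poly R s = poly N s"
    using regular0E[OF assms(1)] by metis
  obtain N' R' where 2: "poly R' 0 \<noteq> 0" "\<And>s. poly R' s \<noteq> 0 \<Longrightarrow> r' s * poly R' s = poly N' s"
    using regular0E[OF assms(2)] by metis
  show ?thesis
  proof (rule regular0I[of "R * R'" _ "N * R' + N' * R"])
    fix s assume "poly (R * R') s \<noteq> 0"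
    then have *: "r s * poly R s = poly N s" "r' s * poly R' s = poly N' s" using 1(2) 2(2) by auto
    show "(r s + r' s) * poly (R * R') s = poly (N * R' + N' * R) s"
      by (simp add: *[symmetric] algebra_simps)
  qed (use 1 2 in simp)
qed

lemma regular0_mult: assumes "regular0 r" "regular0 r'" shows "regular0 (\<lambda>s. r s * r' s)"
proof -
  obtain N R where 1: "poly R 0 \<noteq> 0" "\<And>s. poly R s \<noteq> 0 \<Longrightarrow> r s * poly R s = poly N s"
    using regular0E[OF assms(1)] by metis
  obtain N' R' where 2: "poly R' 0 \<noteq> 0" "\<And>s. poly R' s \<noteq> 0 \<Longrightarrow> r' s * poly R' s = poly N' s"
    using regular0E[OF assms(2)] by metis
  show ?thesis
  proof (rule regular0I[of "R * R'" _ "N * N'"])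
    fix s assume "poly (R * R') s \<noteq> 0"
    then have *: "r s * poly R s = poly N s" "r' s * poly R' s = poly N' s" using 1(2) 2(2) by auto
    show "(r s * r' s) * poly (R * R') s = poly (N * N') s"
      by (simp add: *[symmetric] algebra_simps)
  qed (use 1 2 in simp)
qed

lemma regular0_power: "regular0 r \<Longrightarrow> regular0 (\<lambda>s. r s ^ n)"
proof (induction n)
  case 0
  show ?case by (simp add: regular0_const)
next
  case (Suc n)
  then have "regular0 (\<lambda>s. r s * r s ^ n)" by (intro regular0_mult) auto
  then show ?case by simp
qed

lemma regular0_sum: "finite I \<Longrightarrow> (\<And>i. i \<in> I \<Longrightarrow> regular0 (r i)) \<Longrightarrow> regular0 (\<lambda>s. \<Sum>i\<in>I. r i s)"
proof (induction I rule: finite_induct)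
  case empty
  show ?case by (simp add: regular0_const)
next
  case (insert i I)
  then have "regular0 (\<lambda>s. r i s + (\<Sum>i\<in>I. r i s))" by (intro regular0_add) auto
  then show ?case using insert(1,2) by simp
qed

lemma regular0_inverse: "a \<noteq> 0 \<Longrightarrow> regular0 (\<lambda>s. 1 / (a + b * s))"
  by (rule regular0I[of "[:a, b:]" _ 1]) (auto simp: mult.commute)

lemma regular0_polyfun:
  assumes "F \<in> polyfun E" and t: "\<And>e. e \<in> E \<Longrightarrow> t e \<noteq> 0"
  shows "regular0 (\<lambda>s. F (\<lambda>e. 1 / (t e + p e * s)))"
  using assms(1)
proof (induction rule: polyfun_induct)
  case (const c)
  show ?case by (rule regular0_const)
next
  case (coord e)
  then show ?case using t by (intro regular0_inverse) auto
next
  case (add f g)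
  show ?case by (rule regular0_add[OF add(3,4)])
next
  case (mult f g)
  show ?case by (rule regular0_mult[OF mult(3,4)])
qed

text \<open>
  Continuity at \<open>0\<close>, in algebraic form: the numerator has infinitely many zeros.
\<close>

lemma regular0_zero:
  assumes "regular0 r" "finite S" "\<And>s. s \<notin> S \<Longrightarrow> r s = 0"
  shows "r 0 = 0"
proof -
  obtain N R where 1: "poly R 0 \<noteq> 0" "\<And>s. poly R s \<noteq> 0 \<Longrightarrow> r s * poly R s = poly N s"
    using regular0E[OF assms(1)] by metis
  have "R \<noteq> 0" using 1(1) by auto
  then have fin: "finite (S \<union> {s. poly R s = 0})" using assms(2) poly_roots_finite by blast
  have "UNIV \<subseteq> {s. poly N s = 0} \<union> (S \<union> {s. poly R s = 0})"
  proof
    fix s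
    show "s \<in> {s. poly N s = 0} \<union> (S \<union> {s. poly R s = 0})"
      using assms(3)[of s] 1(2)[of s] by (cases "s \<in> S"; cases "poly R s = 0") auto
  qed
  then have "infinite {s. poly N s = 0}"
    using fin infinite_UNIV_char_0 by (meson finite_UnI finite_subset)
  then have "N = 0" using poly_roots_finite by blast
  then show ?thesis using 1(2)[OF 1(1)] 1(1) by simp
qed

lemma finite_affine_roots:
  fixes t p :: "'e \<Rightarrow> 'f::field_char_0"
  assumes "finite E" "\<And>e. e \<in> E \<Longrightarrow> t e \<noteq> 0 \<or> p e \<noteq> 0"
  shows "finite {s. \<exists>e\<in>E. t e + p e * s = 0}"
proof -
  have "finite {s. poly [:t e, p e:] s = 0}" if "e \<in> E" for e
    using assms(2)[OF that] by (intro poly_roots_finite) auto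
  then have "finite (\<Union>e\<in>E. {s. poly [:t e, p e:] s = 0})" using assms(1) by blast
  moreover have "{s. \<exists>e\<in>E. t e + p e * s = 0} = (\<Union>e\<in>E. {s. poly [:t e, p e:] s = 0})"
    by (auto simp: mult.commute)
  ultimately show ?thesis by simp
qed

text \<open>
  The point \<open>w\<close> may come from some \<open>t\<close> with \<open>t e = 0\<close>. It is
  still a limit of points that come from \<open>t + s * p\<close>, where the coordinate \<open>e\<close>
  is not zero, as \<open>s\<close> tends to \<open>0\<close>.
\<close>

lemma recip_dense:
  assumes "finite E'" "h \<in> polyfun E'" "fs.subspace D" "p \<in> D" "p e \<noteq> 0"
    and h: "\<And>w. w \<in> recip (insert e E') D \<Longrightarrow> h w = 0" and w: "w \<in> recip E' D"
  shows "h w = (0::'f::field_char_0)"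
proof -
  obtain t where t: "t \<in> D" "\<And>f. f \<in> E' \<Longrightarrow> w f * t f = 1" using w unfolding recip_def by blast
  have t0: "t f \<noteq> 0" if "f \<in> E'" for f using t(2)[OF that] by auto
  have r: "regular0 (\<lambda>s. h (\<lambda>f. 1 / (t f + p f * s)))" by (rule regular0_polyfun[OF assms(2) t0])
  have "h (\<lambda>f. 1 / (t f + p f * s)) = 0" if s: "s \<notin> {s. \<exists>f\<in>insert e E'. t f + p f * s = 0}" for s
  proof (rule h)
    have "(\<lambda>f. p f * s) \<in> D" using fs.subspace_scale[OF assms(3,4), of s] by (simp add: mult.commute)
    then have "(\<lambda>f. t f + p f * s) \<in> D" using fs.subspace_add[OF assms(3) t(1)] by (auto simp: plus_fun_def)
    then show "(\<lambda>f. 1 / (t f + p f * s)) \<in> recip (insert e E') D"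
      unfolding recip_def using s by (auto intro!: bexI[of _ "\<lambda>f. t f + p f * s"])
  qed
  moreover have "finite {s. \<exists>f\<in>insert e E'. t f + p f * s = 0}"
    using assms(1,5) t0 by (intro finite_affine_roots) auto
  ultimately have "h (\<lambda>f. 1 / (t f + p f * 0)) = 0" using regular0_zero[OF r] by blast
  moreover have "h (\<lambda>f. 1 / (t f + p f * 0)) = h w"
    by (rule polyfun_cong_coords[OF assms(2)]) (use t(2) t0 in \<open>auto simp: field_simps\<close>)
  ultimately show ?thesis by simp
qed

text \<open>
  This is the contraction step. The full linear form \<open>w e + th w\<close> of \<open>p\<close> is
  constant on lines orthogonal to \<open>D\<close>, so \<open>G\<close> is expanded in its powers rather
  than in powers of \<open>w e\<close>; then the coefficients, which do not involve \<open>w e\<close>,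
  are zonotopal for the contraction \<open>D \<inter> {t. t e = 0}\<close>. Suppose that the leading
  coefficient \<open>Gj m\<close> is not zero. By induction it does not vanish at some point of the
  contracted reciprocal plane, given by \<open>t\<close> with \<open>t e = 0\<close>. Along \<open>t + s
  * p\<close> the coordinate \<open>w e = 1 / s\<close> has a pole, and \<open>G = s * h\<close>. So
  \<open>s ^ m * G\<close> tends to the value of \<open>Gj m\<close> and also to \<open>0\<close>, a
  contradiction.
\<close>

lemma pole_zero:
  fixes D :: "('e \<Rightarrow> 'f::field_char_0) set"
  assumes fin: "finite E" and eE: "e \<in> E" and D: "fs.subspace D" and p: "p \<in> D" "p e = 1"
    and IH: "\<And>F. F \<in> zonotopal (E - {e}) (D \<inter> {t. t e = 0}) \<Longrightarrow>
      (\<And>w. w \<in> recip (E - {e}) (D \<inter> {t. t e = 0}) \<Longrightarrow> F w = 0) \<Longrightarrow> F = (\<lambda>w. 0)"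
    and G: "G \<in> zonotopal_rel E (E - {e}) D" and h: "h \<in> polyfun (E - {e})"
    and eq: "\<And>w. w \<in> recip E D \<Longrightarrow> w e * G w = h w"
  shows "G = (\<lambda>w. 0)"
proof -
  let ?E = "E - {e}" and ?D = "D \<inter> {t. t e = 0}"
  define th where "th w = (\<Sum>f\<in>?E. p f * w f)" for w
  have thp: "th \<in> polyfun ?E"
    unfolding th_def[abs_def] using fin by (intro polyfun_sum polyfun_mult polyfun_const polyfun_coord) auto
  have nth: "(\<lambda>w. - th w) \<in> polyfun ?E" using polyfun_diff[OF polyfun_const[of 0] thp] by simp
  (* The substitution w e = z - th w, which makes z the full linear form of p. *)
  define a where "a f = (if f = e then (\<lambda>w. - th w) else (\<lambda>w. w f))" for f
  define b where "b f = (if f = e then (\<lambda>w. 1) else (\<lambda>w::'e\<Rightarrow>'f. 0::'f))" for f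
  have Gp: "G \<in> polyfun E" using G by (rule zonotopal_rel_polyfun)
  have ap: "a f \<in> polyfun ?E" if "f \<in> E" for f
    unfolding a_def using that nth by (auto intro: polyfun_coord)
  have bp: "b f \<in> polyfun ?E" for f
    unfolding b_def by (auto intro: polyfun_const)
  have ex: "\<exists>J Gj. (\<forall>j. Gj j \<in> polyfun ?E) \<and> (\<forall>w z. G (\<lambda>f. a f w + b f w * z) = (\<Sum>j\<le>J. Gj j w * z ^ j))"
    by (rule polyfun_expand[OF Gp]) (simp_all add: ap bp)
  obtain J Gj where Gj: "\<And>j. Gj j \<in> polyfun ?E"
    "\<And>w z. G (\<lambda>f. a f w + b f w * z) = (\<Sum>j\<le>J. Gj j w * z ^ j)"
    using ex by blast
  have Gexp: "G w = (\<Sum>j\<le>J. Gj j w * (w e + th w) ^ j)" for w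
  proof -
    have "G w = G (\<lambda>f. a f w + b f w * (w e + th w))"
      by (rule polyfun_cong_coords[OF Gp]) (simp add: a_def b_def)
    then show ?thesis using Gj(2) by metis
  qed
  have GjPP: "Gj j \<in> zonotopal ?E ?D" if j: "j \<le> J" for j
  proof (rule zonotopal_relI[OF Gj(1)])
    fix \<alpha> w assume al: "\<alpha> \<in> perp ?E ?D" and ne: "supp ?E \<alpha> \<noteq> {}"
    define k where "k = card (supp ?E \<alpha>) - 1"
    (* A direction \<alpha> orthogonal to the contraction lifts uniquely to a direction \<beta> orthogonal to D. *)
    define c where "c = - (\<Sum>f\<in>?E. \<alpha> f * p f)"
    define \<beta> where "\<beta> = \<alpha>(e := c)"
    have b1: "\<beta> \<in> perp E D"
      unfolding perp_def
    proof (clarify)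
      fix t assume t: "t \<in> D"
      have "(\<lambda>f. t e * p f) \<in> D" using fs.subspace_scale[OF D p(1)] by simp
      then have "(\<lambda>f. t f - t e * p f) \<in> D" using fs.subspace_diff[OF D t] by (auto simp: fun_diff_def)
      then have "(\<lambda>f. t f - t e * p f) \<in> ?D" using p(2) by simp
      moreover have "\<forall>u\<in>?D. (\<Sum>f\<in>?E. \<alpha> f * u f) = 0" using al by (simp only: perp_def mem_Collect_eq)
      ultimately have "(\<Sum>f\<in>?E. \<alpha> f * (t f - t e * p f)) = 0" by (rule bspec[rotated])
      then have "(\<Sum>f\<in>?E. \<alpha> f * t f) = t e * (\<Sum>f\<in>?E. \<alpha> f * p f)"
        by (simp add: algebra_simps sum_subtractf sum_distrib_left)
      moreover have "(\<Sum>f\<in>E. \<beta> f * t f) = c * t e + (\<Sum>f\<in>?E. \<alpha> f * t f)"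
        using fin eE by (simp add: sum.remove \<beta>_def)
      ultimately show "(\<Sum>f\<in>E. \<beta> f * t f) = 0" by (simp add: c_def)
    qed
    have b2: "supp ?E \<beta> = supp ?E \<alpha>" by (auto simp: supp_def \<beta>_def)
    have "\<forall>i. \<exists>q. \<forall>s. Gj i (\<lambda>f. w f + \<alpha> f * s) = poly q s"
      by (rule allI, rule polyfun_line[OF Gj(1)])
    then have "\<exists>q. \<forall>i s. Gj i (\<lambda>f. w f + \<alpha> f * s) = poly (q i) s" by (rule choice)
    then obtain q where q: "\<And>i s. Gj i (\<lambda>f. w f + \<alpha> f * s) = poly (q i) s" by blast
    have "(\<Sum>i\<le>J. coeff (q i) m * z ^ i) = 0" if m: "m \<ge> k" for m z
    proof -
      define v where "v = w(e := z - th w)"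
      have "deg_less k (\<lambda>s. G (\<lambda>f. v f + \<beta> f * s))"
        using zonotopal_relD[OF G b1] ne unfolding b2 k_def by blast
      then obtain r where r: "\<And>s. G (\<lambda>f. v f + \<beta> f * s) = poly r s" "\<And>i. i \<ge> k \<Longrightarrow> coeff r i = 0"
        unfolding deg_less_def by blast
      have "poly r s = poly (\<Sum>i\<le>J. smult (z ^ i) (q i)) s" for s
      proof -
        let ?x = "\<lambda>f. v f + \<beta> f * s"
        have "Gj i ?x = poly (q i) s" for i
          unfolding q[symmetric] by (rule polyfun_cong_coords[OF Gj(1)]) (simp add: v_def \<beta>_def)
        moreover have "?x e + th ?x = z"
        proof -
          have "th ?x = th w + s * (\<Sum>f\<in>?E. \<alpha> f * p f)"
            unfolding th_def sum_distrib_left sum.distrib[symmetric]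
            by (rule sum.cong) (auto simp: v_def \<beta>_def algebra_simps)
          then show ?thesis by (simp add: v_def \<beta>_def c_def algebra_simps)
        qed
        ultimately show ?thesis
          using Gexp[of ?x] r(1)[of s] by (simp add: poly_sum mult.commute)
      qed
      then have "poly r = poly (\<Sum>i\<le>J. smult (z ^ i) (q i))" by (rule ext)
      then have "r = (\<Sum>i\<le>J. smult (z ^ i) (q i))" by (simp only: poly_eq_poly_eq_iff)
      then have "coeff (\<Sum>i\<le>J. smult (z ^ i) (q i)) m = 0" using r(2)[OF m] by simp
      then show ?thesis by (simp add: coeff_sum mult.commute)
    qed
    then have "coeff (q j) m = 0" if "m \<ge> k" for m
      using sum_powers_eq_0[where J = J and c = "\<lambda>i. coeff (q i) m" and j = j] that j by blast
    then show "deg_less (card (supp ?E \<alpha>) - 1) (\<lambda>s. Gj j (\<lambda>f. w f + \<alpha> f * s))"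
      unfolding deg_less_def k_def[symmetric] using q by blast
  qed
  have "Gj j = (\<lambda>w. 0)" if "j \<le> J" for j
  proof (rule ccontr)
    assume ne: "Gj j \<noteq> (\<lambda>w. 0)"
    define A where "A = {i. i \<le> J \<and> Gj i \<noteq> (\<lambda>w. 0)}"
    define m where "m = Max A"
    have finA: "finite A" unfolding A_def by simp
    have "A \<noteq> {}" using ne that unfolding A_def by blast
    then have "m \<in> A" unfolding m_def using finA by (intro Max_in)
    then have m: "m \<le> J" "Gj m \<noteq> (\<lambda>w. 0)" unfolding A_def by auto
    have above: "Gj i = (\<lambda>w. 0)" if "m < i" "i \<le> J" for i
      using that Max_ge[OF finA, of i] unfolding m_def A_def by fastforce
    obtain w0 where w0: "w0 \<in> recip ?E ?D" "Gj m w0 \<noteq> 0"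
      using IH[OF GjPP[OF m(1)]] m(2) by blast
    obtain t where t: "t \<in> D" "t e = 0" "\<And>f. f \<in> ?E \<Longrightarrow> w0 f * t f = 1"
      using w0(1) unfolding recip_def by blast
    have t0: "t f \<noteq> 0" if "f \<in> ?E" for f using t(3)[OF that] by auto
    define v where "v s = (\<lambda>f. 1 / (t f + p f * s))" for s
    (* The function s ^ m * (G - s * h) along t + s * p, written so that it is visibly regular at 0. *)
    define \<Phi> where "\<Phi> s = (\<Sum>i\<le>m. Gj i (v s) * s ^ (m - i) * (1 + s * th (v s)) ^ i)
      + (-1) * s ^ Suc m * h (v s)" for s
    have regv: "regular0 (\<lambda>s. F (v s))" if "F \<in> polyfun ?E" for F
      unfolding v_def by (rule regular0_polyfun[OF that t0])
    have "regular0 \<Phi>"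
      unfolding \<Phi>_def[abs_def] using regv[OF Gj(1)] regv[OF thp] regv[OF h]
      by (intro regular0_add regular0_sum regular0_mult regular0_power regular0_const regular0_id) auto
    moreover have "\<Phi> s = 0" if s: "s \<notin> {s. \<exists>f\<in>E. t f + p f * s = 0}" for s
    proof -
      have u: "(\<lambda>f. t f + p f * s) \<in> D"
        using fs.subspace_add[OF D t(1) fs.subspace_scale[OF D p(1), of s]] by (simp add: plus_fun_def mult.commute)
      have s0: "s \<noteq> 0" using s eE t(2) p(2) by auto
      have "v s \<in> recip E D" unfolding recip_def v_def using u s by (auto intro!: bexI[of _ "\<lambda>f. t f + p f * s"])
      then have "v s e * G (v s) = h (v s)" by (rule eq)
      moreover have ve: "v s e = 1 / s" by (simp add: v_def t(2) p(2))
      ultimately have "G (v s) = s * h (v s)" using s0 by (simp add: field_simps)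
      moreover have "G (v s) = (\<Sum>i\<le>m. Gj i (v s) * (1 / s + th (v s)) ^ i)"
        unfolding Gexp ve using m(1) above by (intro sum.mono_neutral_right) auto
      ultimately have "s ^ m * (\<Sum>i\<le>m. Gj i (v s) * (1 / s + th (v s)) ^ i) = s ^ Suc m * h (v s)"
        by simp
      moreover have "s ^ m * (\<Sum>i\<le>m. Gj i (v s) * (1 / s + th (v s)) ^ i)
          = (\<Sum>i\<le>m. Gj i (v s) * s ^ (m - i) * (1 + s * th (v s)) ^ i)"
        unfolding sum_distrib_left
      proof (rule sum.cong[OF refl])
        fix i assume i: "i \<in> {..m}"
        have "s ^ m = s ^ (m - i) * s ^ i" using i by (simp add: power_add[symmetric])
        moreover have "s ^ i * (1 / s + th (v s)) ^ i = (1 + s * th (v s)) ^ i"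
          unfolding power_mult_distrib[symmetric] using s0 by (simp add: distrib_left)
        ultimately show "s ^ m * (Gj i (v s) * (1 / s + th (v s)) ^ i) = Gj i (v s) * s ^ (m - i) * (1 + s * th (v s)) ^ i"
          by (metis (no_types, lifting) mult.assoc mult.commute)
      qed
      ultimately show ?thesis by (simp add: \<Phi>_def)
    qed
    moreover have "finite {s. \<exists>f\<in>E. t f + p f * s = 0}"
      using fin t0 p(2) by (intro finite_affine_roots) (auto, metis one_neq_zero)
    ultimately have "\<Phi> 0 = 0"
      using regular0_zero[where r = \<Phi> and S = "{s. \<exists>f\<in>E. t f + p f * s = 0}"] by blast
    moreover have "\<Phi> 0 = Gj m (v 0)"
    proof -
      have "(\<Sum>i\<le>m. Gj i (v 0) * 0 ^ (m - i) * (1 + 0 * th (v 0)) ^ i) = (\<Sum>i\<in>{m}. Gj i (v 0))"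
        by (rule sum.mono_neutral_cong_right) auto
      then show ?thesis by (simp add: \<Phi>_def)
    qed
    moreover have "Gj m (v 0) = Gj m w0"
      by (rule polyfun_cong_coords[OF Gj(1)]) (use t(3) t0 in \<open>auto simp: v_def field_simps\<close>)
    ultimately show False using w0(2) by simp
  qed
  then show ?thesis unfolding fun_eq_iff Gexp by simp
qed

lemma polyfun_divide:
  assumes "F \<in> polyfun E" "e \<in> E"
  shows "\<exists>G\<in>polyfun E. \<forall>w. F w = F (w(e := 0)) + w e * G w"
  using assms(1)
proof (induction rule: polyfun_induct)
  case (const c)
  show ?case by (rule bexI[of _ "\<lambda>w. 0"]) (auto intro: polyfun_const)
next
  case (coord f)
  show ?case by (rule bexI[of _ "\<lambda>w. if f = e then 1 else 0"]) (auto intro: polyfun_const)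
next
  case (add f g)
  then obtain G G' where "G \<in> polyfun E" "\<And>w. f w = f (w(e := 0)) + w e * G w"
    "G' \<in> polyfun E" "\<And>w. g w = g (w(e := 0)) + w e * G' w" by metis
  note * = this
  show ?case
    by (rule bexI[of _ "\<lambda>w. G w + G' w"], rule allI, subst *(2), subst *(4))
       (auto intro: polyfun_add *(1,3) simp: algebra_simps)
next
  case (mult f g)
  then obtain G G' where *: "G \<in> polyfun E" "\<And>w. f w = f (w(e := 0)) + w e * G w"
    "G' \<in> polyfun E" "\<And>w. g w = g (w(e := 0)) + w e * G' w" by metis
  have r: "(\<lambda>w. f (w(e := 0))) \<in> polyfun E"
  proof -
    have "(\<lambda>w. f (\<lambda>x. (if x = e then (\<lambda>w. 0) else (\<lambda>w. w x)) w)) \<in> polyfun E"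
      by (rule polyfun_subst[OF mult(1)]) (auto intro: polyfun_const polyfun_coord)
    moreover have "(\<lambda>x. (if x = e then (\<lambda>w. 0) else (\<lambda>w. w x)) w) = w(e := 0)" for w :: "'a \<Rightarrow> 'b" by auto
    ultimately show ?thesis by simp
  qed
  show ?case
  proof (rule bexI[of _ "\<lambda>w. G w * g w + f (w(e := 0)) * G' w"], rule allI)
    fix w
    have "f w * g w = (f (w(e := 0)) + w e * G w) * g w" using *(2) by metis
    also have "\<dots> = f (w(e := 0)) * g w + w e * G w * g w" by (simp add: algebra_simps)
    also have "f (w(e := 0)) * g w = f (w(e := 0)) * (g (w(e := 0)) + w e * G' w)" using *(4) by metis
    finally show "f w * g w = f (w(e := 0)) * g (w(e := 0)) + w e * (G w * g w + f (w(e := 0)) * G' w)"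
      by (simp add: algebra_simps)
  qed (intro polyfun_add polyfun_mult *(1,3) mult(1,2) r)
qed

text \<open>
  If \<open>\<alpha> e \<noteq> 0\<close>, the factor \<open>w e\<close> contributes one to the degree
  along \<open>\<alpha>\<close> and one to the size of the support. If \<open>\<alpha> e = 0\<close>, it
  is constant along \<open>\<alpha>\<close>, and the degrees of \<open>F\<close> and \<open>G\<close>
  agree on lines with \<open>w e \<noteq> 0\<close>; the bound extends to the other lines since the
  coefficients of \<open>G\<close> along \<open>\<alpha>\<close> are polynomials.
\<close>

lemma zonotopal_rel_quotient:
  fixes F :: "('e \<Rightarrow> 'f::field_char_0) \<Rightarrow> 'f"
  assumes fin: "finite E" and eE: "e \<in> E" and F: "F \<in> zonotopal E D" and G: "G \<in> polyfun E" and FG: "\<And>w. F w = w e * G w"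
  shows "G \<in> zonotopal_rel E (E - {e}) D"
proof (rule zonotopal_relI[OF G])
  fix \<alpha> and w :: "'e \<Rightarrow> 'f" assume al: "\<alpha> \<in> perp E D" and ne: "supp (E - {e}) \<alpha> \<noteq> {}"
  let ?k = "card (supp (E - {e}) \<alpha>) - 1"
  have finS: "finite (supp (E - {e}) \<alpha>)" using fin by (simp add: supp_def)
  then have card_pos: "card (supp (E - {e}) \<alpha>) = Suc ?k" using ne by (simp add: card_gt_0_iff)
  have neE: "supp E \<alpha> \<noteq> {}" using ne by (auto simp: supp_def)
  have Fl: "deg_less (card (supp E \<alpha>) - 1) (\<lambda>s. (w e + \<alpha> e * s) * G (\<lambda>f. w f + \<alpha> f * s))" for w
    using zonotopal_relD[OF F al neE, of w] unfolding FG .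
  show "deg_less ?k (\<lambda>s. G (\<lambda>f. w f + \<alpha> f * s))"
  proof (cases "\<alpha> e = 0")
    case False
    then have "supp E \<alpha> = insert e (supp (E - {e}) \<alpha>)" using eE by (auto simp: supp_def)
    moreover have "e \<notin> supp (E - {e}) \<alpha>" by (auto simp: supp_def)
    ultimately have c: "card (supp E \<alpha>) - 1 = Suc ?k" using finS card_pos by simp
    obtain q where "\<And>s. G (\<lambda>f. w f + \<alpha> f * s) = poly q s" using polyfun_line[OF G] by metis
    then show ?thesis using deg_less_unaffine[OF Fl[of w, unfolded c] False] by blast
  next
    case True
    then have S: "supp E \<alpha> = supp (E - {e}) \<alpha>" by (auto simp: supp_def)
    have ex: "\<exists>J C. (\<forall>j. C j \<in> polyfun E) \<and> (\<forall>w z. G (\<lambda>f. w f + \<alpha> f * z) = (\<Sum>j\<le>J. C j w * z ^ j))"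
      by (rule polyfun_expand[OF G, of "\<lambda>f w. w f" E "\<lambda>f w. \<alpha> f"]) (simp_all add: polyfun_coord polyfun_const)
    obtain J C where C: "\<And>j. C j \<in> polyfun E" "\<And>w z. G (\<lambda>f. w f + \<alpha> f * z) = (\<Sum>j\<le>J. C j w * z ^ j)"
      using ex by blast
    have C0: "C j v = 0" if v: "v e \<noteq> 0" and j: "?k \<le> j" "j \<le> J" for v j
    proof -
      have "deg_less ?k (\<lambda>s. (1 / v e) * ((v e + \<alpha> e * s) * G (\<lambda>f. v f + \<alpha> f * s)))"
        using Fl[of v] unfolding S by (rule deg_less_cmult)
      then have "deg_less ?k (\<lambda>s. G (\<lambda>f. v f + \<alpha> f * s))" using v by (simp add: True)
      then obtain r where r: "\<And>s. G (\<lambda>f. v f + \<alpha> f * s) = poly r s" "\<And>i. i \<ge> ?k \<Longrightarrow> coeff r i = 0"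
        unfolding deg_less_def by blast
      have "poly r s = poly (\<Sum>j\<le>J. monom (C j v) j) s" for s
        using r(1) C(2) by (simp add: poly_sum poly_monom)
      then have "poly r = poly (\<Sum>j\<le>J. monom (C j v) j)" by (rule ext)
      then have "r = (\<Sum>j\<le>J. monom (C j v) j)" by (simp only: poly_eq_poly_eq_iff)
      then have "coeff r j = C j v" using j(2) by (simp add: coeff_sum)
      then show ?thesis using r(2)[OF j(1)] by simp
    qed
    have C1: "C j w = 0" if j: "?k \<le> j" "j \<le> J" for j
    proof (cases "w e = 0")
      case w0: True
      obtain q where q: "\<And>s. C j (\<lambda>f. w f + (if f = e then 1 else 0) * s) = poly q s"
        using polyfun_line[OF C(1)] by metis
      have "poly q s = 0" if "s \<noteq> 0" for s
        unfolding q[symmetric] using w0 that j by (intro C0) auto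
      then have "UNIV - {0} \<subseteq> {s. poly q s = 0}" by auto
      then have "q = 0" using poly_roots_finite[of q] infinite_UNIV_char_0
        by (metis finite_Diff2 finite.emptyI finite.insertI finite_subset)
      then show ?thesis using q[of 0] by simp
    qed (use C0 j in auto)
    show ?thesis
      unfolding deg_less_def
      by (rule exI[of _ "\<Sum>j\<le>J. monom (C j w) j"]) (use C1 in \<open>auto simp: C(2) poly_sum poly_monom coeff_sum\<close>)
  qed
qed

text \<open>
  The deletion step: a direction orthogonal to \<open>D\<close> on \<open>E - {e}\<close> extends by
  zero.
\<close>

lemma zonotopal_restrict:
  fixes F :: "('e \<Rightarrow> 'f::field_char_0) \<Rightarrow> 'f"
  assumes fin: "finite E" and eE: "e \<in> E" and F: "F \<in> zonotopal E D"
  shows "(\<lambda>w. F (w(e := 0))) \<in> zonotopal (E - {e}) D"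
proof (rule zonotopal_relI)
  have "(\<lambda>w. F (\<lambda>x. (if x = e then (\<lambda>w. 0) else (\<lambda>w. w x)) w)) \<in> polyfun (E - {e})"
    by (rule polyfun_subst[OF zonotopal_rel_polyfun[OF F]]) (auto intro: polyfun_const polyfun_coord)
  moreover have "(\<lambda>x. (if x = e then (\<lambda>w. 0) else (\<lambda>w. w x)) w) = w(e := 0)" for w :: "'e \<Rightarrow> 'f" by auto
  ultimately show "(\<lambda>w. F (w(e := 0))) \<in> polyfun (E - {e})" by simp
  fix \<alpha> w assume al: "\<alpha> \<in> perp (E - {e}) D" and ne: "supp (E - {e}) \<alpha> \<noteq> {}"
  have "\<alpha>(e := 0) \<in> perp E D"
    unfolding perp_def
  proof (clarify)
    fix t assume "t \<in> D"
    then have "(\<Sum>f\<in>E - {e}. \<alpha> f * t f) = 0" using al by (simp add: perp_def)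
    then show "(\<Sum>f\<in>E. (\<alpha>(e := 0)) f * t f) = 0" using fin eE by (simp add: sum.remove)
  qed
  moreover have S: "supp E (\<alpha>(e := 0)) = supp (E - {e}) \<alpha>" by (auto simp: supp_def)
  ultimately have "deg_less (card (supp (E - {e}) \<alpha>) - 1) (\<lambda>s. F (\<lambda>f. (w(e := 0)) f + (\<alpha>(e := 0)) f * s))"
    using zonotopal_relD[OF F, of "\<alpha>(e := 0)" "w(e := 0)"] ne by simp
  moreover have "(\<lambda>f. (w(e := 0)) f + (\<alpha>(e := 0)) f * s) = (\<lambda>f. w f + \<alpha> f * s)(e := 0)" for s by auto
  ultimately show "deg_less (card (supp (E - {e}) \<alpha>) - 1) (\<lambda>s. F ((\<lambda>f. w f + \<alpha> f * s)(e := 0)))" by simp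
qed

lemma pol_restrict: "F \<in> pol E k \<Longrightarrow> (\<lambda>w. F (w(e := 0))) \<in> pol E k"
proof (induction rule: pol_induct)
  case (const k c)
  show ?case by (rule pol_const)
next
  case (add k f g)
  then show ?case by (intro pol_add)
next
  case (var k d f)
  show ?case
  proof (cases "d = e")
    case True
    then show ?thesis by (simp add: pol_const)
  next
    case False
    have "(\<lambda>w. w d * f (w(e := 0))) \<in> pol E (Suc k)" by (rule pol_var[OF var(1,3)])
    moreover have "(\<lambda>w. (w(e := 0)) d * f (w(e := 0))) = (\<lambda>w. w d * f (w(e := 0)))"
      using False by simp
    ultimately show ?thesis by (simp only:)
  qed
qed

text \<open>
  Induction on the number of coordinates. If a coordinate \<open>e\<close> vanishes on \<open>D\<close>,
  then the line in direction \<open>e\<close> has a support of size one and forces \<open>F = 0\<close>.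
  Otherwise fix any coordinate \<open>e\<close> and compare two maps on the zonotopal polynomials of
  bounded degree: \<open>T\<close> restricts to the reciprocal plane, and \<open>T1\<close> first puts
  \<open>w e = 0\<close>. Surjectivity gives \<open>T1 ` U \<subseteq> T ` U\<close>. For the criterion
  of comparable images, let \<open>T1 u0 = 0\<close> and \<open>T u0 = T1 u\<close>. By the induction
  hypothesis for the deletion, \<open>u0\<close> is zero for \<open>w e = 0\<close>, so it is \<open>w e
  * G w\<close>. On the reciprocal plane this agrees with a polynomial that does not involve \<open>w
  e\<close>, and \<open>pole_zero\<close>, with the induction hypothesis for the contraction, shows that
  \<open>G = 0\<close>.
\<close>

theorem zonotopal_injective:
  fixes D :: "('e \<Rightarrow> 'f::field_char_0) set"
  assumes "finite E" "fs.subspace D" "F \<in> zonotopal E D" "\<And>w. w \<in> recip E D \<Longrightarrow> F w = 0"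
  shows "F = (\<lambda>w. 0)"
  using assms
proof (induction "card E" arbitrary: E D F rule: less_induct)
  case (less E D F)
  note fin = less(2) and D = less(3) and F = less(4) and F0 = less(5)
  note IH = less(1)
  show ?case
  proof (cases "\<exists>e\<in>E. \<forall>t\<in>D. t e = 0")
    case True
    then obtain e where e: "e \<in> E" "\<And>t. t \<in> D \<Longrightarrow> t e = 0" by blast
    define \<alpha> where "\<alpha> f = (if f = e then 1 else (0::'f))" for f
    have "(\<Sum>f\<in>E. \<alpha> f * t f) = 0" if "t \<in> D" for t
      using e(2)[OF that] by (intro sum.neutral) (auto simp: \<alpha>_def)
    then have a: "\<alpha> \<in> perp E D" by (simp add: perp_def)
    have S: "supp E \<alpha> = {e}" using e(1) by (auto simp: supp_def \<alpha>_def)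
    have "deg_less 0 (\<lambda>s. F (\<lambda>f. w f + \<alpha> f * s))" for w using zonotopal_relD[OF F a, of w] unfolding S by simp
    then have "F (\<lambda>f. w f + \<alpha> f * 0) = 0" for w unfolding deg_less_0 by blast
    then show ?thesis by (simp add: fun_eq_iff)
  next
    case False
    show ?thesis
    proof (cases "E = {}")
      case True
      have "F w = F (\<lambda>_. 0)" for w using polyfun_cong_coords[OF zonotopal_rel_polyfun[OF F]] True by blast
      moreover have "(\<lambda>_. 0) \<in> recip E D" using True fs.subspace_0[OF D] unfolding recip_def by auto
      ultimately show ?thesis using F0 by (auto simp: fun_eq_iff)
    next
      case ne: False
      then obtain e where eE: "e \<in> E" by blast
      let ?E = "E - {e}"
      have lt: "card ?E < card E" using fin eE by (rule card_Diff1_less)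
      have finE1: "finite ?E" using fin by simp
      obtain t where t: "t \<in> D" "t e \<noteq> 0" using False eE by blast
      define p where "p = (\<lambda>f. (1 / t e) * t f)"
      have p: "p \<in> D" "p e = 1"
        unfolding p_def using fs.subspace_scale[OF D t(1), of "1 / t e"] t(2) by (simp_all only:) simp
      have D': "fs.subspace (D \<inter> {t. t e = 0})"
        by (rule fs.subspace_inter[OF D]) (auto simp: fs.subspace_def)
      interpret arrangement E D
        by unfold_locales (use fin D False in auto)
      obtain K where K: "F \<in> pol E K" using zonotopal_rel_polyfun[OF F] by (rule polyfunE)
      define U where "U = zonotopal E D \<inter> pol E K"
      define T where "T H = (\<lambda>w. if w \<in> recip E D then H w else 0)" for H :: "('e \<Rightarrow> 'f) \<Rightarrow> 'f"
      define T1 where "T1 H = T (\<lambda>w. H (w(e := 0)))" for H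
      obtain M :: "(('e \<Rightarrow> 'f) \<Rightarrow> 'f) set" where M: "finite M" "pol E K \<subseteq> fs.span M"
        using pol_finite_dimensional[OF fin] by metis
      have "F = 0"
      proof (rule fs.injective_if_comparable_image[of U M T T1])
        show "fs.subspace U"
          unfolding fs.subspace_def U_def zero_fun_def plus_fun_def
          by (auto intro: zonotopal_rel_zero pol_const zonotopal_rel_add pol_add zonotopal_rel_cmult pol_cmult)
        show "U \<subseteq> fs.span M" using M(2) U_def by auto
        show "Vector_Spaces.linear (\<lambda>c g x. c * g x) (\<lambda>c g x. c * g x) T"
          by (intro fs_linearI) (auto simp: T_def fun_eq_iff)
        show "Vector_Spaces.linear (\<lambda>c g x. c * g x) (\<lambda>c g x. c * g x) T1"
          by (intro fs_linearI) (auto simp: T_def T1_def fun_eq_iff)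
        show "T1 ` U \<subseteq> T ` U"
        proof
          fix x assume "x \<in> T1 ` U"
          then obtain H where H: "H \<in> U" "x = T1 H" by blast
          have "(\<lambda>w. H (w(e := 0))) \<in> pol E K" using H(1) U_def pol_restrict by auto
          then obtain H' where "H' \<in> U" "\<forall>w\<in>recip E D. H' w = H (w(e := 0))"
            using zonotopal_surjective unfolding U_def by blast
          then have "T1 H = T H'" by (simp add: T_def T1_def fun_eq_iff)
          then show "x \<in> T ` U" using H(2) \<open>H' \<in> U\<close> by blast
        qed
        show "T F = 0" using F0 by (auto simp: T_def fun_eq_iff)
        show "F \<in> U" using F K U_def by blast
        show "finite M" by (rule M(1))
        fix u0 u assume u0: "u0 \<in> U" and u: "u \<in> U" and T0: "T1 u0 = 0" and Tu: "T u0 = T1 u"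
        have R0: "(\<lambda>w. u0 (w(e := 0))) \<in> zonotopal ?E D" using u0 U_def by (intro zonotopal_restrict[OF fin eE]) auto
        have van: "u0 (w(e := 0)) = 0" if "w \<in> recip E D" for w
          using fun_cong[OF T0, of w] that by (simp add: T1_def T_def)
        have dense: "u0 (w(e := 0)) = 0" if "w \<in> recip ?E D" for w
          by (rule recip_dense[OF finE1 zonotopal_rel_polyfun[OF R0] D p(1), of e, unfolded insert_Diff[OF eE]])
             (use p(2) van that in auto)
        have "(\<lambda>w. u0 (w(e := 0))) = (\<lambda>w. 0)"
          by (rule IH[OF lt finE1 D R0]) (rule dense)
        then have R00: "u0 (w(e := 0)) = 0" for w by metis
        obtain G where G: "G \<in> polyfun E" "\<And>w. u0 w = u0 (w(e := 0)) + w e * G w"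
          using polyfun_divide[OF zonotopal_rel_polyfun eE] u0 U_def by (metis IntD1)
        have u0G: "u0 w = w e * G w" for w using G(2)[of w] R00 by simp
        have GP: "G \<in> zonotopal_rel E ?E D" using u0 U_def by (intro zonotopal_rel_quotient[OF fin eE _ G(1) u0G]) auto
        have hP: "(\<lambda>w. u (w(e := 0))) \<in> polyfun ?E"
          using u U_def by (intro zonotopal_rel_polyfun[OF zonotopal_restrict[OF fin eE]]) auto
        have eq: "w e * G w = u (w(e := 0))" if "w \<in> recip E D" for w
          using fun_cong[OF Tu, of w] that by (simp add: T_def T1_def u0G)
        have "G = (\<lambda>w. 0)"
          by (rule pole_zero[OF fin eE D p _ GP hP eq]) (rule IH[OF lt finE1 D'])
        then show "u0 = 0" using u0G by (auto simp: fun_eq_iff)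
      qed
      then show ?thesis by (simp add: zero_fun_def)
    qed
  qed
qed

section \<open>The polynomial ring\<close>

subsection \<open>Monomials\<close>

abbreviation lookup where "lookup \<equiv> Poly_Mapping.lookup"
abbreviation keys where "keys \<equiv> Poly_Mapping.keys"
abbreviation single where "single \<equiv> Poly_Mapping.single"

lemma sum_singles: "(p :: 'a \<Rightarrow>\<^sub>0 'b::comm_monoid_add) = (\<Sum>m\<in>keys p. single m (lookup p m))"
proof (rule poly_mapping_eqI)
  fix m
  have "lookup (\<Sum>m\<in>keys p. single m (lookup p m)) m = (\<Sum>n\<in>keys p. if n = m then lookup p n else 0)"
    unfolding lookup_sum by (intro sum.cong refl) (simp add: lookup_single when_def)
  also have "\<dots> = lookup p m" by (simp add: in_keys_iff)
  finally show "lookup p m = lookup (\<Sum>m\<in>keys p. single m (lookup p m)) m" by simp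
qed

lemma mpol_induct [case_names single add]:
  fixes P :: "('a \<Rightarrow>\<^sub>0 'b::comm_monoid_add) \<Rightarrow> bool"
  assumes "\<And>m c. P (single m c)" "\<And>p q. P p \<Longrightarrow> P q \<Longrightarrow> P (p + q)"
  shows "P p"
proof -
  have "P (\<Sum>m\<in>S. single m (lookup p m))" if "finite S" for S
    using that
  proof (induction S rule: finite_induct)
    case empty
    show ?case using assms(1)[of undefined 0] by simp
  next
    case (insert m S)
    have "P (single m (lookup p m) + (\<Sum>m\<in>S. single m (lookup p m)))"
      by (rule assms(2)[OF assms(1) insert(3)])
    then show ?case using insert(1,2) by simp
  qed
  then show ?thesis by (metis sum_singles finite_keys)
qed

definition mon_val :: "('x \<Rightarrow> 'r::comm_ring_1) \<Rightarrow> ('x \<Rightarrow>\<^sub>0 nat) \<Rightarrow> 'r" where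
  "mon_val s m = (\<Prod>x\<in>keys m. s x ^ lookup m x)"

lemma mon_val_superset: "finite S \<Longrightarrow> keys m \<subseteq> S \<Longrightarrow> mon_val s m = (\<Prod>x\<in>S. s x ^ lookup m x)"
  unfolding mon_val_def by (rule prod.mono_neutral_left) (auto simp: in_keys_iff)

lemma mon_val_0: "mon_val s 0 = 1"
  by (simp add: mon_val_def)

lemma mon_val_add: "mon_val s (m + n) = mon_val s m * mon_val s n"
proof -
  let ?S = "keys m \<union> keys n"
  have "mon_val s (m + n) = (\<Prod>x\<in>?S. s x ^ lookup (m + n) x)"
    by (rule mon_val_superset) (auto simp: keys_add)
  also have "\<dots> = (\<Prod>x\<in>?S. s x ^ lookup m x) * (\<Prod>x\<in>?S. s x ^ lookup n x)"
    by (simp add: lookup_add power_add prod.distrib)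
  also have "\<dots> = mon_val s m * mon_val s n"
    by (simp add: mon_val_superset[of ?S m] mon_val_superset[of ?S n])
  finally show ?thesis .
qed

subsection \<open>Evaluation\<close>

text \<open>
  Evaluation is needed for four maps on coefficients: the inclusion of constants, for substituting
  polynomials; the identity, for values; \<open>\<lambda>c. [:c:]\<close>, for restrictions to lines;
  and \<open>rat_const\<close>, for the map to rational functions.
\<close>

locale coeff_hom =
  fixes h :: "'f::comm_ring_1 \<Rightarrow> 'r::comm_ring_1"
  assumes h_add: "h (a + b) = h a + h b" and h_mult: "h (a * b) = h a * h b" and h_one: "h 1 = 1"
begin

lemma h_zero: "h 0 = 0"
  using h_add[of 0 0] by simp

lemma eval_poly_superset:
  assumes "finite S" "keys p \<subseteq> S"
  shows "eval_poly h s p = (\<Sum>m\<in>S. h (lookup p m) * mon_val s m)"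
  unfolding eval_poly_def mon_val_def[symmetric]
  by (rule sum.mono_neutral_left) (use assms in \<open>auto simp: in_keys_iff h_zero\<close>)

lemma eval_add: "eval_poly h s (p + q) = eval_poly h s p + eval_poly h s q"
proof -
  let ?S = "keys p \<union> keys q"
  have "eval_poly h s (p + q) = (\<Sum>m\<in>?S. h (lookup (p + q) m) * mon_val s m)"
    by (rule eval_poly_superset) (auto simp: keys_add)
  also have "\<dots> = (\<Sum>m\<in>?S. h (lookup p m) * mon_val s m) + (\<Sum>m\<in>?S. h (lookup q m) * mon_val s m)"
    by (simp add: lookup_add h_add distrib_right sum.distrib)
  finally show ?thesis by (simp add: eval_poly_superset[of ?S])
qed

lemma eval_single: "eval_poly h s (single m c) = h c * mon_val s m"
  by (subst eval_poly_superset[of "{m}"]) auto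

lemma eval_zero: "eval_poly h s 0 = 0"
  by (simp add: eval_poly_def)

lemma eval_mult: "eval_poly h s (p * q) = eval_poly h s p * eval_poly h s q"
proof (induction p rule: mpol_induct)
  case (single m c)
  show ?case
  proof (induction q rule: mpol_induct)
    case (single n d)
    show ?case by (simp add: mult_single eval_single mon_val_add h_mult mult_ac)
  next
    case (add p q)
    then show ?case by (simp add: distrib_left eval_add)
  qed
next
  case (add p q)
  then show ?case by (simp add: distrib_right eval_add)
qed

lemma eval_Cst: "eval_poly h s (Cst c) = h c"
  by (simp add: Cst_def eval_single mon_val_0)

lemma eval_one: "eval_poly h s 1 = 1"
  using eval_Cst[of s 1] by (simp add: Cst_def h_one)

lemma eval_Vr: "eval_poly h s (Vr x) = s x"
  by (simp add: Vr_def eval_single mon_val_def h_one)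

lemma eval_uminus: "eval_poly h s (- p) = - eval_poly h s p"
  using eval_add[of s p "- p"] by (simp add: eval_zero eq_neg_iff_add_eq_0 add.commute)

lemma eval_diff: "eval_poly h s (p - q) = eval_poly h s p - eval_poly h s q"
  using eval_add[of s p "- q"] by (simp add: eval_uminus)

lemma eval_sum: "eval_poly h s (\<Sum>i\<in>I. f i) = (\<Sum>i\<in>I. eval_poly h s (f i))"
  by (induction I rule: infinite_finite_induct) (auto simp: eval_zero eval_add)

lemma eval_power: "eval_poly h s (p ^ n) = eval_poly h s p ^ n"
  by (induction n) (auto simp: eval_one eval_mult)

end

lemma Cst_add: "Cst (a + b) = Cst a + Cst b" by (simp add: Cst_def single_add)
lemma Cst_mult: "Cst (a * b) = Cst a * Cst b" by (simp add: Cst_def mult_single)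
lemma Cst_one: "Cst 1 = 1" by (simp add: Cst_def)
lemma Cst_zero: "Cst 0 = 0" by (simp add: Cst_def)
lemma Cst_uminus: "Cst (- a) = - Cst a" by (simp add: Cst_def single_uminus)
lemma Cst_times_single: "Cst c * single m d = single m (c * d)"
  by (simp add: Cst_def mult_single)

lemma lookup_Cst_mult: "lookup (Cst c * p) m = c * lookup p m"
proof (induction p rule: mpol_induct)
  case (single n d)
  show ?case by (simp add: Cst_times_single lookup_single when_def)
next
  case (add p q)
  then show ?case by (simp add: distrib_left lookup_add)
qed

interpretation Cst_hom: coeff_hom Cst
  by unfold_locales (auto simp: Cst_add Cst_mult Cst_one)

interpretation id_hom: coeff_hom "\<lambda>c. c"
  by unfold_locales auto

interpretation pCons_hom: coeff_hom "\<lambda>c. [:c:]"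
  by unfold_locales auto

abbreviation ev :: "('x \<Rightarrow> 'f) \<Rightarrow> ('x, 'f::comm_ring_1) mpol \<Rightarrow> 'f" where
  "ev \<equiv> eval_poly (\<lambda>c. c)"

subsection \<open>Polynomials in a given set of variables\<close>

lemma polys_add: "p \<in> polys I \<Longrightarrow> q \<in> polys I \<Longrightarrow> p + q \<in> polys I"
  using keys_add[of p q] unfolding polys_def by blast

lemma polys_mult: "p \<in> polys I \<Longrightarrow> q \<in> polys I \<Longrightarrow> p * q \<in> polys I"
proof -
  assume p: "p \<in> polys I" and q: "q \<in> polys I"
  have "keys m \<subseteq> I" if "m \<in> keys (p * q)" for m
  proof -
    obtain a b where "m = a + b" "a \<in> keys p" "b \<in> keys q" using \<open>m \<in> keys (p * q)\<close> keys_mult[of p q] by blast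
    moreover have "keys a \<subseteq> I" "keys b \<subseteq> I" using p q calculation unfolding polys_def by auto
    ultimately show ?thesis using keys_add[of a b] by blast
  qed
  then show ?thesis unfolding polys_def by blast
qed

lemma polys_single: "keys m \<subseteq> I \<Longrightarrow> single m c \<in> polys I"
  unfolding polys_def by (cases "c = 0") auto

lemma polys_Cst: "Cst c \<in> polys I"
  unfolding Cst_def by (rule polys_single) simp

lemma polys_zero: "0 \<in> polys I" by (simp add: polys_def)

lemma polys_one: "1 \<in> polys I" using polys_Cst[of 1 I] by (simp add: Cst_one)

lemma polys_Vr: "x \<in> I \<Longrightarrow> Vr x \<in> polys I"
  unfolding Vr_def by (rule polys_single) simp

lemma polys_uminus: "p \<in> polys I \<Longrightarrow> - p \<in> polys I"
  unfolding polys_def by (simp add: in_keys_iff)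

lemma polys_diff: "p \<in> polys I \<Longrightarrow> q \<in> polys I \<Longrightarrow> p - q \<in> polys I"
  using polys_add[of p I "- q"] polys_uminus[of q I] by simp

lemma polys_sum: "(\<And>i. i \<in> S \<Longrightarrow> f i \<in> polys I) \<Longrightarrow> (\<Sum>i\<in>S. f i) \<in> polys I"
  by (induction S rule: infinite_finite_induct) (auto intro: polys_zero polys_add)

lemma polys_power: "p \<in> polys I \<Longrightarrow> p ^ n \<in> polys I"
  by (induction n) (auto intro: polys_one polys_mult)

lemma polys_prod: "(\<And>i. i \<in> S \<Longrightarrow> f i \<in> polys I) \<Longrightarrow> (\<Prod>i\<in>S. f i) \<in> polys I"
  by (induction S rule: infinite_finite_induct) (auto intro: polys_one polys_mult)

lemma polys_mono: "I \<subseteq> J \<Longrightarrow> polys I \<subseteq> polys J"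
  unfolding polys_def by blast

lemma Vr_power: "Vr x ^ k = single (single x k) 1"
  by (induction k) (auto simp: Vr_def mult_single single_add[symmetric])

lemma single_eq_prod: "single m c = Cst c * (\<Prod>x\<in>keys m. Vr x ^ lookup m x)"
proof -
  have "(\<Prod>x\<in>S. Vr x ^ lookup m x) = single (\<Sum>x\<in>S. single x (lookup m x)) (1::'b)" if "finite S" for S
    using that by (induction S rule: finite_induct) (auto simp: Vr_power mult_single)
  then have "(\<Prod>x\<in>keys m. Vr x ^ lookup m x) = single m (1::'b)"
    using sum_singles[of m] by simp
  then show ?thesis by (simp add: Cst_times_single)
qed

lemma polys_induct [consumes 1, case_names Cst Vr add mult]:
  assumes "p \<in> polys I" and C: "\<And>c. P (Cst c)" and V: "\<And>x. x \<in> I \<Longrightarrow> P (Vr x)"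
    and A: "\<And>p q. p \<in> polys I \<Longrightarrow> q \<in> polys I \<Longrightarrow> P p \<Longrightarrow> P q \<Longrightarrow> P (p + q)"
    and M: "\<And>p q. p \<in> polys I \<Longrightarrow> q \<in> polys I \<Longrightarrow> P p \<Longrightarrow> P q \<Longrightarrow> P (p * q)"
  shows "P p"
proof -
  have pow: "P (Vr x ^ k)" if "x \<in> I" for x k
  proof (induction k)
    case 0
    show ?case using C[of 1] by (simp add: Cst_one)
  next
    case (Suc k)
    have "P (Vr x * Vr x ^ k)" using that by (intro M polys_Vr polys_power V Suc)
    then show ?case by simp
  qed
  have prod: "P (\<Prod>x\<in>S. Vr x ^ f x)" if "finite S" "S \<subseteq> I" for S f
    using that
  proof (induction S rule: finite_induct)
    case empty
    show ?case using C[of 1] by (simp add: Cst_one)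
  next
    case (insert x S)
    have "P (Vr x ^ f x * (\<Prod>x\<in>S. Vr x ^ f x))"
      using insert by (intro M polys_power polys_prod polys_Vr pow) auto
    then show ?case using insert(1,2) by simp
  qed
  have mon: "P (single m c)" if "keys m \<subseteq> I" for m c
    unfolding single_eq_prod using that by (intro M C prod polys_Cst polys_prod polys_power polys_Vr) auto
  have "P (\<Sum>m\<in>S. single m (lookup p m))" if "finite S" "S \<subseteq> keys p" for S
    using that
  proof (induction S rule: finite_induct)
    case empty
    show ?case using C[of 0] by (simp add: Cst_zero)
  next
    case (insert m S)
    have *: "keys n \<subseteq> I" if "n \<in> keys p" for n using that assms(1) unfolding polys_def by blast
    have "P (single m (lookup p m) + (\<Sum>m\<in>S. single m (lookup p m)))"
      using insert * by (intro A mon polys_single polys_sum) auto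
    then show ?case using insert(1,2) by simp
  qed
  from this[of "keys p"] show ?thesis using sum_singles[of p] by simp
qed

lemma (in coeff_hom) eval_comp:
  "eval_poly h s (eval_poly Cst \<sigma> p) = eval_poly h (\<lambda>x. eval_poly h s (\<sigma> x)) p"
proof (induction p rule: mpol_induct)
  case (single m c)
  have "eval_poly h s (mon_val \<sigma> m) = mon_val (\<lambda>x. eval_poly h s (\<sigma> x)) m"
  proof -
    have "eval_poly h s (\<Prod>x\<in>S. \<sigma> x ^ lookup m x) = (\<Prod>x\<in>S. eval_poly h s (\<sigma> x) ^ lookup m x)" for S
      by (induction S rule: infinite_finite_induct) (auto simp: eval_one eval_mult eval_power)
    then show ?thesis by (simp add: mon_val_def)
  qed
  then show ?case by (simp add: Cst_hom.eval_single eval_single eval_mult eval_Cst)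
next
  case (add p q)
  then show ?case by (simp add: Cst_hom.eval_add eval_add)
qed

lemma eval_poly_polys:
  assumes "p \<in> polys I" "\<And>x. x \<in> I \<Longrightarrow> \<sigma> x \<in> polys J"
  shows "eval_poly Cst \<sigma> p \<in> polys J"
  using assms(1)
proof (induction rule: polys_induct)
  case (Cst c)
  show ?case by (simp add: Cst_hom.eval_Cst polys_Cst)
next
  case (Vr x)
  then show ?case by (simp add: Cst_hom.eval_Vr assms(2))
next
  case (add p q)
  then show ?case by (simp add: Cst_hom.eval_add polys_add)
next
  case (mult p q)
  then show ?case by (simp add: Cst_hom.eval_mult polys_mult)
qed

lemma eval_poly_cong_vars:
  assumes "p \<in> polys I" "\<And>x. x \<in> I \<Longrightarrow> s x = s' x"
  shows "eval_poly h s p = eval_poly h s' p"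
  unfolding eval_poly_def
proof (rule sum.cong[OF refl])
  fix m assume "m \<in> keys p"
  then have "keys m \<subseteq> I" using assms(1) unfolding polys_def by blast
  then have "(\<Prod>x\<in>keys m. s x ^ lookup m x) = (\<Prod>x\<in>keys m. s' x ^ lookup m x)"
    using assms(2) by (intro prod.cong) auto
  then show "h (lookup p m) * (\<Prod>x\<in>keys m. s x ^ lookup m x) = h (lookup p m) * (\<Prod>x\<in>keys m. s' x ^ lookup m x)"
    by simp
qed

lemma ev_polyfun: "p \<in> polys I \<Longrightarrow> (\<lambda>w. ev w p) \<in> polyfun I"
proof (induction rule: polys_induct)
  case (Cst c)
  show ?case by (simp add: id_hom.eval_Cst polyfun_const)
next
  case (Vr x)
  then show ?case by (simp add: id_hom.eval_Vr polyfun_coord)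
next
  case (add p q)
  then show ?case unfolding id_hom.eval_add by (intro polyfun_add)
next
  case (mult p q)
  then show ?case unfolding id_hom.eval_mult by (intro polyfun_mult)
qed

text \<open>
  With the preceding lemma, this translates between formal polynomials and polynomial functions.
\<close>

lemma polyfun_ev: "F \<in> polyfun I \<Longrightarrow> \<exists>p\<in>polys I. \<forall>w. F w = ev w p"
proof (induction rule: polyfun_induct)
  case (const c)
  show ?case by (rule bexI[of _ "Cst c"]) (auto simp: id_hom.eval_Cst polys_Cst)
next
  case (coord e)
  then show ?case by (intro bexI[of _ "Vr e"]) (auto simp: id_hom.eval_Vr polys_Vr)
next
  case (add f g)
  then obtain p q where "p \<in> polys I" "\<forall>w. f w = ev w p" "q \<in> polys I" "\<forall>w. g w = ev w q" by blast
  then show ?case by (intro bexI[of _ "p + q"]) (auto simp: id_hom.eval_add polys_add)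
next
  case (mult f g)
  then obtain p q where "p \<in> polys I" "\<forall>w. f w = ev w p" "q \<in> polys I" "\<forall>w. g w = ev w q" by blast
  then show ?case by (intro bexI[of _ "p * q"]) (auto simp: id_hom.eval_mult polys_mult)
qed

subsection \<open>Differential operators\<close>

text \<open>
  The coefficient with which the monomial operator \<open>m\<close> acts on the monomial
  \<open>n\<close>.
\<close>

definition falling :: "('x \<Rightarrow>\<^sub>0 nat) \<Rightarrow> ('x \<Rightarrow>\<^sub>0 nat) \<Rightarrow> 'f::comm_ring_1" where
  "falling m n = (\<Prod>x\<in>keys m. of_nat (fact (lookup m x) * (lookup n x choose lookup m x)))"

lemma falling_superset: "finite S \<Longrightarrow> keys m \<subseteq> S \<Longrightarrow> falling m n = (\<Prod>x\<in>S. of_nat (fact (lookup m x) * (lookup n x choose lookup m x)))"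
  unfolding falling_def by (rule prod.mono_neutral_left) (auto simp: in_keys_iff)

lemma fact_choose_add:
  "fact (a + b) * (n choose (a + b)) = fact b * (n choose b) * (fact a * ((n - b) choose a))" for n a b :: nat
proof (cases "a + b \<le> n")
  case True
  have "fact (n - (a + b)) * (fact (a + b) * (n choose (a + b))) = fact n"
    using binomial_fact_lemma[OF True] by (simp add: mult_ac)
  moreover have "fact b * fact (n - b) * (n choose b) = fact n"
    using True by (intro binomial_fact_lemma) auto
  moreover have "fact a * fact (n - b - a) * ((n - b) choose a) = fact (n - b)"
    using True by (intro binomial_fact_lemma) auto
  moreover have "n - b - a = n - (a + b)" by simp
  ultimately have "fact (n - (a + b)) * (fact (a + b) * (n choose (a + b)))
      = fact (n - (a + b)) * (fact b * (n choose b) * (fact a * ((n - b) choose a)))"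
    by (smt (verit) mult.assoc mult.commute)
  then show ?thesis by simp
next
  case False
  then show ?thesis by (cases "b \<le> n") (auto simp: binomial_eq_0)
qed

lemma falling_add: "falling (m1 + m2) n = falling m2 n * falling m1 (n - m2)"
proof -
  let ?S = "keys m1 \<union> keys m2"
  have "falling (m1 + m2) n = (\<Prod>x\<in>?S. of_nat (fact (lookup (m1 + m2) x) * (lookup n x choose lookup (m1 + m2) x)))"
    by (rule falling_superset) (auto simp: keys_add)
  also have "\<dots> = (\<Prod>x\<in>?S. of_nat (fact (lookup m2 x) * (lookup n x choose lookup m2 x)) *
      of_nat (fact (lookup m1 x) * (lookup (n - m2) x choose lookup m1 x)))"
    by (intro prod.cong refl) (simp only: lookup_add lookup_minus fact_choose_add of_nat_mult)
  finally show ?thesis by (simp add: prod.distrib falling_superset[of ?S])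
qed

lemma diff_op_superset:
  assumes "finite S" "keys D \<subseteq> S" "finite T" "keys f \<subseteq> T"
  shows "diff_op D f = (\<Sum>m\<in>S. \<Sum>n\<in>T. single (n - m) (lookup D m * lookup f n * falling m n))"
proof -
  have "diff_op D f = (\<Sum>m\<in>keys D. \<Sum>n\<in>keys f. single (n - m) (lookup D m * lookup f n * falling m n))"
    unfolding diff_op_def falling_def by simp
  also have "\<dots> = (\<Sum>m\<in>keys D. \<Sum>n\<in>T. single (n - m) (lookup D m * lookup f n * falling m n))"
    using assms by (intro sum.cong refl sum.mono_neutral_left) (auto simp: in_keys_iff)
  also have "\<dots> = (\<Sum>m\<in>S. \<Sum>n\<in>T. single (n - m) (lookup D m * lookup f n * falling m n))"
    using assms by (intro sum.mono_neutral_left) (auto simp: in_keys_iff)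
  finally show ?thesis .
qed

lemma diff_op_add_left: "diff_op (D + D') f = diff_op D f + diff_op D' f"
proof -
  let ?S = "keys D \<union> keys D'"
  have "diff_op (D + D') f = (\<Sum>m\<in>?S. \<Sum>n\<in>keys f. single (n - m) (lookup (D + D') m * lookup f n * falling m n))"
    by (rule diff_op_superset) (auto simp: keys_add)
  then show ?thesis
    by (simp add: diff_op_superset[of ?S _ "keys f"] lookup_add distrib_right single_add sum.distrib)
qed

lemma diff_op_add_right: "diff_op D (f + g) = diff_op D f + diff_op D g"
proof -
  let ?S = "keys f \<union> keys g"
  have "diff_op D (f + g) = (\<Sum>m\<in>keys D. \<Sum>n\<in>?S. single (n - m) (lookup D m * lookup (f + g) n * falling m n))"
    by (rule diff_op_superset) (auto simp: keys_add)
  then show ?thesis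
    by (simp add: diff_op_superset[of "keys D" _ ?S] lookup_add distrib_right distrib_left single_add sum.distrib)
qed

lemma diff_op_single: "diff_op (single m c) (single n d) = single (n - m) (c * d * falling m n)"
  by (subst diff_op_superset[of "{m}" _ "{n}"]) auto

lemma diff_op_zero_left: "diff_op 0 f = 0" by (simp add: diff_op_def)
lemma diff_op_zero_right: "diff_op D 0 = 0" by (simp add: diff_op_def)

lemma diff_op_mult: "diff_op (D1 * D2) f = diff_op D1 (diff_op D2 f)"
proof (induction D1 rule: mpol_induct)
  case (single m1 c1)
  show ?case
  proof (induction D2 rule: mpol_induct)
    case (single m2 c2)
    show ?case
    proof (induction f rule: mpol_induct)
      case (single n d)
      show ?case
        by (simp add: mult_single diff_op_single falling_add diff_diff_add[symmetric] add.commute[of m1] mult_ac)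
           (simp add: falling_add[symmetric] mult_ac add.commute)
    next
      case (add p q)
      then show ?case by (simp add: diff_op_add_right)
    qed
  next
    case (add p q)
    then show ?case by (simp add: distrib_left diff_op_add_left diff_op_add_right)
  qed
next
  case (add p q)
  then show ?case by (simp add: distrib_right diff_op_add_left)
qed

lemma diff_op_Cst: "diff_op (Cst c) f = Cst c * f"
proof (induction f rule: mpol_induct)
  case (single n d)
  show ?case by (simp add: Cst_def diff_op_single falling_def mult_single)
next
  case (add p q)
  then show ?case by (simp add: diff_op_add_right distrib_left)
qed

lemma diff_op_Cst_right: "diff_op D (Cst c * f) = Cst c * diff_op D f"
  by (metis diff_op_Cst diff_op_mult mult.commute)

lemma diff_op_sum_left: "diff_op (\<Sum>i\<in>I. D i) f = (\<Sum>i\<in>I. diff_op (D i) f)"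
  by (induction I rule: infinite_finite_induct) (auto simp: diff_op_zero_left diff_op_add_left)

lemma diff_op_polys: "f \<in> polys I \<Longrightarrow> diff_op D f \<in> polys I"
proof -
  assume f: "f \<in> polys I"
  have "keys (n - m) \<subseteq> keys n" for n m :: "'a \<Rightarrow>\<^sub>0 nat" by (auto simp: in_keys_iff lookup_minus)
  then show ?thesis
    unfolding diff_op_def using f by (intro polys_sum polys_single) (unfold polys_def, blast)
qed

lemma diff_op_Vr_single: "diff_op (Vr x) (single n d) = single (n - single x 1) (d * of_nat (lookup n x))"
  unfolding Vr_def by (simp add: diff_op_single falling_def)

lemma diff_op_Vr_mult: "diff_op (Vr x) (f * g) = diff_op (Vr x) f * g + f * diff_op (Vr x) g"
proof (induction f rule: mpol_induct)
  case (single n d)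
  show ?case
  proof (induction g rule: mpol_induct)
    case (single n' d')
    let ?e = "single x (1::nat)"
    have 1: "single (n - ?e + n') (d * of_nat (lookup n x) * d') = single (n + n' - ?e) (d * of_nat (lookup n x) * d')"
    proof (cases "lookup n x = 0")
      case False
      have "n - ?e + n' = n + n' - ?e"
        by (rule poly_mapping_eqI) (use False in \<open>auto simp: lookup_add lookup_minus lookup_single when_def\<close>)
      then show ?thesis by simp
    qed simp
    have 2: "single (n + (n' - ?e)) (d * (d' * of_nat (lookup n' x))) = single (n + n' - ?e) (d * (d' * of_nat (lookup n' x)))"
    proof (cases "lookup n' x = 0")
      case False
      have "n + (n' - ?e) = n + n' - ?e"
        by (rule poly_mapping_eqI) (use False in \<open>auto simp: lookup_add lookup_minus lookup_single when_def\<close>)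
      then show ?thesis by simp
    qed simp
    show ?case
      unfolding mult_single diff_op_Vr_single 1 2 single_add[symmetric]
      by (simp add: lookup_add algebra_simps)
  next
    case (add p q)
    then show ?case by (simp add: distrib_left diff_op_add_right)
  qed
next
  case (add p q)
  then show ?case by (simp add: distrib_right diff_op_add_right)
qed

text \<open>
  As a polynomial function this is a linear form; as a differential operator it is the derivative in
  direction \<open>a\<close>.
\<close>

definition lin_poly :: "'x set \<Rightarrow> ('x \<Rightarrow> 'f) \<Rightarrow> ('x, 'f::comm_ring_1) mpol" where
  "lin_poly S a = (\<Sum>x\<in>S. Cst (a x) * Vr x)"

lemma diff_op_lin_poly: "diff_op (lin_poly S a) f = (\<Sum>x\<in>S. Cst (a x) * diff_op (Vr x) f)"
  unfolding lin_poly_def diff_op_sum_left diff_op_mult diff_op_Cst ..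

lemma diff_op_lin_poly_mult: "diff_op (lin_poly S a) (f * g) = diff_op (lin_poly S a) f * g + f * diff_op (lin_poly S a) g"
  unfolding diff_op_lin_poly diff_op_Vr_mult
  by (simp add: algebra_simps sum.distrib sum_distrib_left sum_distrib_right)

lemma diff_op_lin_poly_Cst: "diff_op (lin_poly S a) (Cst c) = 0"
  unfolding diff_op_lin_poly by (intro sum.neutral ballI) (simp add: Cst_def diff_op_Vr_single)

lemma diff_op_lin_poly_Vr: "finite S \<Longrightarrow> x \<in> S \<Longrightarrow> diff_op (lin_poly S a) (Vr x) = Cst (a x)"
proof -
  assume S: "finite S" "x \<in> S"
  have "diff_op (Vr y) (Vr x) = (if y = x then 1 else 0 :: ('a, 'b) mpol)" for y
    unfolding Vr_def[of x] diff_op_Vr_single by (auto simp: lookup_single when_def)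
  then have "diff_op (lin_poly S a) (Vr x) = (\<Sum>y\<in>S. if y = x then Cst (a y) else 0)"
    unfolding diff_op_lin_poly by (intro sum.cong) auto
  then show ?thesis using S by simp
qed

text \<open>
  The restriction to the line through \<open>s\<close> in direction \<open>a\<close>.
\<close>

definition on_line :: "('x \<Rightarrow> 'f) \<Rightarrow> ('x \<Rightarrow> 'f) \<Rightarrow> ('x, 'f::comm_ring_1) mpol \<Rightarrow> 'f poly" where
  "on_line s a f = eval_poly (\<lambda>c. [:c:]) (\<lambda>x. [:s x, a x:]) f"

lemma poly_on_line: "poly (on_line s a f) z = ev (\<lambda>x. s x + a x * z) f"
  unfolding on_line_def eval_poly_def by (simp add: poly_sum poly_prod mult.commute)

text \<open>
  The chain rule: along a line in direction \<open>a\<close> the directional derivative becomes the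
  ordinary one.
\<close>

lemma pderiv_on_line:
  assumes "finite S" "f \<in> polys S"
  shows "pderiv (on_line s a f) = on_line s a (diff_op (lin_poly S a) f)"
  using assms(2)
proof (induction rule: polys_induct)
  case (Cst c)
  show ?case by (simp add: diff_op_lin_poly_Cst on_line_def pCons_hom.eval_Cst pCons_hom.eval_zero pderiv_pCons)
next
  case (Vr x)
  then show ?case using assms(1) by (simp add: diff_op_lin_poly_Vr on_line_def pCons_hom.eval_Cst pCons_hom.eval_Vr pderiv_pCons)
next
  case (add p q)
  then show ?case by (simp add: diff_op_add_right on_line_def pCons_hom.eval_add pderiv_add)
next
  case (mult p q)
  then show ?case
    by (simp add: diff_op_lin_poly_mult on_line_def pCons_hom.eval_add pCons_hom.eval_mult pderiv_mult)
qed

lemma pderiv_on_line_power: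
  assumes "finite S" "f \<in> polys S"
  shows "(pderiv ^^ k) (on_line s a f) = on_line s a (diff_op (lin_poly S a ^ k) f)"
proof (induction k)
  case 0
  have "diff_op 1 f = f" using diff_op_Cst[of 1 f] by (simp add: Cst_one)
  then show ?case by simp
next
  case (Suc k)
  then show ?case using assms by (simp add: diff_op_mult pderiv_on_line diff_op_polys)
qed

lemma ev_0: "ev (\<lambda>x. 0) g = lookup (g :: ('x, 'f::comm_ring_1) mpol) 0"
proof (induction g rule: mpol_induct)
  case (single m c)
  have "mon_val (\<lambda>x. 0) m = (if m = 0 then 1 else (0::'f))"
  proof (cases "m = 0")
    case False
    then obtain x where "x \<in> keys m" by (metis keys_eq_empty ex_in_conv)
    then show ?thesis
      unfolding mon_val_def using False by (auto simp: in_keys_iff power_0_left intro!: prod_zero bexI[of _ x])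
  qed (simp add: mon_val_0)
  then show ?case by (simp add: id_hom.eval_single lookup_single when_def)
next
  case (add p q)
  then show ?case by (simp add: id_hom.eval_add lookup_add)
qed

definition mfact :: "('x \<Rightarrow>\<^sub>0 nat) \<Rightarrow> 'f::comm_ring_1" where
  "mfact m = (\<Prod>x\<in>keys m. of_nat (fact (lookup m x)))"

lemma mfact_nonzero: "mfact m \<noteq> (0::'f::field_char_0)"
  unfolding mfact_def by simp

lemma pairing_add_left: "sym_pairing (f + g) D = sym_pairing f D + sym_pairing g D"
  by (simp add: sym_pairing_def diff_op_add_right lookup_add)

lemma pairing_add_right: "sym_pairing f (D + D') = sym_pairing f D + sym_pairing f D'"
  by (simp add: sym_pairing_def diff_op_add_left lookup_add)

lemma pairing_single_single:
  "sym_pairing (single n d) (single m c) = (if m = n then c * d * mfact m else (0::'f::comm_ring_1))"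
proof -
  have "falling m n = (0::'f)" if nm: "n - m = 0" "m \<noteq> n"
  proof -
    have le: "lookup n x \<le> lookup m x" for x
      using arg_cong[OF nm(1), of "\<lambda>p. lookup p x"] by (simp add: lookup_minus)
    obtain x where "lookup m x \<noteq> lookup n x" using nm(2) by (metis poly_mapping_eqI)
    then have "lookup n x < lookup m x" using le[of x] by simp
    then have "x \<in> keys m" "lookup n x choose lookup m x = 0" by (auto simp: in_keys_iff)
    then show ?thesis unfolding falling_def by (intro prod_zero bexI[of _ x]) (auto simp: binomial_eq_0)
  qed
  moreover have "falling m m = (mfact m :: 'f)" unfolding falling_def mfact_def by simp
  ultimately show ?thesis
    unfolding sym_pairing_def diff_op_single by (auto simp: lookup_single when_def)
qed

lemma pairing_single_right: "sym_pairing f (single m c) = c * lookup f m * mfact m"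
proof (induction f rule: mpol_induct)
  case (single n d)
  show ?case by (simp add: pairing_single_single lookup_single when_def)
next
  case (add p q)
  then show ?case by (simp add: pairing_add_left lookup_add algebra_simps)
qed

lemma pairing_single_left: "sym_pairing (single m c) D = c * lookup D m * mfact m"
proof (induction D rule: mpol_induct)
  case (single n d)
  show ?case by (simp add: pairing_single_single lookup_single when_def mult.commute)
next
  case (add p q)
  then show ?case by (simp add: pairing_add_right lookup_add algebra_simps)
qed

lemma finite_vars: "\<exists>S. finite S \<and> f \<in> polys S"
  by (rule exI[of _ "\<Union> (keys ` keys f)"]) (auto simp: polys_def)

text \<open>
  A polynomial that vanishes as a function has vanishing derivatives, as can be seen on lines, and its
  coefficients are, up to factorials, values of derivatives at the origin.
\<close>

lemma ev_eq_0_imp: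
  fixes f :: "('x, 'f::field_char_0) mpol"
  assumes "\<And>s. ev s f = 0"
  shows "f = 0"
proof (rule poly_mapping_eqI)
  fix m
  obtain S where S: "finite S" "f + single m 1 \<in> polys S" "f \<in> polys S" "single m (1::'f) \<in> polys S"
  proof -
    obtain S T where "finite S" "f \<in> polys S" "finite T" "single m (1::'f) \<in> polys T" using finite_vars by metis
    then show thesis using that[of "S \<union> T"] polys_mono[of S "S \<union> T"] polys_mono[of T "S \<union> T"] polys_add by blast
  qed
  have "\<forall>f\<in>polys S. (\<forall>s. ev s f = 0) \<longrightarrow> (\<forall>s. ev s (diff_op D f) = 0)" if "D \<in> polys S" for D :: "('x, 'f) mpol"
    using that
  proof (induction rule: polys_induct)
    case (Cst c)
    show ?case by (simp add: diff_op_Cst id_hom.eval_mult)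
  next
    case (Vr x)
    show ?case
    proof (intro ballI impI allI)
      fix f :: "('x, 'f) mpol" and s :: "'x \<Rightarrow> 'f" assume f: "f \<in> polys S" "\<forall>s. ev s f = 0"
      define a where "a y = (if y = x then 1 else 0 :: 'f)" for y
      have "lin_poly S a = (\<Sum>y\<in>S. if y = x then Vr y else 0)"
        unfolding lin_poly_def by (rule sum.cong) (auto simp: a_def Cst_one Cst_zero)
      then have v: "lin_poly S a = Vr x" using S(1) Vr by simp
      have "poly (on_line s a f) z = 0" for z using f(2) by (simp add: poly_on_line)
      then have "on_line s a f = 0" using poly_all_0_iff_0 by blast
      then have "poly (on_line s a (diff_op (Vr x) f)) 0 = 0"
        using pderiv_on_line[OF S(1) f(1), of s a] v by simp
      then show "ev s (diff_op (Vr x) f) = 0" by (simp add: poly_on_line)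
    qed
  next
    case (add p q)
    then show ?case by (simp add: diff_op_add_left id_hom.eval_add)
  next
    case (mult p q)
    then show ?case by (simp add: diff_op_mult diff_op_polys)
  qed
  from this[OF S(4)] have "ev (\<lambda>x. 0) (diff_op (single m 1) f) = 0" using S(3) assms by blast
  then have "sym_pairing f (single m 1) = 0" by (simp add: ev_0 sym_pairing_def)
  then show "lookup f m = lookup 0 m" by (simp add: pairing_single_right mfact_nonzero)
qed

lemma pderiv_power_eq_0_iff:
  fixes q :: "'f::field_char_0 poly"
  shows "(pderiv ^^ k) q = 0 \<longleftrightarrow> (\<forall>i\<ge>k. coeff q i = 0)"
proof (induction k arbitrary: q)
  case 0
  show ?case by (auto simp: poly_eq_iff)
next
  case (Suc k)
  have "(pderiv ^^ Suc k) q = (pderiv ^^ k) (pderiv q)" by (simp add: funpow_swap1)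
  also have "\<dots> = 0 \<longleftrightarrow> (\<forall>i\<ge>k. coeff (pderiv q) i = 0)" by (rule Suc)
  also have "\<dots> \<longleftrightarrow> (\<forall>i\<ge>k. coeff q (Suc i) = 0)" by (simp add: coeff_pderiv del: of_nat_Suc)
  also have "\<dots> \<longleftrightarrow> (\<forall>i\<ge>Suc k. coeff q i = 0)" by (metis Suc_le_D Suc_le_mono)
  finally show ?case .
qed

text \<open>
  This turns the differential equations that define the internal space into bounds for the degree on
  lines.
\<close>

lemma diff_op_lin_poly_power_eq_0_iff:
  fixes f :: "('x, 'f::field_char_0) mpol"
  assumes "finite S" "f \<in> polys S"
  shows "diff_op (lin_poly S a ^ k) f = 0 \<longleftrightarrow> (\<forall>s. deg_less k (\<lambda>z. ev (\<lambda>x. s x + a x * z) f))"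
proof -
  have "deg_less k (\<lambda>z. ev (\<lambda>x. s x + a x * z) f) \<longleftrightarrow> (\<forall>i\<ge>k. coeff (on_line s a f) i = 0)" for s
  proof
    assume "deg_less k (\<lambda>z. ev (\<lambda>x. s x + a x * z) f)"
    then obtain q where q: "\<And>z. poly (on_line s a f) z = poly q z" "\<forall>i\<ge>k. coeff q i = 0"
      unfolding deg_less_def poly_on_line by blast
    have "poly (on_line s a f) = poly q" using q(1) by (rule ext)
    then have "on_line s a f = q" by (simp only: poly_eq_poly_eq_iff)
    then show "\<forall>i\<ge>k. coeff (on_line s a f) i = 0" using q(2) by simp
  qed (auto simp: deg_less_def poly_on_line[symmetric])
  then have "(\<forall>s. deg_less k (\<lambda>z. ev (\<lambda>x. s x + a x * z) f)) \<longleftrightarrow> (\<forall>s. on_line s a (diff_op (lin_poly S a ^ k) f) = 0)"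
    by (simp add: pderiv_power_eq_0_iff[symmetric] pderiv_on_line_power[OF assms])
  also have "\<dots> \<longleftrightarrow> diff_op (lin_poly S a ^ k) f = 0"
  proof
    assume l: "\<forall>s. on_line s a (diff_op (lin_poly S a ^ k) f) = 0"
    show "diff_op (lin_poly S a ^ k) f = 0"
    proof (rule ev_eq_0_imp)
      fix s show "ev s (diff_op (lin_poly S a ^ k) f) = 0"
        using poly_on_line[of s a "diff_op (lin_poly S a ^ k) f" 0] l by simp
    qed
  qed (simp add: on_line_def pCons_hom.eval_zero)
  finally show ?thesis by simp
qed

section \<open>Linear spaces in coordinates\<close>

text \<open>
  The functional is one on \<open>x\<close> and zero on a basis of \<open>U\<close>.
\<close>

lemma (in vector_space) separating_functional:
  assumes "subspace U" "x \<notin> U"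
  shows "\<exists>\<phi>. Vector_Spaces.linear scale (*) \<phi> \<and> (\<forall>u\<in>U. \<phi> u = 0) \<and> \<phi> x \<noteq> 0"
proof -
  interpret F: vector_space "(*) :: 'a \<Rightarrow> 'a \<Rightarrow> 'a" by unfold_locales (auto simp: algebra_simps)
  interpret p: vector_space_pair scale "(*) :: 'a \<Rightarrow> 'a \<Rightarrow> 'a" by unfold_locales
  obtain B where B: "B \<subseteq> U" "independent B" "U \<subseteq> span B"
    using maximal_independent_subset by blast
  have spB: "span B = U" using B assms(1) by (metis span_minimal subset_antisym)
  have ind: "independent (insert x B)" using B(2) assms(2) spB by (simp add: independent_insert)
  obtain \<phi> where \<phi>: "Vector_Spaces.linear scale (*) \<phi>" "\<And>b. b \<in> insert x B \<Longrightarrow> \<phi> b = (if b = x then 1 else 0)"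
    using p.linear_independent_extend[OF ind, of "\<lambda>b. if b = x then 1 else 0"] by blast
  have xB: "x \<notin> B" using B(1) assms(2) by blast
  have "\<phi> u = (\<lambda>_. 0) u" if "u \<in> span B" for u
    by (rule p.linear_eq_on[OF \<phi>(1) p.linear_zero that]) (use \<phi>(2) xB in auto)
  then show ?thesis using \<phi> spB by (intro exI[of _ \<phi>]) auto
qed

locale framed_space =
  fixes A :: "('f::field_char_0, 'v::ab_group_add, 'e) linspace" and X :: "('f, 'v, 'e) frame"
  assumes LS: "linear_space A" and FR: "frame_of A X"
begin

abbreviation "E \<equiv> edges A"
abbreviation "B \<equiv> bas X"
abbreviation "L \<equiv> sub A"
abbreviation "dv \<equiv> dual_vec A X"

sublocale V: vector_space "smul A"
  using LS unfolding linear_space_def by blast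

sublocale F: vector_space "(*) :: 'f \<Rightarrow> 'f \<Rightarrow> 'f"
  by unfold_locales (auto simp: algebra_simps)

sublocale VF: vector_space_pair "smul A" "(*) :: 'f \<Rightarrow> 'f \<Rightarrow> 'f"
  by unfold_locales

declare F.scale_scale [simp del]

lemma finE: "finite E" using LS unfolding linear_space_def by blast

lemma subL: "V.subspace L" using LS unfolding linear_space_def by blast

lemma vec_line: "e \<in> E \<Longrightarrow> vec X e \<in> line A e" and vec_nonzero: "e \<in> E \<Longrightarrow> vec X e \<noteq> 0"
  using FR unfolding frame_of_def by auto

lemma line_eq: assumes e: "e \<in> E" shows "line A e = range (\<lambda>c. smul A c (vec X e))"
proof -
  obtain v where v: "line A e = V.span {v}"
    using LS e unfolding linear_space_def by blast
  have sp: "V.span {u} = range (\<lambda>c. smul A c u)" for u by (auto simp: V.span_singleton)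
  obtain c where c: "vec X e = smul A c v" using vec_line[OF e] unfolding v sp by blast
  have c0: "c \<noteq> 0" using c vec_nonzero[OF e] by auto
  show ?thesis unfolding v sp
  proof (intro subset_antisym subsetI)
    fix x assume "x \<in> range (\<lambda>c. smul A c v)"
    then obtain d where "x = smul A d v" by blast
    then have "x = smul A (d / c) (vec X e)" using c c0 by simp
    then show "x \<in> range (\<lambda>c. smul A c (vec X e))" by blast
  next
    fix x assume "x \<in> range (\<lambda>c. smul A c (vec X e))"
    then show "x \<in> range (\<lambda>c. smul A c v)" using c by auto
  qed
qed

lemma decomposition: "\<exists>!a. a \<in> (\<Pi>\<^sub>E e\<in>E. line A e) \<and> x = (\<Sum>e\<in>E. a e)"
  using LS unfolding linear_space_def by blast

lemma component_eq:
  assumes "x = (\<Sum>e\<in>E. smul A (c e) (vec X e))" "e \<in> E"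
  shows "component A e x = smul A (c e) (vec X e)"
proof -
  define a where "a = restrict (\<lambda>e. smul A (c e) (vec X e)) E"
  have "a \<in> (\<Pi>\<^sub>E e\<in>E. line A e)" unfolding a_def using line_eq by auto
  moreover have "x = (\<Sum>e\<in>E. a e)" unfolding a_def assms(1) by (intro sum.cong) auto
  ultimately have "(THE a. a \<in> (\<Pi>\<^sub>E e\<in>E. line A e) \<and> x = (\<Sum>e\<in>E. a e)) = a"
    by (intro the1_equality decomposition conjI)
  then show ?thesis unfolding component_def using assms(2) by (simp add: a_def)
qed

lemma dv_unique:
  assumes "x = (\<Sum>e\<in>E. smul A (c e) (vec X e))" "e \<in> E"
  shows "dv e x = c e"
  unfolding dual_vec_def component_eq[OF assms]
  by (rule the_equality) (use vec_nonzero[OF assms(2)] in auto)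

lemma dv_expand: "x = (\<Sum>e\<in>E. smul A (dv e x) (vec X e))"
proof -
  obtain a where a: "a \<in> (\<Pi>\<^sub>E e\<in>E. line A e)" "x = (\<Sum>e\<in>E. a e)" using decomposition[of x] by blast
  have "\<forall>e\<in>E. \<exists>c. a e = smul A c (vec X e)" using a(1) line_eq by (auto simp: PiE_iff)
  then obtain c where c: "\<And>e. e \<in> E \<Longrightarrow> a e = smul A (c e) (vec X e)" by metis
  have x: "x = (\<Sum>e\<in>E. smul A (c e) (vec X e))" unfolding a(2) using c by (intro sum.cong) auto
  have "(\<Sum>e\<in>E. smul A (dv e x) (vec X e)) = (\<Sum>e\<in>E. smul A (c e) (vec X e))"
    using dv_unique[OF x] by (intro sum.cong) auto
  then show ?thesis using x by simp
qed

lemma dv_add: "e \<in> E \<Longrightarrow> dv e (x + y) = dv e x + dv e y"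
proof (rule dv_unique)
  show "x + y = (\<Sum>e\<in>E. smul A (dv e x + dv e y) (vec X e))"
    unfolding V.scale_left_distrib sum.distrib dv_expand[symmetric] ..
qed

lemma dv_scale: "e \<in> E \<Longrightarrow> dv e (smul A c x) = c * dv e x"
proof (rule dv_unique)
  have "smul A c x = smul A c (\<Sum>e\<in>E. smul A (dv e x) (vec X e))" using dv_expand by simp
  then show "smul A c x = (\<Sum>e\<in>E. smul A (c * dv e x) (vec X e))" by (simp add: V.scale_sum_right)
qed

lemma linear_dv: "e \<in> E \<Longrightarrow> Vector_Spaces.linear (smul A) (*) (dv e)"
  unfolding Vector_Spaces.linear_iff
  by (intro conjI allI V.vector_space_axioms F.vector_space_axioms dv_add dv_scale)

lemma dv_vec: "e \<in> E \<Longrightarrow> f \<in> E \<Longrightarrow> dv e (vec X f) = (if e = f then 1 else 0)"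
proof (rule dv_unique)
  assume "e \<in> E" "f \<in> E"
  then have "(\<Sum>e\<in>E. smul A (if e = f then 1 else 0) (vec X e)) = (\<Sum>e\<in>{f}. vec X e)"
    using finE by (intro sum.mono_neutral_cong_right) auto
  then show "vec X f = (\<Sum>e\<in>E. smul A (if e = f then 1 else 0) (vec X e))" by simp
qed auto

lemma linear_expand:
  assumes "Vector_Spaces.linear (smul A) (*) \<phi>"
  shows "\<phi> x = (\<Sum>e\<in>E. dv e x * \<phi> (vec X e))"
proof -
  interpret l: Vector_Spaces.linear "smul A" "(*)" \<phi> by (rule assms)
  have "\<phi> x = \<phi> (\<Sum>e\<in>E. smul A (dv e x) (vec X e))" using dv_expand by simp
  then show ?thesis by (simp add: l.sum l.scale)
qed

lemma mult_num_eq: "mult_num A \<alpha> = card (supp E (\<lambda>e. dv e \<alpha>))"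
proof -
  have "component A e \<alpha> \<noteq> 0 \<longleftrightarrow> dv e \<alpha> \<noteq> 0" if "e \<in> E" for e
    using component_eq[OF dv_expand that] vec_nonzero[OF that] by simp
  then have "{e \<in> E. component A e \<alpha> \<noteq> 0} = supp E (\<lambda>e. dv e \<alpha>)" unfolding supp_def by blast
  then show ?thesis by (simp add: mult_num_def)
qed

lemma dv_nonzero: "\<alpha> \<noteq> 0 \<Longrightarrow> supp E (\<lambda>e. dv e \<alpha>) \<noteq> {}"
proof
  assume "\<alpha> \<noteq> 0" "supp E (\<lambda>e. dv e \<alpha>) = {}"
  then have "dv e \<alpha> = 0" if "e \<in> E" for e using that by (auto simp: supp_def)
  then have "(\<Sum>e\<in>E. smul A (dv e \<alpha>) (vec X e)) = 0" by (intro sum.neutral) auto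
  then show False using dv_expand[of \<alpha>] \<open>\<alpha> \<noteq> 0\<close> by simp
qed

subsection \<open>The annihilator\<close>

abbreviation "Ann \<equiv> annihilator A"

lemma AnnD: "\<phi> \<in> Ann \<Longrightarrow> Vector_Spaces.linear (smul A) (*) \<phi>" "\<phi> \<in> Ann \<Longrightarrow> x \<in> L \<Longrightarrow> \<phi> x = 0"
  unfolding annihilator_def by auto

lemma AnnI: "Vector_Spaces.linear (smul A) (*) \<phi> \<Longrightarrow> (\<And>x. x \<in> L \<Longrightarrow> \<phi> x = 0) \<Longrightarrow> \<phi> \<in> Ann"
  unfolding annihilator_def by auto

text \<open>
  The subspace \<open>L\<^sup>\<bottom>\<close> in the coordinates with respect to the
  \<open>w\<^sub>e\<close>.
\<close>

definition D :: "('e \<Rightarrow> 'f) set" where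
  "D = (\<lambda>\<phi> e. \<phi> (vec X e)) ` Ann"

lemma subspace_D: "fs.subspace D"
  unfolding fs.subspace_def
proof (intro conjI ballI allI)
  have "(\<lambda>x. 0) \<in> Ann" by (rule AnnI) (rule VF.linear_zero, simp)
  then show "0 \<in> D" unfolding D_def by (force simp: zero_fun_def)
next
  fix s t assume "s \<in> D" "t \<in> D"
  then obtain \<phi> \<psi> where *: "\<phi> \<in> Ann" "s = (\<lambda>e. \<phi> (vec X e))" "\<psi> \<in> Ann" "t = (\<lambda>e. \<psi> (vec X e))"
    unfolding D_def by blast
  have "(\<lambda>x. \<phi> x + \<psi> x) \<in> Ann"
    by (rule AnnI, rule VF.linear_compose_add[OF AnnD(1)[OF *(1)] AnnD(1)[OF *(3)]])
       (simp add: AnnD(2)[OF *(1)] AnnD(2)[OF *(3)])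
  then show "s + t \<in> D" unfolding D_def *(2,4) by (force simp: plus_fun_def)
next
  fix c t assume "t \<in> D"
  then obtain \<phi> where *: "\<phi> \<in> Ann" "t = (\<lambda>e. \<phi> (vec X e))" unfolding D_def by blast
  have "(\<lambda>x. c * \<phi> x) \<in> Ann"
    by (rule AnnI, rule VF.linear_compose_scale_right[OF AnnD(1)[OF *(1)]])
       (simp add: AnnD(2)[OF *(1)])
  then show "(\<lambda>e. c * t e) \<in> D" unfolding D_def *(2) by force
qed

text \<open>
  The vectors orthogonal to \<open>L\<^sup>\<bottom>\<close> are those of \<open>L\<close>, since every
  vector outside \<open>L\<close> is separated from \<open>L\<close> by a functional.
\<close>

lemma perp_D: "\<alpha> \<in> perp E D \<longleftrightarrow> (\<Sum>e\<in>E. smul A (\<alpha> e) (vec X e)) \<in> L"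
proof -
  let ?x = "\<Sum>e\<in>E. smul A (\<alpha> e) (vec X e)"
  have lin: "\<phi> ?x = (\<Sum>e\<in>E. \<alpha> e * \<phi> (vec X e))" if "\<phi> \<in> Ann" for \<phi>
  proof -
    interpret l: Vector_Spaces.linear "smul A" "(*)" \<phi> by (rule AnnD[OF that])
    show ?thesis by (simp add: l.sum l.scale)
  qed
  have "\<alpha> \<in> perp E D \<longleftrightarrow> (\<forall>\<phi>\<in>Ann. \<phi> ?x = 0)"
    unfolding perp_def D_def using lin by auto
  also have "\<dots> \<longleftrightarrow> ?x \<in> L"
  proof
    assume *: "\<forall>\<phi>\<in>Ann. \<phi> ?x = 0"
    show "?x \<in> L"
    proof (rule ccontr)
      assume "?x \<notin> L"
      then obtain \<phi> where "Vector_Spaces.linear (smul A) (*) \<phi>" "\<forall>u\<in>L. \<phi> u = 0" "\<phi> ?x \<noteq> 0"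
        using V.separating_functional[OF subL] by blast
      then show False using * AnnI by blast
    qed
  qed (use AnnD in blast)
  finally show ?thesis .
qed

subsection \<open>Coordinates on L\<close>

abbreviation "rep \<equiv> V.representation B"

lemma indB: "V.independent B" and spanB: "V.span B = L"
  using FR unfolding frame_of_def by auto

lemma finB: "finite B"
proof -
  have "x \<in> V.span (vec X ` E)" for x
  proof -
    have "(\<Sum>e\<in>E. smul A (dv e x) (vec X e)) \<in> V.span (vec X ` E)"
      by (intro V.span_sum V.span_scale V.span_base) auto
    then show ?thesis using dv_expand[of x] by simp
  qed
  then show ?thesis using V.independent_span_bound[OF _ indB, of "vec X ` E"] finE by blast
qed

lemma BL: "B \<subseteq> L" using spanB V.span_superset by blast

lemma rep_sum: "x \<in> L \<Longrightarrow> (\<Sum>b\<in>B. smul A (rep x b) b) = x"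
  using V.sum_representation_eq[OF indB, of x B] finB spanB by simp

definition lin_comb :: "('v \<Rightarrow> 'f) \<Rightarrow> 'v" where "lin_comb s = (\<Sum>b\<in>B. smul A (s b) b)"

lemma lin_comb_L: "lin_comb s \<in> L"
  unfolding lin_comb_def using BL by (intro V.subspace_sum[OF subL] V.subspace_scale[OF subL]) auto

lemma sym_vec_eq: "sym_vec A X \<alpha> = lin_poly B (rep \<alpha>)"
  unfolding sym_vec_def lin_poly_def ..

text \<open>
  The coordinates in \<open>V\<close> of the point of \<open>L\<close> with coordinates
  \<open>s\<close>.
\<close>

definition pt :: "('v \<Rightarrow> 'f) \<Rightarrow> 'e \<Rightarrow> 'f" where
  "pt s e = (\<Sum>b\<in>B. dv e b * s b)"

lemma pt_eq: "e \<in> E \<Longrightarrow> pt s e = dv e (lin_comb s)"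
proof -
  assume e: "e \<in> E"
  interpret l: Vector_Spaces.linear "smul A" "(*)" "dv e" by (rule linear_dv[OF e])
  show ?thesis unfolding pt_def lin_comb_def by (simp add: l.sum l.scale mult.commute)
qed

lemma pt_rep: "e \<in> E \<Longrightarrow> x \<in> L \<Longrightarrow> pt (rep x) e = dv e x"
  by (simp add: pt_eq lin_comb_def rep_sum)

lemma ex_coord: "\<exists>l. Vector_Spaces.linear (smul A) (*) l \<and> (\<forall>c\<in>B. l c = (if c = b then 1 else 0))"
  using VF.linear_independent_extend[OF indB, of "\<lambda>c. if c = b then 1 else 0"] by blast

text \<open>
  An extension to \<open>V\<close> of the functional dual to the basis element \<open>b\<close> of
  \<open>L\<close>. Together they give a projection from \<open>V\<close> onto \<open>L\<close>, in
  coordinates \<open>proj\<close>, for which \<open>pt\<close> is a section.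
\<close>

definition coord :: "'v \<Rightarrow> 'v \<Rightarrow> 'f" where
  "coord b = (SOME l. Vector_Spaces.linear (smul A) (*) l \<and> (\<forall>c\<in>B. l c = (if c = b then 1 else 0)))"

lemma coord_linear: "Vector_Spaces.linear (smul A) (*) (coord b)"
  and coord_basis: "c \<in> B \<Longrightarrow> coord b c = (if c = b then 1 else 0)"
  using someI_ex[OF ex_coord[of b]] unfolding coord_def[symmetric] by auto

lemma coord_lin_comb: "b \<in> B \<Longrightarrow> coord b (lin_comb s) = s b"
proof -
  assume b: "b \<in> B"
  interpret l: Vector_Spaces.linear "smul A" "(*)" "coord b" by (rule coord_linear)
  have "coord b (lin_comb s) = (\<Sum>c\<in>B. if c = b then s c else 0)"
    unfolding lin_comb_def l.sum l.scale by (intro sum.cong) (auto simp: coord_basis)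
  then show ?thesis using b finB by simp
qed

definition proj :: "('e \<Rightarrow> 'f) \<Rightarrow> 'v \<Rightarrow> 'f" where
  "proj w b = (\<Sum>e\<in>E. coord b (vec X e) * w e)"

lemma proj_dv: "proj (\<lambda>e. dv e x) b = coord b x"
  unfolding proj_def linear_expand[OF coord_linear, of b x] by (simp add: mult.commute)

lemma proj_cong: "(\<And>e. e \<in> E \<Longrightarrow> w e = w' e) \<Longrightarrow> proj w = proj w'"
  unfolding proj_def by (rule ext, rule sum.cong) auto

lemma proj_pt: "b \<in> B \<Longrightarrow> proj (pt s) b = s b"
proof -
  assume b: "b \<in> B"
  have "proj (pt s) = proj (\<lambda>e. dv e (lin_comb s))" by (rule proj_cong) (rule pt_eq)
  then show ?thesis using b by (simp add: proj_dv coord_lin_comb)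
qed

lemma proj_line: "proj (\<lambda>e. w e + \<alpha> e * s) b = proj w b + proj \<alpha> b * s"
  unfolding proj_def by (simp add: algebra_simps sum.distrib sum_distrib_left)

subsection \<open>Restriction and lift\<close>

text \<open>
  Pullback of polynomials along the projection from \<open>V\<close> onto \<open>L\<close>, a section of
  the restriction to \<open>L\<close>.
\<close>

definition lift :: "('v, 'f) mpol \<Rightarrow> ('e, 'f) mpol" where
  "lift = eval_poly Cst (\<lambda>b. lin_poly E (\<lambda>e. coord b (vec X e)))"

lemma lin_poly_polys: "lin_poly S a \<in> polys S"
  unfolding lin_poly_def by (intro polys_sum polys_mult polys_Cst polys_Vr)

lemma restr_def': "restr A X = eval_poly Cst (\<lambda>e. lin_poly B (dv e))"
  unfolding restr_def lin_poly_def ..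

lemma restr_polys: "p \<in> polys E \<Longrightarrow> restr A X p \<in> polys B"
  unfolding restr_def' by (erule eval_poly_polys) (rule lin_poly_polys)

lemma lift_polys: "f \<in> polys B \<Longrightarrow> lift f \<in> polys E"
  unfolding lift_def by (erule eval_poly_polys) (rule lin_poly_polys)

lemma ev_lin_poly: "ev s (lin_poly S a) = (\<Sum>x\<in>S. a x * s x)"
  unfolding lin_poly_def by (simp add: id_hom.eval_sum id_hom.eval_mult id_hom.eval_Cst id_hom.eval_Vr)

lemma ev_restr: "ev s (restr A X p) = ev (pt s) p"
  unfolding restr_def' id_hom.eval_comp by (simp add: ev_lin_poly pt_def[abs_def])

lemma ev_lift: "ev w (lift f) = ev (proj w) f"
  unfolding lift_def id_hom.eval_comp by (simp add: ev_lin_poly proj_def[abs_def])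

lemma mpol_eqI: "(\<And>s. ev s f = ev s g) \<Longrightarrow> f = g" for f g :: "('x, 'f) mpol"
  using ev_eq_0_imp[of "f - g"] by (simp add: id_hom.eval_diff)

lemma restr_lift: "f \<in> polys B \<Longrightarrow> restr A X (lift f) = f"
  by (rule mpol_eqI, unfold ev_restr ev_lift, rule eval_poly_cong_vars) (auto simp: proj_pt)

lemma restr_add: "restr A X (p + q) = restr A X p + restr A X q"
  and restr_mult: "restr A X (p * q) = restr A X p * restr A X q"
  and restr_diff: "restr A X (p - q) = restr A X p - restr A X q"
  and restr_Cst: "restr A X (Cst c) = Cst c"
  unfolding restr_def' by (simp_all add: Cst_hom.eval_add Cst_hom.eval_mult Cst_hom.eval_diff Cst_hom.eval_Cst)

lemma lift_add: "lift (p + q) = lift p + lift q"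
  and lift_mult: "lift (p * q) = lift p * lift q"
  and lift_Cst: "lift (Cst c) = Cst c"
  unfolding lift_def by (simp_all add: Cst_hom.eval_add Cst_hom.eval_mult Cst_hom.eval_diff Cst_hom.eval_Cst)

lemma sym_covec_polys: "sym_covec A X \<phi> \<in> polys E"
  unfolding sym_covec_def by (intro polys_sum polys_mult polys_Cst polys_Vr)

lemma ev_sym_covec: "ev w (sym_covec A X \<phi>) = (\<Sum>e\<in>E. \<phi> (vec X e) * w e)"
  unfolding sym_covec_def by (simp add: id_hom.eval_sum id_hom.eval_mult id_hom.eval_Cst id_hom.eval_Vr)

lemma restr_sym_covec: "\<phi> \<in> Ann \<Longrightarrow> restr A X (sym_covec A X \<phi>) = 0"
proof (rule mpol_eqI)
  fix s assume phi: "\<phi> \<in> Ann"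
  have "ev s (restr A X (sym_covec A X \<phi>)) = (\<Sum>e\<in>E. dv e (lin_comb s) * \<phi> (vec X e))"
    unfolding ev_restr ev_sym_covec by (rule sum.cong) (auto simp: pt_eq)
  also have "\<dots> = 0" using linear_expand[OF AnnD(1)[OF phi]] AnnD(2)[OF phi lin_comb_L] by metis
  finally show "ev s (restr A X (sym_covec A X \<phi>)) = ev s 0" by (simp add: id_hom.eval_zero)
qed

text \<open>
  The ideal generated by \<open>L\<^sup>\<bottom>\<close> in \<open>Sym V\<^sup>*\<close>, in a form
  that gives an induction on the number of summands.
\<close>

inductive_set ann_ideal :: "('e, 'f) mpol set" where
  zero: "0 \<in> ann_ideal"
| step: "p \<in> ann_ideal \<Longrightarrow> \<phi> \<in> Ann \<Longrightarrow> q \<in> polys E \<Longrightarrow> p + sym_covec A X \<phi> * q \<in> ann_ideal"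

lemma ann_ideal_add: "p \<in> ann_ideal \<Longrightarrow> q \<in> ann_ideal \<Longrightarrow> q + p \<in> ann_ideal"
  by (induction rule: ann_ideal.induct) (auto simp: add.assoc[symmetric] intro: ann_ideal.step)

lemma ann_ideal_mult: "p \<in> ann_ideal \<Longrightarrow> r \<in> polys E \<Longrightarrow> p * r \<in> ann_ideal"
proof (induction rule: ann_ideal.induct)
  case zero
  then show ?case by (simp add: ann_ideal.zero)
next
  case (step p \<phi> q)
  have "p * r + sym_covec A X \<phi> * (q * r) \<in> ann_ideal"
    using step by (intro ann_ideal.step polys_mult) auto
  then show ?case by (simp add: algebra_simps)
qed

text \<open>
  For a coordinate, \<open>dv e\<close> minus the pullback of its restriction is a functional that
  vanishes on \<open>L\<close>. The ideal property extends this to all polynomials, and it follows that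
  the restriction to \<open>L\<close> has kernel \<open>ann_ideal\<close>.
\<close>

lemma lift_restr: "p \<in> polys E \<Longrightarrow> p - lift (restr A X p) \<in> ann_ideal"
proof (induction rule: polys_induct)
  case (Cst c)
  show ?case by (simp add: restr_Cst lift_Cst ann_ideal.zero)
next
  case (Vr e)
  define \<phi> where "\<phi> x = dv e x - (\<Sum>b\<in>B. dv e b * coord b x)" for x
  have lin: "Vector_Spaces.linear (smul A) (*) \<phi>"
    unfolding \<phi>_def[abs_def]
    by (intro VF.linear_compose_sub VF.linear_compose_sum ballI VF.linear_compose_scale_right linear_dv coord_linear Vr)
  interpret l: Vector_Spaces.linear "smul A" "(*)" \<phi> by (rule lin)
  have "\<phi> c = 0" if c: "c \<in> B" for c
  proof -
    have "(\<Sum>b\<in>B. dv e b * coord b c) = (\<Sum>b\<in>B. if b = c then dv e b else 0)"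
      using c by (intro sum.cong) (auto simp: coord_basis)
    then show ?thesis using c finB by (simp add: \<phi>_def)
  qed
  then have "\<phi> x = 0" if "x \<in> L" for x
    using VF.linear_eq_on[OF lin VF.linear_zero, of x B] that spanB by simp
  then have phi: "\<phi> \<in> Ann" using lin by (intro AnnI)
  have "Vr e - lift (restr A X (Vr e)) = sym_covec A X \<phi>"
  proof (rule mpol_eqI)
    fix w
    have "ev w (lift (restr A X (Vr e))) = (\<Sum>b\<in>B. dv e b * proj w b)"
      unfolding ev_lift by (simp add: restr_def' Cst_hom.eval_Vr ev_lin_poly)
    also have "\<dots> = (\<Sum>b\<in>B. \<Sum>f\<in>E. dv e b * coord b (vec X f) * w f)"
      unfolding proj_def sum_distrib_left by (simp only: mult.assoc)
    also have "\<dots> = (\<Sum>f\<in>E. \<Sum>b\<in>B. dv e b * coord b (vec X f) * w f)" by (rule sum.swap)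
    also have "\<dots> = (\<Sum>f\<in>E. (\<Sum>b\<in>B. dv e b * coord b (vec X f)) * w f)"
      by (simp only: sum_distrib_right)
    finally have 1: "ev w (lift (restr A X (Vr e))) = (\<Sum>f\<in>E. (\<Sum>b\<in>B. dv e b * coord b (vec X f)) * w f)" .
    have "(\<Sum>f\<in>E. dv e (vec X f) * w f) = (\<Sum>f\<in>E. if f = e then w f else 0)"
      using Vr by (intro sum.cong) (auto simp: dv_vec)
    then have "(\<Sum>f\<in>E. dv e (vec X f) * w f) = w e" using Vr finE by simp
    then show "ev w (Vr e - lift (restr A X (Vr e))) = ev w (sym_covec A X \<phi>)"
      unfolding id_hom.eval_diff id_hom.eval_Vr 1 ev_sym_covec \<phi>_def
      by (simp add: left_diff_distrib sum_subtractf)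
  qed
  moreover have "0 + sym_covec A X \<phi> * 1 \<in> ann_ideal" by (rule ann_ideal.step[OF ann_ideal.zero phi polys_one])
  ultimately show ?case by simp
next
  case (add p q)
  have "(p - lift (restr A X p)) + (q - lift (restr A X q)) \<in> ann_ideal" by (rule ann_ideal_add[OF add(4,3)])
  then show ?case by (simp add: restr_add lift_add algebra_simps)
next
  case (mult p q)
  have "(p - lift (restr A X p)) * q + (q - lift (restr A X q)) * lift (restr A X p) \<in> ann_ideal"
    using mult by (intro ann_ideal_add ann_ideal_mult lift_polys restr_polys)
  then show ?case by (simp add: restr_mult lift_mult algebra_simps)
qed

lemma restr_eq_0: "p \<in> polys E \<Longrightarrow> restr A X p = 0 \<Longrightarrow> p \<in> ann_ideal"
  using lift_restr[of p] by (simp add: lift_def Cst_hom.eval_zero)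

section \<open>The direct sum decomposition\<close>

lemma P_iff: "f \<in> P_minus A X \<longleftrightarrow> f \<in> polys B \<and>
   (\<forall>\<alpha>\<in>L. \<alpha> \<noteq> 0 \<longrightarrow> (\<forall>s. deg_less (mult_num A \<alpha> - 1) (\<lambda>z. ev (\<lambda>b. s b + rep \<alpha> b * z) f)))"
  by (auto simp: P_minus_def sym_vec_eq diff_op_lin_poly_power_eq_0_iff[OF finB])

text \<open>
  A line orthogonal to \<open>D\<close> has a direction in \<open>L\<close>, on which the projection is
  the identity; and \<open>mult_num\<close> is the size of the support.
\<close>

lemma zonotopal_of_P:
  assumes f: "f \<in> P_minus A X"
  shows "(\<lambda>w. ev (proj w) f) \<in> zonotopal E D"
proof (rule zonotopal_relI)
  have fB: "f \<in> polys B" using f P_iff by blast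
  show "(\<lambda>w. ev (proj w) f) \<in> polyfun E"
    using ev_polyfun[OF lift_polys[OF fB]] unfolding ev_lift .
  fix \<alpha> w assume a: "\<alpha> \<in> perp E D" and ne: "supp E \<alpha> \<noteq> {}"
  define x where "x = (\<Sum>e\<in>E. smul A (\<alpha> e) (vec X e))"
  have xL: "x \<in> L" using a perp_D x_def by blast
  have dvx: "dv e x = \<alpha> e" if "e \<in> E" for e using dv_unique[OF x_def that] .
  have S: "supp E (\<lambda>e. dv e x) = supp E \<alpha>" using dvx by (auto simp: supp_def)
  have x0: "x \<noteq> 0"
  proof
    assume "x = 0"
    moreover obtain e where "e \<in> E" "\<alpha> e \<noteq> 0" using ne by (auto simp: supp_def)
    moreover have "dv e 0 = 0" if "e \<in> E" for e using dv_scale[OF that, of 0 0] by simp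
    ultimately show False using dvx by metis
  qed
  have px: "proj \<alpha> b = rep x b" if b: "b \<in> B" for b
  proof -
    have "proj \<alpha> = proj (\<lambda>e. dv e x)" by (rule proj_cong) (simp add: dvx)
    then have "proj \<alpha> b = coord b (lin_comb (rep x))" using rep_sum[OF xL] by (simp add: proj_dv lin_comb_def)
    then show ?thesis using coord_lin_comb[OF b] by simp
  qed
  have "ev (proj (\<lambda>e. w e + \<alpha> e * s)) f = ev (\<lambda>b. proj w b + rep x b * s) f" for s
    by (rule eval_poly_cong_vars[OF fB]) (simp add: proj_line px)
  moreover have "deg_less (mult_num A x - 1) (\<lambda>z. ev (\<lambda>b. proj w b + rep x b * z) f)"
    using f xL x0 unfolding P_iff by blast
  ultimately show "deg_less (card (supp E \<alpha>) - 1) (\<lambda>s. ev (proj (\<lambda>e. w e + \<alpha> e * s)) f)"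
    by (simp add: mult_num_eq S)
qed

end

context framed_space
begin

lemma P_of_zonotopal:
  assumes p: "p \<in> polys E" and zonotopal: "(\<lambda>w. ev w p) \<in> zonotopal E D"
  shows "restr A X p \<in> P_minus A X"
  unfolding P_iff
proof (intro conjI ballI impI allI)
  show "restr A X p \<in> polys B" by (rule restr_polys[OF p])
  fix \<alpha> s assume a: "\<alpha> \<in> L" "\<alpha> \<noteq> 0"
  let ?\<alpha> = "\<lambda>e. dv e \<alpha>"
  have "?\<alpha> \<in> perp E D" unfolding perp_D using a(1) dv_expand[of \<alpha>] by simp
  then have "deg_less (mult_num A \<alpha> - 1) (\<lambda>z. ev (\<lambda>e. pt s e + ?\<alpha> e * z) p)"
    unfolding mult_num_eq using zonotopal_relD[OF zonotopal _ dv_nonzero[OF a(2)]] by blast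
  moreover have "ev (\<lambda>b. s b + rep \<alpha> b * z) (restr A X p) = ev (\<lambda>e. pt s e + ?\<alpha> e * z) p" for z
  proof -
    have "pt (\<lambda>b. s b + rep \<alpha> b * z) e = pt s e + ?\<alpha> e * z" if e: "e \<in> E" for e
    proof -
      have "pt (\<lambda>b. s b + rep \<alpha> b * z) e = pt s e + pt (rep \<alpha>) e * z"
        unfolding pt_def by (simp add: algebra_simps sum.distrib sum_distrib_left)
      then show ?thesis using pt_rep[OF e a(1)] by simp
    qed
    then have "ev (pt (\<lambda>b. s b + rep \<alpha> b * z)) p = ev (\<lambda>e. pt s e + ?\<alpha> e * z) p"
      by (rule eval_poly_cong_vars[OF p])
    then show ?thesis by (simp only: ev_restr)
  qed
  ultimately show "deg_less (mult_num A \<alpha> - 1) (\<lambda>z. ev (\<lambda>b. s b + rep \<alpha> b * z) (restr A X p))" by (simp only:)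
qed

definition recip_ideal :: "('e, 'f) mpol set" where
  "recip_ideal = {p \<in> polys E. \<forall>w\<in>recip E D. ev w p = 0}"

text \<open>
  If a coordinate vanishes on \<open>D\<close>, the reciprocal plane is empty, and zero represents
  everything.
\<close>

lemma zonotopal_representative:
  assumes "p \<in> polys E"
  shows "\<exists>q\<in>polys E. (\<lambda>w. ev w q) \<in> zonotopal E D \<and> p - q \<in> recip_ideal"
proof (cases "\<forall>e\<in>E. \<exists>t\<in>D. t e \<noteq> 0")
  case True
  interpret arrangement E D by (unfold_locales, rule finE, rule subspace_D, use True in blast)
  obtain k where "(\<lambda>w. ev w p) \<in> pol E k" using ev_polyfun[OF assms] by (rule polyfunE)
  then obtain F where F: "F \<in> zonotopal E D" "\<forall>w\<in>recip E D. F w = ev w p" using zonotopal_surjective[of "\<lambda>w. ev w p" k] by blast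
  obtain q where q: "q \<in> polys E" "\<forall>w. F w = ev w q" using polyfun_ev[OF zonotopal_rel_polyfun[OF F(1)]] by blast
  have "F = (\<lambda>w. ev w q)" using q(2) by blast
  then have "(\<lambda>w. ev w q) \<in> zonotopal E D" using F(1) by simp
  moreover have "p - q \<in> recip_ideal" unfolding recip_ideal_def using assms q F(2) by (auto simp: polys_diff id_hom.eval_diff)
  ultimately show ?thesis using q(1) by blast
next
  case False
  then have "recip E D = {}" unfolding recip_def by (auto, metis mult_zero_right zero_neq_one)
  then have "p - 0 \<in> recip_ideal" using assms unfolding recip_ideal_def by simp
  moreover have "(\<lambda>w. ev w (0 :: ('e, 'f) mpol)) \<in> zonotopal E D" by (simp add: id_hom.eval_zero zonotopal_rel_zero)
  ultimately show ?thesis using polys_zero by blast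
qed

text \<open>
  The difference of \<open>p\<close> and the pullback of \<open>f\<close> lies in the ideal generated by
  \<open>L\<^sup>\<bottom>\<close>. Replacing the coefficients of the forms of
  \<open>L\<^sup>\<bottom>\<close> in it by zonotopal representatives gives a zonotopal polynomial
  \<open>H\<close> that still vanishes on \<open>L\<close> and has the same values on the reciprocal
  plane. The pullback of \<open>f\<close> plus \<open>H\<close> is zonotopal and agrees with
  \<open>p\<close> on the reciprocal plane, where \<open>p\<close> vanishes. So it is zero, and its
  restriction to \<open>L\<close> is \<open>f\<close>.
\<close>

theorem P_inter_K:
  assumes f: "f \<in> P_minus A X" and p: "p \<in> recip_ideal" "restr A X p = f"
  shows "f = 0"
proof -
  have pE: "p \<in> polys E" using p recip_ideal_def by blast
  have "r \<in> ann_ideal \<Longrightarrow> \<exists>H\<in>zonotopal E D. (\<forall>w\<in>recip E D. H w = ev w r) \<and> (\<forall>s. H (pt s) = 0)" for r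
  proof (induction rule: ann_ideal.induct)
    case zero
    show ?case by (rule bexI[of _ "\<lambda>w. 0"]) (auto simp: id_hom.eval_zero zonotopal_rel_zero)
  next
    case (step r \<phi> q)
    then obtain H where H: "H \<in> zonotopal E D" "\<forall>w\<in>recip E D. H w = ev w r" "\<forall>s. H (pt s) = 0" by blast
    obtain q' where q': "q' \<in> polys E" "(\<lambda>w. ev w q') \<in> zonotopal E D" "q - q' \<in> recip_ideal"
      using zonotopal_representative[OF step(3)] by blast
    have phi: "(\<lambda>e. \<phi> (vec X e)) \<in> D" using step(2) unfolding D_def by blast
    have th0: "(\<Sum>e\<in>E. \<phi> (vec X e) * pt s e) = 0" for s
      using restr_sym_covec[OF step(2)] ev_restr[of s "sym_covec A X \<phi>"]
      by (simp add: ev_sym_covec id_hom.eval_zero)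
    have qq: "ev w q = ev w q'" if "w \<in> recip E D" for w
      using q'(3) that unfolding recip_ideal_def by (simp add: id_hom.eval_diff)
    show ?case
    proof (rule bexI[of _ "\<lambda>w. H w + (\<Sum>e\<in>E. \<phi> (vec X e) * w e) * ev w q'"], intro conjI ballI allI)
      show "(\<lambda>w. H w + (\<Sum>e\<in>E. \<phi> (vec X e) * w e) * ev w q') \<in> zonotopal E D"
        by (rule zonotopal_rel_add[OF H(1) zonotopal_rel_mult_form[OF finE q'(2) phi]])
      fix w assume "w \<in> recip E D"
      then show "H w + (\<Sum>e\<in>E. \<phi> (vec X e) * w e) * ev w q' = ev w (r + sym_covec A X \<phi> * q)"
        using H(2) qq by (simp add: id_hom.eval_add id_hom.eval_mult ev_sym_covec)
    next
      fix s show "H (pt s) + (\<Sum>e\<in>E. \<phi> (vec X e) * pt s e) * ev (pt s) q' = 0"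
        using H(3) th0 by simp
    qed
  qed
  from this[OF lift_restr[OF pE]] obtain H where H: "H \<in> zonotopal E D"
    "\<forall>w\<in>recip E D. H w = ev w (p - lift f)" "\<forall>s. H (pt s) = 0" unfolding p(2) by blast
  have "(\<lambda>w. ev (proj w) f + H w) \<in> zonotopal E D" by (rule zonotopal_rel_add[OF zonotopal_of_P[OF f] H(1)])
  then have 0: "(\<lambda>w. ev (proj w) f + H w) = (\<lambda>w. 0)"
  proof (rule zonotopal_injective[OF finE subspace_D])
    fix w assume "w \<in> recip E D"
    then show "ev (proj w) f + H w = 0"
      using H(2) p(1) unfolding recip_ideal_def by (simp add: id_hom.eval_diff ev_lift)
  qed
  have fB: "f \<in> polys B" using f P_iff by blast
  show ?thesis
  proof (rule ev_eq_0_imp)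
    fix s
    have "ev (proj (pt s)) f = 0" using fun_cong[OF 0, of "pt s"] H(3) by simp
    moreover have "ev (proj (pt s)) f = ev s f" by (rule eval_poly_cong_vars[OF fB]) (rule proj_pt)
    ultimately show "ev s f = 0" by simp
  qed
qed

theorem P_plus_K:
  assumes f: "f \<in> polys B"
  shows "\<exists>g\<in>P_minus A X. \<exists>p\<in>recip_ideal. f = g + restr A X p"
proof -
  obtain q where q: "q \<in> polys E" "(\<lambda>w. ev w q) \<in> zonotopal E D" "lift f - q \<in> recip_ideal"
    using zonotopal_representative[OF lift_polys[OF f]] by blast
  have "f = restr A X q + restr A X (lift f - q)" by (simp add: restr_diff restr_lift[OF f])
  then show ?thesis using P_of_zonotopal[OF q(1,2)] q(3) by blast
qed

end

section \<open>Graded subspaces and perfect pairings\<close>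

subsection \<open>Polynomial rings\<close>

lemma cring_poly_ring: "cring (poly_ring I :: ('x, 'f::comm_ring_1) mpol ring)"
proof (rule cringI)
  show "abelian_group (poly_ring I :: ('x, 'f) mpol ring)"
    by (rule abelian_groupI)
       (auto simp: poly_ring_def polys_add polys_zero add.assoc add.commute intro: bexI[of _ "- x" for x] polys_uminus)
  show "comm_monoid (poly_ring I :: ('x, 'f) mpol ring)"
    by (rule comm_monoidI) (auto simp: poly_ring_def polys_mult polys_one mult.assoc mult.commute)
qed (auto simp: poly_ring_def distrib_right)

lemma poly_ring_simps [simp]:
  "carrier (poly_ring I) = polys I" "x \<otimes>\<^bsub>poly_ring I\<^esub> y = x * y" "\<one>\<^bsub>poly_ring I\<^esub> = 1"
  "\<zero>\<^bsub>poly_ring I\<^esub> = 0" "x \<oplus>\<^bsub>poly_ring I\<^esub> y = x + y"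
  by (auto simp: poly_ring_def)

lemma finsum_poly_ring:
  fixes u :: "'k \<Rightarrow> ('x, 'f::comm_ring_1) mpol"
  assumes "finite S" "\<And>k. k \<in> S \<Longrightarrow> u k \<in> polys I"
  shows "(\<Oplus>\<^bsub>poly_ring I\<^esub>k\<in>S. u k) = (\<Sum>k\<in>S. u k)"
proof -
  interpret R: cring "poly_ring I :: ('x, 'f) mpol ring" by (rule cring_poly_ring)
  show ?thesis
    using assms
  proof (induction S rule: finite_induct)
    case empty
    then show ?case by simp
  next
    case (insert k S)
    then show ?case by (subst R.finsum_insert) auto
  qed
qed

subsection \<open>Homogeneous components\<close>

text \<open>
  The homogeneous component for an arbitrary weight of the monomials; the weight is
  \<open>mon_deg\<close> for \<open>Sym L\<^sup>*\<close> and its negative for Sym L.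
\<close>

definition hcomp :: "(('x \<Rightarrow>\<^sub>0 nat) \<Rightarrow> int) \<Rightarrow> int \<Rightarrow> ('x, 'f::comm_ring_1) mpol \<Rightarrow> ('x, 'f) mpol" where
  "hcomp d k f = (\<Sum>m\<in>{m \<in> keys f. d m = k}. single m (lookup f m))"

lemma lookup_hcomp: "lookup (hcomp d k f) m = (if d m = k then lookup f m else 0)"
proof -
  have "lookup (hcomp d k f) m = (\<Sum>n\<in>{m \<in> keys f. d m = k}. if n = m then lookup f n else 0)"
    unfolding hcomp_def lookup_sum by (intro sum.cong refl) (simp add: lookup_single when_def)
  then show ?thesis by (auto simp: in_keys_iff)
qed

lemma keys_hcomp: "keys (hcomp d k f) = {m \<in> keys f. d m = k}"
  by (auto simp: in_keys_iff lookup_hcomp split: if_splits)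

lemma hcomp_add: "hcomp d k (f + g) = hcomp d k f + hcomp d k g"
  by (rule poly_mapping_eqI) (simp add: lookup_hcomp lookup_add)

lemma hcomp_Cst_mult: "hcomp d k (Cst c * f) = Cst c * hcomp d k f"
  by (rule poly_mapping_eqI) (simp add: lookup_hcomp lookup_Cst_mult)

lemma hcomp_polys: "f \<in> polys I \<Longrightarrow> hcomp d k f \<in> polys I"
  by (auto simp: polys_def keys_hcomp)

definition homog :: "'x set \<Rightarrow> (('x \<Rightarrow>\<^sub>0 nat) \<Rightarrow> int) \<Rightarrow> int \<Rightarrow> ('x, 'f::comm_ring_1) mpol set" where
  "homog I d k = {f \<in> polys I. \<forall>m\<in>keys f. d m = k}"

lemma hcomp_homog: "f \<in> polys I \<Longrightarrow> hcomp d k f \<in> homog I d k"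
  unfolding homog_def by (auto simp: hcomp_polys keys_hcomp)

lemma hcomp_id: "f \<in> homog I d k \<Longrightarrow> hcomp d k f = f"
  by (rule poly_mapping_eqI) (auto simp: lookup_hcomp homog_def in_keys_iff)

lemma hcomp_other: "f \<in> homog I d k \<Longrightarrow> l \<noteq> k \<Longrightarrow> hcomp d l f = 0"
  by (rule poly_mapping_eqI) (auto simp: lookup_hcomp homog_def in_keys_iff)

lemma hcomp_sum: "finite S \<Longrightarrow> d ` keys f \<subseteq> S \<Longrightarrow> (\<Sum>k\<in>S. hcomp d k f) = f"
proof (rule poly_mapping_eqI)
  fix m assume S: "finite S" "d ` keys f \<subseteq> S"
  have "lookup (\<Sum>k\<in>S. hcomp d k f) m = (\<Sum>k\<in>S. if k = d m then lookup f m else 0)"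
    unfolding lookup_sum lookup_hcomp by (intro sum.cong) auto
  moreover have "d m \<notin> S \<Longrightarrow> lookup f m = 0" using S(2) by (metis image_subset_iff in_keys_iff)
  ultimately show "lookup (\<Sum>k\<in>S. hcomp d k f) m = lookup f m" using S(1) by auto
qed

definition mpol_subspace :: "'x set \<Rightarrow> ('x, 'f::comm_ring_1) mpol set \<Rightarrow> bool" where
  "mpol_subspace I W \<longleftrightarrow> W \<subseteq> polys I \<and> 0 \<in> W \<and> (\<forall>x\<in>W. \<forall>y\<in>W. x + y \<in> W) \<and> (\<forall>c. \<forall>x\<in>W. Cst c * x \<in> W)"

lemma mpol_subspace_F: "mpol_subspace I W \<longleftrightarrow> F_subspace (poly_ring I) Cst W"
  unfolding mpol_subspace_def F_subspace_def by simp

lemma mpol_subspaceD: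
  assumes "mpol_subspace I W"
  shows "x \<in> W \<Longrightarrow> x \<in> polys I" "0 \<in> W" "x \<in> W \<Longrightarrow> y \<in> W \<Longrightarrow> x + y \<in> W" "x \<in> W \<Longrightarrow> Cst c * x \<in> W"
  using assms unfolding mpol_subspace_def by auto

lemma mpol_subspace_diff: "mpol_subspace I W \<Longrightarrow> x \<in> W \<Longrightarrow> y \<in> W \<Longrightarrow> x - y \<in> W"
  using mpol_subspaceD(3)[of I W x "Cst (-1) * y"] mpol_subspaceD(4)[of I W y "-1"] by (simp add: Cst_uminus Cst_one)

lemma mpol_subspace_sum: "mpol_subspace I W \<Longrightarrow> (\<And>i. i \<in> S \<Longrightarrow> f i \<in> W) \<Longrightarrow> (\<Sum>i\<in>S. f i) \<in> W"
  by (induction S rule: infinite_finite_induct) (auto intro: mpol_subspaceD)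

lemma homog_iff: "f \<in> homog I d k \<longleftrightarrow> f \<in> polys I \<and> (\<forall>m. d m \<noteq> k \<longrightarrow> lookup f m = 0)"
  unfolding homog_def by (auto simp: in_keys_iff)

lemma mpol_subspace_homog: "mpol_subspace I (homog I d k)"
  unfolding mpol_subspace_def
proof (intro conjI ballI allI)
  show "homog I d k \<subseteq> polys I" unfolding homog_def by simp
  show "0 \<in> homog I d k" by (simp add: homog_iff polys_zero)
  show "x + y \<in> homog I d k" if "x \<in> homog I d k" "y \<in> homog I d k" for x y
    using that by (simp add: homog_iff polys_add lookup_add)
  show "Cst c * x \<in> homog I d k" if "x \<in> homog I d k" for c x
    using that by (simp add: homog_iff polys_mult polys_Cst lookup_Cst_mult)
qed

lemma mpol_subspace_Int: "mpol_subspace I V \<Longrightarrow> mpol_subspace I W \<Longrightarrow> mpol_subspace I (V \<inter> W)"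
  unfolding mpol_subspace_def by blast

abbreviation "dg \<equiv> (\<lambda>m. int (mon_deg m))"
abbreviation "dn \<equiv> (\<lambda>m. - int (mon_deg m))"

lemma graded_poly_ring:
  fixes W :: "('x, 'f::comm_ring_1) mpol set"
  assumes W: "mpol_subspace I W" and hom: "\<And>f k. f \<in> W \<Longrightarrow> hcomp d k f \<in> W"
  shows "graded_space (poly_ring I) Cst W (\<lambda>k. W \<inter> homog I d k)"
  unfolding graded_space_def mpol_subspace_F[symmetric]
proof (intro conjI allI ballI)
  show "mpol_subspace I (W \<inter> homog I d k)" for k by (intro mpol_subspace_Int W mpol_subspace_homog)
  fix x assume x: "x \<in> W"
  have xI: "x \<in> polys I" using mpol_subspaceD(1)[OF W x] .
  let ?P = "\<lambda>u. (\<forall>k. u k \<in> W \<inter> homog I d k) \<and> finite {k. u k \<noteq> \<zero>\<^bsub>poly_ring I\<^esub>} \<and>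
      x = (\<Oplus>\<^bsub>poly_ring I\<^esub>k\<in>{k. u k \<noteq> \<zero>\<^bsub>poly_ring I\<^esub>}. u k)"
  show "\<exists>!u. ?P u"
  proof (rule ex1I[of _ "\<lambda>k. hcomp d k x"])
    have sub: "{k. hcomp d k x \<noteq> 0} \<subseteq> d ` keys x"
      by (auto simp: poly_mapping_eq_iff fun_eq_iff lookup_hcomp in_keys_iff split: if_splits)
    have fin: "finite {k. hcomp d k x \<noteq> 0}" by (rule finite_subset[OF sub]) simp
    have "(\<Sum>k\<in>{k. hcomp d k x \<noteq> 0}. hcomp d k x) = (\<Sum>k\<in>d ` keys x. hcomp d k x)"
      using sub by (intro sum.mono_neutral_left) auto
    also have "\<dots> = x" by (rule hcomp_sum) auto
    finally show "?P (\<lambda>k. hcomp d k x)"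
      using x hom xI fin by (auto simp: finsum_poly_ring hcomp_polys hcomp_homog)
  next
    fix u assume u: "?P u"
    have uI: "u k \<in> polys I" for k using u mpol_subspaceD(1)[OF W] by blast
    have x_eq: "x = (\<Sum>k\<in>{k. u k \<noteq> 0}. u k)" using u uI by (simp add: finsum_poly_ring)
    show "u = (\<lambda>k. hcomp d k x)"
    proof (rule ext, rule poly_mapping_eqI)
      fix k m
      have uD: "lookup (u l) m = 0" if "d m \<noteq> l" for l
        using u that unfolding homog_def by (metis (mono_tags, lifting) IntD2 in_keys_iff mem_Collect_eq)
      have "lookup x m = (\<Sum>l\<in>{k. u k \<noteq> 0}. if l = d m then lookup (u l) m else 0)"
        unfolding x_eq lookup_sum using uD by (intro sum.cong) auto
      also have "\<dots> = lookup (u (d m)) m" using u by auto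
      finally show "lookup (u k) m = lookup (hcomp d k x) m" using uD by (auto simp: lookup_hcomp)
    qed
  qed
qed (use W in auto)

subsection \<open>Transport along linear bijections\<close>

text \<open>
  The quotients are only reached through the bijections from \<open>P_minus\<close> and
  \<open>E_dual\<close>. All their linear structure, gradings and pairings are transported along these.
\<close>

locale linear_bijection = S: abelian_monoid S + T: abelian_monoid T
  for S :: "'s ring" and T :: "'t ring" +
  fixes h :: "'f::field \<Rightarrow> 's" and i :: "'f \<Rightarrow> 't" and W U g
  assumes sub: "F_subspace S h W" and U: "U \<subseteq> carrier T"
    and bij: "bij_betw g W U"
    and g_add: "\<And>x y. x \<in> W \<Longrightarrow> y \<in> W \<Longrightarrow> g (x \<oplus>\<^bsub>S\<^esub> y) = g x \<oplus>\<^bsub>T\<^esub> g y"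
    and g_scale: "\<And>c x. x \<in> W \<Longrightarrow> g (h c \<otimes>\<^bsub>S\<^esub> x) = i c \<otimes>\<^bsub>T\<^esub> g x"
    and g_zero: "g \<zero>\<^bsub>S\<^esub> = \<zero>\<^bsub>T\<^esub>"
begin

lemma subD: "x \<in> W \<Longrightarrow> x \<in> carrier S" "\<zero>\<^bsub>S\<^esub> \<in> W" "x \<in> W \<Longrightarrow> y \<in> W \<Longrightarrow> x \<oplus>\<^bsub>S\<^esub> y \<in> W"
  "x \<in> W \<Longrightarrow> h c \<otimes>\<^bsub>S\<^esub> x \<in> W"
  using sub unfolding F_subspace_def by auto

lemma gU: "x \<in> W \<Longrightarrow> g x \<in> U" using bij bij_betwE by blast

lemma g_inj: "x \<in> W \<Longrightarrow> y \<in> W \<Longrightarrow> g x = g y \<Longrightarrow> x = y"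
  using bij unfolding bij_betw_def inj_on_def by blast

lemma g_surj: "y \<in> U \<Longrightarrow> \<exists>x\<in>W. y = g x"
  using bij unfolding bij_betw_def by blast

lemma subspace_image:
  assumes "F_subspace S h V" "V \<subseteq> W"
  shows "F_subspace T i (g ` V)"
  unfolding F_subspace_def
proof (intro conjI ballI allI)
  show "g ` V \<subseteq> carrier T" using assms gU U by blast
  show "\<zero>\<^bsub>T\<^esub> \<in> g ` V" using assms(1) g_zero unfolding F_subspace_def by (metis imageI)
  fix x y assume "x \<in> g ` V" "y \<in> g ` V"
  then obtain a b where "a \<in> V" "x = g a" "b \<in> V" "y = g b" by blast
  moreover from this have "a \<in> W" "b \<in> W" using assms(2) by auto
  ultimately have "x \<oplus>\<^bsub>T\<^esub> y = g (a \<oplus>\<^bsub>S\<^esub> b)" "a \<oplus>\<^bsub>S\<^esub> b \<in> V"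
    using assms(1) g_add unfolding F_subspace_def by auto
  then show "x \<oplus>\<^bsub>T\<^esub> y \<in> g ` V" by blast
next
  fix c x assume "x \<in> g ` V"
  then obtain a where "a \<in> V" "x = g a" by blast
  moreover from this have "a \<in> W" using assms(2) by auto
  ultimately have "i c \<otimes>\<^bsub>T\<^esub> x = g (h c \<otimes>\<^bsub>S\<^esub> a)" "h c \<otimes>\<^bsub>S\<^esub> a \<in> V"
    using assms(1) g_scale unfolding F_subspace_def by auto
  then show "i c \<otimes>\<^bsub>T\<^esub> x \<in> g ` V" by blast
qed

lemma g_finsum:
  assumes "finite K" "\<And>k. k \<in> K \<Longrightarrow> u k \<in> W"
  shows "(\<Oplus>\<^bsub>S\<^esub>k\<in>K. u k) \<in> W \<and> g (\<Oplus>\<^bsub>S\<^esub>k\<in>K. u k) = (\<Oplus>\<^bsub>T\<^esub>k\<in>K. g (u k))"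
  using assms
proof (induction K rule: finite_induct)
  case empty
  then show ?case using subD(2) g_zero by simp
next
  case (insert k K)
  have "u \<in> K \<rightarrow> carrier S" "u k \<in> carrier S" using insert subD(1) by auto
  then have 1: "(\<Oplus>\<^bsub>S\<^esub>k\<in>insert k K. u k) = u k \<oplus>\<^bsub>S\<^esub> (\<Oplus>\<^bsub>S\<^esub>k\<in>K. u k)"
    using insert(1,2) by (rule_tac S.finsum_insert) auto
  have "(\<lambda>k. g (u k)) \<in> K \<rightarrow> carrier T" "g (u k) \<in> carrier T" using insert gU U by auto
  then have 2: "(\<Oplus>\<^bsub>T\<^esub>k\<in>insert k K. g (u k)) = g (u k) \<oplus>\<^bsub>T\<^esub> (\<Oplus>\<^bsub>T\<^esub>k\<in>K. g (u k))"
    using insert(1,2) by (rule_tac T.finsum_insert) auto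
  show ?case unfolding 1 2 using insert subD(3) g_add by auto
qed

lemma graded_image:
  assumes gr: "graded_space S h W Wg"
  shows "graded_space T i U (\<lambda>k. g ` Wg k)"
  unfolding graded_space_def
proof (intro conjI allI ballI)
  have Wg: "F_subspace S h (Wg k)" "Wg k \<subseteq> W" for k using gr unfolding graded_space_def by auto
  show "F_subspace T i U" using subspace_image[OF sub] bij unfolding bij_betw_def by simp
  show "F_subspace T i (g ` Wg k)" for k by (rule subspace_image[OF Wg])
  show "g ` Wg k \<subseteq> U" for k using Wg gU by blast
  fix y assume "y \<in> U"
  then obtain x where x: "x \<in> W" "y = g x" using g_surj by blast
  have z: "g v \<noteq> \<zero>\<^bsub>T\<^esub> \<longleftrightarrow> v \<noteq> \<zero>\<^bsub>S\<^esub>" if "v \<in> W" for v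
    using g_inj[OF that subD(2)] g_zero by metis
  let ?PS = "\<lambda>u. (\<forall>k. u k \<in> Wg k) \<and> finite {k. u k \<noteq> \<zero>\<^bsub>S\<^esub>} \<and> x = (\<Oplus>\<^bsub>S\<^esub>k\<in>{k. u k \<noteq> \<zero>\<^bsub>S\<^esub>}. u k)"
  let ?PT = "\<lambda>u. (\<forall>k. u k \<in> g ` Wg k) \<and> finite {k. u k \<noteq> \<zero>\<^bsub>T\<^esub>} \<and> y = (\<Oplus>\<^bsub>T\<^esub>k\<in>{k. u k \<noteq> \<zero>\<^bsub>T\<^esub>}. u k)"
  have ex1: "\<exists>!u. ?PS u" using gr x(1) unfolding graded_space_def by blast
  have iff: "?PT (\<lambda>k. g (u k)) \<longleftrightarrow> ?PS u" if u: "\<forall>k. u k \<in> Wg k" for u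
  proof -
    have uW: "u k \<in> W" for k using u Wg by blast
    have s: "{k. g (u k) \<noteq> \<zero>\<^bsub>T\<^esub>} = {k. u k \<noteq> \<zero>\<^bsub>S\<^esub>}" using z uW by blast
    show ?thesis
    proof (cases "finite {k. u k \<noteq> \<zero>\<^bsub>S\<^esub>}")
      case True
      note f = g_finsum[OF True, of u] 
      have "y = (\<Oplus>\<^bsub>T\<^esub>k\<in>{k. u k \<noteq> \<zero>\<^bsub>S\<^esub>}. g (u k)) \<longleftrightarrow> x = (\<Oplus>\<^bsub>S\<^esub>k\<in>{k. u k \<noteq> \<zero>\<^bsub>S\<^esub>}. u k)"
        using f uW x g_inj by metis
      then show ?thesis unfolding s using u by blast
    qed (simp add: s)
  qed
  obtain u where u: "?PS u" using ex1 by blast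
  show "\<exists>!u. ?PT u"
  proof (rule ex1I)
    show "?PT (\<lambda>k. g (u k))" using iff u by blast
  next
    fix v assume v: "?PT v"
    then have "\<forall>k. \<exists>a. a \<in> Wg k \<and> v k = g a" by blast
    then obtain u' where u': "\<And>k. u' k \<in> Wg k" "\<And>k. v k = g (u' k)" by metis
    have v': "v = (\<lambda>k. g (u' k))" using u'(2) by blast
    have "?PS u'" using iff[of u'] v u'(1) unfolding v' by blast
    then have "u' = u" using ex1 u by blast
    then show "v = (\<lambda>k. g (u k))" using v' by simp
  qed
qed

lemma graded_iso_image:
  assumes "graded_space S h W Wg"
  shows "graded_iso S h W Wg T i U (\<lambda>k. g ` Wg k) g"
  unfolding graded_iso_def using assms graded_image[OF assms] bij g_add g_scale by blast

lemma linear_form_pull: "linear_form T i U l \<Longrightarrow> linear_form S h W (\<lambda>x. l (g x))"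
  unfolding linear_form_def using g_add g_scale gU by auto

lemma linear_form_push:
  assumes "linear_form S h W l" and l': "\<And>x. x \<in> W \<Longrightarrow> l' (g x) = l x"
  shows "linear_form T i U l'"
  unfolding linear_form_def
proof (intro conjI ballI allI)
  fix x y assume "x \<in> U" "y \<in> U"
  then obtain a b where "a \<in> W" "x = g a" "b \<in> W" "y = g b" using g_surj by metis
  then show "l' (x \<oplus>\<^bsub>T\<^esub> y) = l' x + l' y"
    using assms subD g_add[symmetric] unfolding linear_form_def by auto
next
  fix c x assume "x \<in> U"
  then obtain a where "a \<in> W" "x = g a" using g_surj by metis
  then show "l' (i c \<otimes>\<^bsub>T\<^esub> x) = c * l' x"
    using assms subD g_scale[symmetric] unfolding linear_form_def by auto
qed

lemma perfect_pairing_image: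
  assumes pp: "perfect_pairing S h W R j V \<beta>"
    and \<beta>': "\<And>x y. x \<in> W \<Longrightarrow> y \<in> V \<Longrightarrow> \<beta>' (g x) y = \<beta> x y"
    and V: "F_subspace R j V"
  shows "perfect_pairing T i U R j V \<beta>'"
proof -
  note p = pp[unfolded perfect_pairing_def]
  have lin_cong: "linear_form R j V l'" if "linear_form R j V l" "\<And>y. y \<in> V \<Longrightarrow> l' y = l y" for l l'
    using that V unfolding linear_form_def F_subspace_def by simp
  show ?thesis
    unfolding perfect_pairing_def
  proof (intro conjI ballI allI impI)
    fix x assume "x \<in> U"
    then obtain a where a: "a \<in> W" "x = g a" using g_surj by metis
    show "linear_form R j V (\<beta>' x)"
      by (rule lin_cong[of "\<beta> a"]) (use p a \<beta>' in auto)
  next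
    fix y assume y: "y \<in> V"
    show "linear_form T i U (\<lambda>x. \<beta>' x y)"
      by (rule linear_form_push[of "\<lambda>x. \<beta> x y"]) (use p y \<beta>' in auto)
  next
    fix l assume l: "linear_form R j V l"
    have ex1: "\<exists>!x. x \<in> W \<and> (\<forall>y\<in>V. l y = \<beta> x y)" using p l by blast
    then obtain a where a: "a \<in> W" "\<forall>y\<in>V. l y = \<beta> a y" by blast
    show "\<exists>!x. x \<in> U \<and> (\<forall>y\<in>V. l y = \<beta>' x y)"
    proof (rule ex1I[of _ "g a"])
      show "g a \<in> U \<and> (\<forall>y\<in>V. l y = \<beta>' (g a) y)" using a gU \<beta>' by simp
      fix x assume x: "x \<in> U \<and> (\<forall>y\<in>V. l y = \<beta>' x y)"
      then obtain b where b: "b \<in> W" "x = g b" using g_surj by metis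
      then have "\<forall>y\<in>V. l y = \<beta> b y" using x \<beta>' by simp
      then show "x = g a" using ex1 a b by blast
    qed
  next
    fix l assume "linear_form T i U l"
    then have "linear_form S h W (\<lambda>x. l (g x))" by (rule linear_form_pull)
    then have ex1: "\<exists>!y. y \<in> V \<and> (\<forall>x\<in>W. l (g x) = \<beta> x y)" using p by blast
    have "(\<forall>x\<in>W. l (g x) = \<beta> x y) \<longleftrightarrow> (\<forall>x\<in>U. l x = \<beta>' x y)" if "y \<in> V" for y
      using that \<beta>' gU g_surj by metis
    then show "\<exists>!y. y \<in> V \<and> (\<forall>x\<in>U. l x = \<beta>' x y)" using ex1 by (metis (no_types, lifting))
  qed
qed

lemma restrict:
  assumes "F_subspace S h V" "V \<subseteq> W"
  shows "linear_bijection S T h i V (g ` V) g"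
proof
  show "F_subspace S h V" by fact
  show "g ` V \<subseteq> carrier T" using assms gU U by blast
  show "bij_betw g V (g ` V)" using assms(2) g_inj by (auto simp: bij_betw_def inj_on_def)
  show "g (x \<oplus>\<^bsub>S\<^esub> y) = g x \<oplus>\<^bsub>T\<^esub> g y" if "x \<in> V" "y \<in> V" for x y
    by (rule g_add) (use that assms(2) in blast)+
  show "g (h c \<otimes>\<^bsub>S\<^esub> x) = i c \<otimes>\<^bsub>T\<^esub> g x" if "x \<in> V" for c x
    by (rule g_scale) (use that assms(2) in blast)
  show "g \<zero>\<^bsub>S\<^esub> = \<zero>\<^bsub>T\<^esub>" by (rule g_zero)
qed

lemma graded_dual_image:
  assumes gd: "graded_dual S h W Wg R j V Vg \<beta>"
    and \<beta>': "\<And>x y. x \<in> W \<Longrightarrow> y \<in> V \<Longrightarrow> \<beta>' (g x) y = \<beta> x y"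
  shows "graded_dual T i U (\<lambda>k. g ` Wg k) R j V Vg \<beta>'"
proof -
  have gW: "graded_space S h W Wg" and gV: "graded_space R j V Vg"
    and pp: "perfect_pairing S h W R j V \<beta>"
    and ppk: "\<And>k. perfect_pairing S h (Wg k) R j (Vg (- k)) \<beta>"
    and orth: "\<And>k l x y. k + l \<noteq> 0 \<Longrightarrow> x \<in> Wg k \<Longrightarrow> y \<in> Vg l \<Longrightarrow> \<beta> x y = 0"
    using gd unfolding graded_dual_def by auto
  have Wg: "F_subspace S h (Wg k)" "Wg k \<subseteq> W" for k using gW unfolding graded_space_def by auto
  have Vg: "F_subspace R j (Vg k)" "Vg k \<subseteq> V" "F_subspace R j V" for k using gV unfolding graded_space_def by auto
  have "perfect_pairing T i (g ` Wg k) R j (Vg (- k)) \<beta>'" for k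
    using linear_bijection.perfect_pairing_image[OF restrict[OF Wg] ppk _ Vg(1)] \<beta>' Wg(2) Vg(2) by blast
  moreover have "\<beta>' x y = 0" if kl: "k + l \<noteq> 0" and x: "x \<in> g ` Wg k" and y: "y \<in> Vg l" for k l x y
  proof -
    obtain a where a: "a \<in> Wg k" "x = g a" using x by blast
    have "\<beta>' (g a) y = \<beta> a y" by (rule \<beta>') (use a(1) y Wg(2) Vg(2) in blast)+
    then show ?thesis using orth[OF kl a(1) y] a(2) by simp
  qed
  ultimately show ?thesis
    unfolding graded_dual_def
    using graded_image[OF gW] gV perfect_pairing_image[OF pp \<beta>' Vg(3)] by auto
qed

end

lemma graded_dual_flip:
  assumes "graded_dual S h W Wg T i U Ug \<beta>"
  shows "graded_dual T i U Ug S h W Wg (\<lambda>y x. \<beta> x y)"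
proof -
  have flip: "perfect_pairing T i U' S h W' (\<lambda>y x. \<beta> x y)" if "perfect_pairing S h W' T i U' \<beta>" for W' U'
    using that unfolding perfect_pairing_def by blast
  have "perfect_pairing T i (Ug k) S h (Wg (- k)) (\<lambda>y x. \<beta> x y)" for k
  proof (rule flip)
    have "perfect_pairing S h (Wg (- k)) T i (Ug (- (- k))) \<beta>"
      using assms unfolding graded_dual_def by blast
    then show "perfect_pairing S h (Wg (- k)) T i (Ug k) \<beta>" by simp
  qed
  moreover have "\<beta> x y = 0" if "k + l \<noteq> 0" "y \<in> Ug k" "x \<in> Wg l" for k l x y
  proof -
    have "l + k \<noteq> 0" using that(1) by simp
    then show ?thesis using assms that(2,3) unfolding graded_dual_def by blast
  qed
  ultimately show ?thesis
    using assms flip[of W U] unfolding graded_dual_def by auto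
qed

lemma (in linear_bijection) graded_dual_image_right:
  assumes gd: "graded_dual R j V Vg S h W Wg \<beta>"
    and \<beta>': "\<And>x y. x \<in> V \<Longrightarrow> y \<in> W \<Longrightarrow> \<beta>' x (g y) = \<beta> x y"
  shows "graded_dual R j V Vg T i U (\<lambda>k. g ` Wg k) \<beta>'"
  using graded_dual_flip[OF graded_dual_image[OF graded_dual_flip[OF gd], of "\<lambda>y x. \<beta>' x y"]] \<beta>' by simp

subsection \<open>The pairing of polynomials with differential operators\<close>

lemma pairing_Cst_left: "sym_pairing (Cst c * f) D = c * sym_pairing f D"
  by (simp add: sym_pairing_def diff_op_Cst_right lookup_Cst_mult)

lemma pairing_Cst_right: "sym_pairing f (Cst c * D) = c * sym_pairing f D"
  by (simp add: sym_pairing_def diff_op_mult diff_op_Cst lookup_Cst_mult)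

lemma pairing_zero_left: "sym_pairing 0 D = 0" and pairing_zero_right: "sym_pairing f 0 = 0"
  by (simp_all add: sym_pairing_def diff_op_zero_left diff_op_zero_right)

lemma pairing_diff_right: "sym_pairing f (D - D') = sym_pairing f D - sym_pairing f D'"
  using pairing_add_right[of f "D - D'" D'] by simp

lemma pairing_sum_left: "sym_pairing (\<Sum>i\<in>S. f i) D = (\<Sum>i\<in>S. sym_pairing (f i) D)"
  by (induction S rule: infinite_finite_induct) (auto simp: pairing_zero_left pairing_add_left)

lemma pairing_sum_right: "sym_pairing f (\<Sum>i\<in>S. D i) = (\<Sum>i\<in>S. sym_pairing f (D i))"
  by (induction S rule: infinite_finite_induct) (auto simp: pairing_zero_right pairing_add_right)

lemma pairing_formula: "sym_pairing f D = (\<Sum>m\<in>keys D. lookup D m * lookup f m * mfact m)"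
  by (subst sum_singles[of D]) (simp only: pairing_sum_right pairing_single_right)

lemma pairing_commute: "sym_pairing f D = sym_pairing D f"
proof -
  have "sym_pairing f D = (\<Sum>m\<in>keys f. sym_pairing (single m (lookup f m)) D)"
    by (subst sum_singles[of f]) (rule pairing_sum_left)
  then show ?thesis unfolding pairing_formula[of D f] by (simp add: pairing_single_left)
qed

lemma pairing_nondegenerate:
  fixes f :: "('x, 'f::field_char_0) mpol"
  assumes "f \<in> polys I" "\<And>D. D \<in> polys I \<Longrightarrow> sym_pairing f D = 0"
  shows "f = 0"
proof (rule poly_mapping_eqI)
  fix m
  show "lookup f m = lookup 0 m"
  proof (cases "m \<in> keys f")
    case True
    then have "single m (1::'f) \<in> polys I" using assms(1) unfolding polys_def by (auto simp: subset_iff)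
    from assms(2)[OF this] show ?thesis by (simp add: pairing_single_right mfact_nonzero)
  qed (simp add: in_keys_iff)
qed

lemma finite_monomials: "finite B \<Longrightarrow> finite {m :: 'x \<Rightarrow>\<^sub>0 nat. keys m \<subseteq> B \<and> mon_deg m \<le> d}"
proof (rule inj_on_finite[of "\<lambda>m. restrict (lookup m) B" _ "B \<rightarrow>\<^sub>E {..d}"])
  assume B: "finite B"
  show "inj_on (\<lambda>m. restrict (lookup m) B) {m. keys m \<subseteq> B \<and> mon_deg m \<le> d}"
  proof (rule inj_onI, rule poly_mapping_eqI)
    fix m n x assume *: "m \<in> {m. keys m \<subseteq> B \<and> mon_deg m \<le> d}" "n \<in> {m. keys m \<subseteq> B \<and> mon_deg m \<le> d}"
      "restrict (lookup m) B = restrict (lookup n) B"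
    show "lookup m x = lookup n x"
    proof (cases "x \<in> B")
      case True
      then show ?thesis using fun_cong[OF *(3), of x] by simp
    next
      case False
      then have "x \<notin> keys m" "x \<notin> keys n" using * by auto
      then show ?thesis by (simp add: in_keys_iff)
    qed
  qed
  have le: "lookup m x \<le> mon_deg m" for m :: "'x \<Rightarrow>\<^sub>0 nat" and x
    unfolding mon_deg_def by (cases "x \<in> keys m") (auto intro: member_le_sum simp: in_keys_iff)
  show "(\<lambda>m. restrict (lookup m) B) ` {m. keys m \<subseteq> B \<and> mon_deg m \<le> d} \<subseteq> B \<rightarrow>\<^sub>E {..d}"
    by (auto intro: order_trans[OF le])
  show "finite (B \<rightarrow>\<^sub>E {..d})" using B by (intro finite_PiE) auto
qed

text \<open>
  A form that is zero in high degrees only depends on finitely many monomials, so its values, divided by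
  the factorials, are the coefficients of a polynomial.
\<close>

lemma represent_form:
  fixes l :: "('x, 'f::field_char_0) mpol \<Rightarrow> 'f"
  assumes B: "finite B" and l: "linear_form (poly_ring B) Cst (polys B) l"
    and van: "\<And>m. keys m \<subseteq> B \<Longrightarrow> d < mon_deg m \<Longrightarrow> l (single m 1) = 0"
  shows "\<exists>f\<in>polys B. \<forall>D\<in>polys B. sym_pairing f D = l D"
proof -
  define M where "M = {m :: 'x \<Rightarrow>\<^sub>0 nat. keys m \<subseteq> B \<and> mon_deg m \<le> d}"
  have finM: "finite M" unfolding M_def by (rule finite_monomials[OF B])
  define f where "f = (\<Sum>m\<in>M. single m (l (single m 1) / mfact m))"
  have fB: "f \<in> polys B" unfolding f_def M_def by (intro polys_sum polys_single) auto
  have l_add: "l (x + y) = l x + l y" if "x \<in> polys B" "y \<in> polys B" for x y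
    using l that unfolding linear_form_def by simp
  have l_scale: "l (Cst c * x) = c * l x" if "x \<in> polys B" for c x
    using l that unfolding linear_form_def by simp
  have l_zero: "l 0 = 0" using l_scale[OF polys_zero, of 0] by simp
  have l_sum: "l (\<Sum>i\<in>S. g i) = (\<Sum>i\<in>S. l (g i))" if "finite S" "\<And>i. i \<in> S \<Longrightarrow> g i \<in> polys B" for S and g :: "('x \<Rightarrow>\<^sub>0 nat) \<Rightarrow> _"
    using that
  proof (induction S rule: finite_induct)
    case empty
    then show ?case by (simp add: l_zero)
  next
    case (insert i S)
    then show ?case by (simp add: l_add polys_sum)
  qed
  have lf: "lookup f m = (if m \<in> M then l (single m 1) / mfact m else 0)" for m
  proof -
    have "lookup f m = (\<Sum>n\<in>M. if n = m then l (single n 1) / mfact n else 0)"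
      unfolding f_def lookup_sum by (intro sum.cong refl) (simp add: lookup_single when_def)
    then show ?thesis using finM by simp
  qed
  have "sym_pairing f D = l D" if D: "D \<in> polys B" for D
  proof -
    have k: "keys m \<subseteq> B" if "m \<in> keys D" for m using D that unfolding polys_def by blast
    have "l D = l (\<Sum>m\<in>keys D. single m (lookup D m))" using sum_singles[of D] by simp
    also have "\<dots> = (\<Sum>m\<in>keys D. l (single m (lookup D m)))"
      using k by (intro l_sum polys_single) auto
    also have "\<dots> = (\<Sum>m\<in>keys D. lookup D m * lookup f m * mfact m)"
    proof (rule sum.cong[OF refl])
      fix m assume m: "m \<in> keys D"
      have "l (single m (lookup D m)) = lookup D m * l (single m 1)"
        using l_scale[OF polys_single[OF k[OF m], of 1], of "lookup D m"] by (simp add: Cst_times_single)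
      moreover have "l (single m 1) = lookup f m * mfact m"
        using van[OF k[OF m]] k[OF m] unfolding lf M_def by (auto simp: mfact_nonzero)
      ultimately show "l (single m (lookup D m)) = lookup D m * lookup f m * mfact m" by simp
    qed
    finally show ?thesis by (simp add: pairing_formula)
  qed
  then show ?thesis using fB by blast
qed

interpretation pv: vector_space "\<lambda>(c::'f::field) (p :: ('x, 'f) mpol). Cst c * p"
  by unfold_locales (auto simp: algebra_simps Cst_add Cst_mult Cst_one)

text \<open>
  The functional that separates \<open>D\<close> from \<open>I\<close> is zero in high degrees, so it is
  given by pairing with a polynomial.
\<close>

lemma double_perp:
  fixes I :: "('x, 'f::field_char_0) mpol set"
  assumes B: "finite B" and I: "mpol_subspace B I" and high: "\<And>m. keys m \<subseteq> B \<Longrightarrow> d < mon_deg m \<Longrightarrow> single m 1 \<in> I"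
    and D: "D \<in> polys B" "\<And>f. f \<in> polys B \<Longrightarrow> (\<And>D. D \<in> I \<Longrightarrow> sym_pairing f D = 0) \<Longrightarrow> sym_pairing f D = 0"
  shows "D \<in> I"
proof (rule ccontr)
  assume "D \<notin> I"
  moreover have "pv.subspace I" using mpol_subspaceD[OF I] unfolding pv.subspace_def by blast
  ultimately obtain l where l: "Vector_Spaces.linear (\<lambda>c p. Cst c * p) (*) l" "\<forall>u\<in>I. l u = 0" "l D \<noteq> 0"
    using pv.separating_functional by blast
  interpret l: Vector_Spaces.linear "\<lambda>c p. Cst c * p" "(*)" l by (rule l(1))
  have "linear_form (poly_ring B) Cst (polys B) l"
    unfolding linear_form_def by (simp add: l.add l.scale)
  then obtain f where f: "f \<in> polys B" "\<forall>D\<in>polys B. sym_pairing f D = l D"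
    using represent_form[OF B, of l d] high l(2) by blast
  have "sym_pairing f D' = 0" if "D' \<in> I" for D' using f(2) l(2) mpol_subspaceD(1)[OF I that] that by simp
  then show False using D(2)[OF f(1)] f(2) D(1) l(3) by simp
qed

lemma pairing_homog: "f \<in> homog I dg k \<Longrightarrow> D \<in> homog J dn l \<Longrightarrow>
  k + l \<noteq> 0 \<Longrightarrow> sym_pairing f D = 0"
proof -
  assume f: "f \<in> homog I dg k" and D: "D \<in> homog J dn l" and kl: "k + l \<noteq> 0"
  have "lookup f m = 0" if "m \<in> keys D" for m
  proof (rule ccontr)
    assume "lookup f m \<noteq> 0"
    then have "m \<in> keys f" by (simp add: in_keys_iff)
    then have "int (mon_deg m) = k" "- int (mon_deg m) = l" using f D that unfolding homog_def by auto
    then show False using kl by simp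
  qed
  then show ?thesis unfolding pairing_formula by (intro sum.neutral) auto
qed

lemma pairing_hcomp:
  "sym_pairing (hcomp dg k f) D = sym_pairing f (hcomp dn (- k) D)"
proof -
  have "sym_pairing (hcomp dg k f) D
      = (\<Sum>m\<in>keys D. lookup D m * (if int (mon_deg m) = k then lookup f m else 0) * mfact m)"
    by (simp add: pairing_formula lookup_hcomp)
  also have "\<dots> = (\<Sum>m\<in>{m \<in> keys D. - int (mon_deg m) = - k}. lookup D m * lookup f m * mfact m)"
    by (rule sum.mono_neutral_cong_right) auto
  also have "\<dots> = sym_pairing f (hcomp dn (- k) D)"
    unfolding pairing_formula keys_hcomp by (rule sum.cong) (auto simp: lookup_hcomp)
  finally show ?thesis .
qed

lemma hcomp_neg: "hcomp dn k f = hcomp dg (- k) f"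
  by (rule poly_mapping_eqI) (auto simp: lookup_hcomp)

text \<open>
  The passage from the decomposition into \<open>P\<close> and \<open>K\<close> to all the statements
  about duality is formal. It uses that \<open>P\<close> and \<open>EE\<close> are the orthogonal spaces
  of \<open>I\<close> and \<open>K\<close>, and that \<open>I\<close> and \<open>K\<close> are
  homogeneous and contain everything of high degree. Under the conditions of the locale
  \<open>EE\<close> and \<open>I\<close> are complementary as well, so that the situation is symmetric.
\<close>

locale dual_decomposition =
  fixes B :: "'x set" and P K EE I :: "('x, 'f::field_char_0) mpol set" and d :: nat
  assumes B: "finite B" and P: "mpol_subspace B P" and K: "mpol_subspace B K" and I: "mpol_subspace B I"
    and P_K_disjoint: "P \<inter> K = {0}" and P_K_sum: "\<And>f. f \<in> polys B \<Longrightarrow> \<exists>p\<in>P. \<exists>k\<in>K. f = p + k"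
    and E_def: "EE = {D \<in> polys B. \<forall>f\<in>K. sym_pairing f D = 0}"
    and P_def: "P = {f \<in> polys B. \<forall>D\<in>I. sym_pairing f D = 0}"
    and K_high: "\<And>m. keys m \<subseteq> B \<Longrightarrow> d < mon_deg m \<Longrightarrow> single m 1 \<in> K"
    and I_high: "\<And>m. keys m \<subseteq> B \<Longrightarrow> d < mon_deg m \<Longrightarrow> single m 1 \<in> I"
    and P_hom: "\<And>f k. f \<in> P \<Longrightarrow> hcomp dg k f \<in> P"
    and K_hom: "\<And>f k. f \<in> K \<Longrightarrow> hcomp dg k f \<in> K"
begin

lemma subspace_E: "mpol_subspace B EE"
  unfolding mpol_subspace_def E_def
  by (auto simp: polys_zero polys_add polys_mult polys_Cst pairing_zero_right pairing_add_right pairing_Cst_right)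

lemma E_hom: "D \<in> EE \<Longrightarrow> hcomp dn k D \<in> EE"
proof -
  assume D: "D \<in> EE"
  have "sym_pairing f (hcomp dn k D) = 0" if f: "f \<in> K" for f
    using D K_hom[OF f, of "- k"] pairing_hcomp[of "- k" f D] unfolding E_def by simp
  then show ?thesis using D unfolding E_def by (simp add: hcomp_polys)
qed

lemma I_perp: "D \<in> polys B \<Longrightarrow> (\<And>f. f \<in> P \<Longrightarrow> sym_pairing f D = 0) \<Longrightarrow> D \<in> I"
  by (rule double_perp[OF B I I_high]) (auto simp: P_def)

lemma P_I_orthogonal: "f \<in> P \<Longrightarrow> D \<in> I \<Longrightarrow> sym_pairing f D = 0" using P_def by blast
lemma K_E_orthogonal: "f \<in> K \<Longrightarrow> D \<in> EE \<Longrightarrow> sym_pairing f D = 0" using E_def by blast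

lemma I_hom: "D \<in> I \<Longrightarrow> hcomp dn k D \<in> I"
proof (rule I_perp)
  assume D: "D \<in> I"
  show "hcomp dn k D \<in> polys B" using mpol_subspaceD(1)[OF I D] by (rule hcomp_polys)
  fix f assume "f \<in> P"
  then show "sym_pairing f (hcomp dn k D) = 0" using P_I_orthogonal[OF P_hom D, of f "- k"] pairing_hcomp[of "- k" f D] by simp
qed

lemma E_I_disjoint: "EE \<inter> I = {0}"
proof (intro subset_antisym subsetI)
  fix D assume D: "D \<in> EE \<inter> I"
  then have DB: "D \<in> polys B" using mpol_subspaceD(1)[OF I] by blast
  have "sym_pairing D f = 0" if "f \<in> polys B" for f
  proof -
    obtain p k where "p \<in> P" "k \<in> K" "f = p + k" using P_K_sum[OF \<open>f \<in> polys B\<close>] by blast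
    then show ?thesis using D P_I_orthogonal K_E_orthogonal by (simp add: pairing_commute[of D] pairing_add_left)
  qed
  then show "D \<in> {0}" using pairing_nondegenerate[OF DB] by blast
qed (use mpol_subspaceD(2)[OF subspace_E] mpol_subspaceD(2)[OF I] in auto)

lemma unique_P: assumes "p \<in> P" "p' \<in> P" "k \<in> K" "k' \<in> K" "p + k = p' + k'" shows "p = p'"
proof -
  have "p - p' = k' - k" using assms(5) by (simp add: algebra_simps)
  then have "p - p' \<in> P \<inter> K" using mpol_subspace_diff[OF P assms(1,2)] mpol_subspace_diff[OF K assms(4,3)] by simp
  then show ?thesis using P_K_disjoint by simp
qed

text \<open>
  The form is extended by zero on \<open>K\<close>. The extension is zero in high degrees, so it is
  given by an operator, which is orthogonal to \<open>K\<close> by construction.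
\<close>

lemma represent_on_P:
  assumes l: "linear_form (poly_ring B) Cst P l"
  shows "\<exists>D\<in>EE. \<forall>f\<in>P. l f = sym_pairing f D"
proof -
  obtain pr where pr: "\<And>f. f \<in> polys B \<Longrightarrow> pr f \<in> P \<and> f - pr f \<in> K"
  proof -
    have "\<exists>p. p \<in> P \<and> f - p \<in> K" if "f \<in> polys B" for f
    proof -
      obtain p k where "p \<in> P" "k \<in> K" "f = p + k" using P_K_sum[OF \<open>f \<in> polys B\<close>] by blast
      then show ?thesis by auto
    qed
    then have "\<forall>f. \<exists>p. f \<in> polys B \<longrightarrow> p \<in> P \<and> f - p \<in> K" by blast
    from choice[OF this] obtain pr where "\<forall>f. f \<in> polys B \<longrightarrow> pr f \<in> P \<and> f - pr f \<in> K" ..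
    then show thesis by (intro that) blast
  qed
  have pr_eq: "pr f = p" if "p \<in> P" "f - p \<in> K" for f p
  proof -
    have "f = p + (f - p)" by simp
    then have "f \<in> polys B" using polys_add mpol_subspaceD(1)[OF P that(1)] mpol_subspaceD(1)[OF K that(2)] by metis
    then show ?thesis using unique_P[of "pr f" p "f - pr f" "f - p"] pr that by simp
  qed
  have "linear_form (poly_ring B) Cst (polys B) (\<lambda>f. l (pr f))"
    unfolding linear_form_def poly_ring_simps
  proof (intro conjI ballI allI)
    fix f g :: "('x, 'f) mpol" assume f: "f \<in> polys B" and g: "g \<in> polys B"
    have "(f - pr f) + (g - pr g) \<in> K" using pr[OF f] pr[OF g] mpol_subspaceD(3)[OF K] by blast
    moreover have "(f - pr f) + (g - pr g) = (f + g) - (pr f + pr g)" by simp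
    ultimately have "pr (f + g) = pr f + pr g"
      using pr[OF f] pr[OF g] mpol_subspaceD(3)[OF P] by (intro pr_eq) auto
    then show "l (pr (f + g)) = l (pr f) + l (pr g)" using l pr[OF f] pr[OF g] unfolding linear_form_def by simp
  next
    fix c and f :: "('x, 'f) mpol" assume f: "f \<in> polys B"
    have "Cst c * (f - pr f) \<in> K" using pr[OF f] mpol_subspaceD(4)[OF K] by blast
    then have "pr (Cst c * f) = Cst c * pr f"
      using pr[OF f] mpol_subspaceD(4)[OF P] by (intro pr_eq) (auto simp: right_diff_distrib)
    then show "l (pr (Cst c * f)) = c * l (pr f)" using l pr[OF f] unfolding linear_form_def by simp
  qed
  moreover have l0: "l 0 = 0" using l mpol_subspaceD(2)[OF P] unfolding linear_form_def by (metis add_cancel_right_left poly_ring_simps(5) add_0)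
  have prK: "pr k = 0" if "k \<in> K" for k using that mpol_subspaceD(2)[OF P] by (intro pr_eq) auto
  ultimately obtain D where D: "D \<in> polys B" "\<forall>f\<in>polys B. sym_pairing D f = l (pr f)"
    using represent_form[OF B, of "\<lambda>f. l (pr f)" d] K_high prK l0 by metis
  have "D \<in> EE"
    unfolding E_def using D prK l0 mpol_subspaceD(1)[OF K] by (auto simp: pairing_commute[of _ D])
  moreover have "l f = sym_pairing f D" if "f \<in> P" for f
  proof -
    have "pr f = f" using that mpol_subspaceD(2)[OF K] by (intro pr_eq) auto
    then show ?thesis using D(2) mpol_subspaceD(1)[OF P that] by (simp add: pairing_commute[of _ D])
  qed
  ultimately show ?thesis by blast
qed

text \<open>
  On \<open>P\<close> the pairing with \<open>D\<close> is also the pairing with some element of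
  \<open>EE\<close>; the difference is orthogonal to \<open>P\<close>, so it lies in \<open>I\<close>.
\<close>

lemma E_I_sum:
  assumes D: "D \<in> polys B"
  shows "\<exists>D1\<in>EE. \<exists>D2\<in>I. D = D1 + D2"
proof -
  have "linear_form (poly_ring B) Cst P (\<lambda>f. sym_pairing f D)"
    unfolding linear_form_def by (simp add: pairing_add_left pairing_Cst_left)
  then obtain D1 where D1: "D1 \<in> EE" "\<forall>f\<in>P. sym_pairing f D = sym_pairing f D1"
    using represent_on_P by metis
  have "D - D1 \<in> I"
    using D D1 mpol_subspaceD(1)[OF subspace_E] by (intro I_perp polys_diff) (auto simp: pairing_diff_right)
  then show ?thesis using D1(1) by (intro bexI[of _ D1] bexI[of _ "D - D1"]) auto
qed

lemma E_nondegenerate: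
  assumes D: "D \<in> EE" and 0: "\<And>f. f \<in> P \<Longrightarrow> sym_pairing f D = 0"
  shows "D = 0"
proof -
  have "D \<in> I" by (rule I_perp[OF mpol_subspaceD(1)[OF subspace_E D] 0])
  then show ?thesis using D E_I_disjoint by blast
qed

lemma represent_on_P_unique:
  assumes l: "linear_form (poly_ring B) Cst P l"
  shows "\<exists>!D. D \<in> EE \<and> (\<forall>f\<in>P. l f = sym_pairing f D)"
proof -
  obtain D where D: "D \<in> EE" "\<forall>f\<in>P. l f = sym_pairing f D" using represent_on_P[OF l] by blast
  show ?thesis
  proof (rule ex1I[of _ D])
    show "D \<in> EE \<and> (\<forall>f\<in>P. l f = sym_pairing f D)" using D by blast
    fix G assume G: "G \<in> EE \<and> (\<forall>f\<in>P. l f = sym_pairing f G)"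
    have GD: "G - D \<in> EE" using mpol_subspace_diff[OF subspace_E] G D by blast
    have "G - D = 0" by (rule E_nondegenerate[OF GD]) (use G D in \<open>simp add: pairing_diff_right\<close>)
    then show "G = D" by simp
  qed
qed

lemma represent_on_P_deg_unique:
  assumes l: "linear_form (poly_ring B) Cst (P \<inter> homog B dg k) l"
  shows "\<exists>!D. D \<in> EE \<inter> homog B dn (- k) \<and> (\<forall>f\<in>P \<inter> homog B dg k. l f = sym_pairing f D)"
proof -
  have h: "hcomp dg k f \<in> P \<inter> homog B dg k" if "f \<in> P" for f
    using P_hom[OF that] hcomp_homog[OF mpol_subspaceD(1)[OF P that]] by blast
  have "linear_form (poly_ring B) Cst P (\<lambda>f. l (hcomp dg k f))"
    using l h unfolding linear_form_def by (simp add: hcomp_add hcomp_Cst_mult)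
  then obtain D where D: "D \<in> EE" "\<forall>f\<in>P. l (hcomp dg k f) = sym_pairing f D" using represent_on_P by blast
  let ?D = "hcomp dn (- k) D"
  have D1: "?D \<in> EE \<inter> homog B dn (- k)" using E_hom[OF D(1)] hcomp_homog[OF mpol_subspaceD(1)[OF subspace_E D(1)]] by blast
  show ?thesis
  proof (rule ex1I[of _ ?D])
    show D2: "?D \<in> EE \<inter> homog B dn (- k) \<and> (\<forall>f\<in>P \<inter> homog B dg k. l f = sym_pairing f ?D)"
    proof (intro conjI ballI D1)
      fix f assume f: "f \<in> P \<inter> homog B dg k"
      then have "hcomp dg k f = f" by (intro hcomp_id[of _ B]) auto
      then show "l f = sym_pairing f ?D" using D(2) f pairing_hcomp[of k f D] by (metis IntD1)
    qed
    fix G assume G: "G \<in> EE \<inter> homog B dn (- k) \<and> (\<forall>f\<in>P \<inter> homog B dg k. l f = sym_pairing f G)"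
    have GD: "G - ?D \<in> EE \<inter> homog B dn (- k)" using mpol_subspace_diff[OF mpol_subspace_Int[OF subspace_E mpol_subspace_homog]] G D1 by blast
    have "sym_pairing f (G - ?D) = 0" if f: "f \<in> P" for f
    proof -
      have "G - ?D = hcomp dn (- k) (G - ?D)" using GD hcomp_id by (metis IntD2)
      then have "sym_pairing f (G - ?D) = sym_pairing (hcomp dg k f) (G - ?D)" using pairing_hcomp by metis
      also have "\<dots> = 0" using G D2 h[OF f] by (simp add: pairing_diff_right)
      finally show ?thesis .
    qed
    then have "G - ?D = 0" using E_nondegenerate GD by blast
    then show "G = ?D" by simp
  qed
qed

lemma swap: "dual_decomposition B EE I P K d"
proof
  show "P = {D \<in> polys B. \<forall>f\<in>I. sym_pairing f D = 0}" using P_def by (simp add: pairing_commute)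
  show "EE = {f \<in> polys B. \<forall>D\<in>K. sym_pairing f D = 0}" using E_def by (simp add: pairing_commute)
  show "\<And>f k. f \<in> EE \<Longrightarrow> hcomp dg k f \<in> EE" using E_hom[of _ "- k" for k] unfolding hcomp_neg by (metis minus_minus)
  show "\<And>f k. f \<in> I \<Longrightarrow> hcomp dg k f \<in> I" using I_hom[of _ "- k" for k] unfolding hcomp_neg by (metis minus_minus)
qed (use B subspace_E K I E_I_disjoint E_I_sum K_high I_high in auto)

lemma homog_neg: "homog B dn (- k) = homog B dg k"
  by (auto simp: homog_def)

lemma perfect:
  "perfect_pairing (poly_ring B) Cst P (poly_ring B) Cst EE sym_pairing"
  "perfect_pairing (poly_ring B) Cst (P \<inter> homog B dg k) (poly_ring B) Cst (EE \<inter> homog B dn (- k)) sym_pairing"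
proof -
  have lin: "linear_form (poly_ring B) Cst W (sym_pairing x)" "linear_form (poly_ring B) Cst W (\<lambda>x. sym_pairing x y)"
    for W x y
    unfolding linear_form_def
    by (simp_all add: pairing_add_left pairing_Cst_left pairing_add_right pairing_Cst_right)
  have 1: "\<exists>!f. f \<in> P \<and> (\<forall>D\<in>EE. l D = sym_pairing f D)" if "linear_form (poly_ring B) Cst EE l" for l
    using dual_decomposition.represent_on_P_unique[OF swap that] by (subst pairing_commute)
  have 2: "\<exists>!f. f \<in> P \<inter> homog B dg k \<and> (\<forall>D\<in>EE \<inter> homog B dn (- k). l D = sym_pairing f D)"
    if "linear_form (poly_ring B) Cst (EE \<inter> homog B dn (- k)) l" for l
    using dual_decomposition.represent_on_P_deg_unique[OF swap that[unfolded homog_neg]]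
    unfolding homog_neg by (subst pairing_commute)
  show "perfect_pairing (poly_ring B) Cst P (poly_ring B) Cst EE sym_pairing"
    unfolding perfect_pairing_def by (intro conjI allI impI ballI lin 1 represent_on_P_unique)
  show "perfect_pairing (poly_ring B) Cst (P \<inter> homog B dg k) (poly_ring B) Cst (EE \<inter> homog B dn (- k)) sym_pairing"
    unfolding perfect_pairing_def by (intro conjI allI impI ballI lin 2 represent_on_P_deg_unique)
qed

theorem graded_dual_P_E:
  "graded_dual (poly_ring B) Cst P (\<lambda>k. P \<inter> homog B dg k) (poly_ring B) Cst EE (\<lambda>k. EE \<inter> homog B dn k) sym_pairing"
  unfolding graded_dual_def
  using graded_poly_ring[OF P, of dg] P_hom graded_poly_ring[OF subspace_E, of dn] E_hom perfect pairing_homog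
  by blast

end

subsection \<open>Quotient rings\<close>

lemma quotient_ring_facts:
  assumes "ring R" "ideal J R"
  defines "q \<equiv> \<lambda>x. J +>\<^bsub>R\<^esub> x"
  shows "ring (R Quot J)" and "carrier (R Quot J) = q ` carrier R"
    and "\<And>x y. x \<in> carrier R \<Longrightarrow> y \<in> carrier R \<Longrightarrow> q (x \<oplus>\<^bsub>R\<^esub> y) = q x \<oplus>\<^bsub>R Quot J\<^esub> q y"
    and "\<And>x y. x \<in> carrier R \<Longrightarrow> y \<in> carrier R \<Longrightarrow> q (x \<otimes>\<^bsub>R\<^esub> y) = q x \<otimes>\<^bsub>R Quot J\<^esub> q y"
    and "\<And>x y. x \<in> carrier R \<Longrightarrow> y \<in> carrier R \<Longrightarrow> q x = q y \<longleftrightarrow> x \<ominus>\<^bsub>R\<^esub> y \<in> J"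
    and "\<And>x. x \<in> carrier R \<Longrightarrow> q x = \<zero>\<^bsub>R Quot J\<^esub> \<longleftrightarrow> x \<in> J"
proof -
  interpret R: ring R by (rule assms(1))
  interpret J: ideal J R by (rule assms(2))
  show "ring (R Quot J)" by (rule J.quotient_is_ring)
  show "carrier (R Quot J) = q ` carrier R"
    unfolding q_def FactRing_def A_RCOSETS_def' by auto
  show add: "q (x \<oplus>\<^bsub>R\<^esub> y) = q x \<oplus>\<^bsub>R Quot J\<^esub> q y" if "x \<in> carrier R" "y \<in> carrier R" for x y
    unfolding q_def using ring_hom_add[OF J.rcos_ring_hom that] .
  show "q (x \<otimes>\<^bsub>R\<^esub> y) = q x \<otimes>\<^bsub>R Quot J\<^esub> q y" if "x \<in> carrier R" "y \<in> carrier R" for x y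
    unfolding q_def using ring_hom_mult[OF J.rcos_ring_hom that] .
  show eq: "q x = q y \<longleftrightarrow> x \<ominus>\<^bsub>R\<^esub> y \<in> J" if "x \<in> carrier R" "y \<in> carrier R" for x y
    unfolding q_def using R.quotient_eq_iff_same_a_r_cos[OF assms(2) that] by blast
  show "q x = \<zero>\<^bsub>R Quot J\<^esub> \<longleftrightarrow> x \<in> J" if x: "x \<in> carrier R" for x
  proof -
    have "q \<zero>\<^bsub>R\<^esub> = \<zero>\<^bsub>R Quot J\<^esub>"
      unfolding q_def FactRing_def using R.a_rcos_zero[OF assms(2) additive_subgroup.zero_closed[OF ideal.axioms(1)[OF assms(2)]]] by simp
    then show ?thesis using eq[OF x R.zero_closed] x by (simp add: R.minus_eq)
  qed
qed

lemma ideal_poly_ringI: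
  fixes J :: "('x, 'f::comm_ring_1) mpol set"
  assumes "mpol_subspace I J" "\<And>p q. p \<in> J \<Longrightarrow> q \<in> polys I \<Longrightarrow> q * p \<in> J"
  shows "ideal J (poly_ring I)"
proof (rule idealI)
  interpret R: cring "poly_ring I :: ('x, 'f) mpol ring" by (rule cring_poly_ring)
  show "ring (poly_ring I :: ('x, 'f) mpol ring)" by (rule R.ring_axioms)
  show "subgroup J (add_monoid (poly_ring I))"
  proof
    show "J \<subseteq> carrier (add_monoid (poly_ring I))" using mpol_subspaceD(1)[OF assms(1)] by auto
    show "x \<otimes>\<^bsub>add_monoid (poly_ring I)\<^esub> y \<in> J" if "x \<in> J" "y \<in> J" for x y
      using mpol_subspaceD(3)[OF assms(1) that] by simp
    show "\<one>\<^bsub>add_monoid (poly_ring I)\<^esub> \<in> J" using mpol_subspaceD(2)[OF assms(1)] by simp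
    show "inv\<^bsub>add_monoid (poly_ring I)\<^esub> x \<in> J" if "x \<in> J" for x
    proof -
      have "x \<in> polys I" using mpol_subspaceD(1)[OF assms(1) that] .
      then have "\<ominus>\<^bsub>poly_ring I\<^esub> x = - x" by (intro R.minus_equality) (use polys_uminus in auto)
      moreover have "- x \<in> J" using mpol_subspace_diff[OF assms(1) mpol_subspaceD(2)[OF assms(1)] that] by simp
      ultimately show ?thesis by (simp add: a_inv_def)
    qed
  qed
qed (use assms(2) in \<open>auto simp: mult.commute\<close>)

lemma mpol_subspace_ideal: assumes "ideal J (poly_ring I)" shows "mpol_subspace I J"
  and "p \<in> J \<Longrightarrow> q \<in> polys I \<Longrightarrow> q * p \<in> J"
proof -
  interpret J: ideal J "poly_ring I" by (rule assms)
  show m: "p \<in> J \<Longrightarrow> q \<in> polys I \<Longrightarrow> q * p \<in> J" for p q using J.I_l_closed[of p q] by simp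
  show "mpol_subspace I J"
    unfolding mpol_subspace_def
  proof (intro conjI ballI allI)
    show "J \<subseteq> polys I" using J.a_subset by simp
    show "0 \<in> J" using additive_subgroup.zero_closed[OF ideal.axioms(1)[OF assms]] by simp
    show "x + y \<in> J" if "x \<in> J" "y \<in> J" for x y
      using additive_subgroup.a_closed[OF ideal.axioms(1)[OF assms] that] by simp
    show "Cst c * x \<in> J" if "x \<in> J" for c x by (rule m[OF that polys_Cst])
  qed
qed

subsection \<open>Complements of kernels\<close>

text \<open>
  A complement of the kernel maps bijectively to the image. If both are homogeneous, the degrees
  correspond.
\<close>

lemma complement_bijection:
  fixes W N :: "('x, 'f::field) mpol set" and T :: "'t ring"
  assumes W: "mpol_subspace I W" and N: "mpol_subspace I N" and WN: "W \<inter> N = {0}"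
    and sum: "\<And>f. f \<in> polys I \<Longrightarrow> \<exists>w\<in>W. \<exists>n\<in>N. f = w + n"
    and T: "ring T" and carr: "carrier T = q ` polys I"
    and q_add: "\<And>x y. x \<in> polys I \<Longrightarrow> y \<in> polys I \<Longrightarrow> q (x + y) = q x \<oplus>\<^bsub>T\<^esub> q y"
    and q_scale: "\<And>c x. x \<in> polys I \<Longrightarrow> q (Cst c * x) = i c \<otimes>\<^bsub>T\<^esub> q x"
    and q_zero: "\<And>x. x \<in> polys I \<Longrightarrow> q x = \<zero>\<^bsub>T\<^esub> \<longleftrightarrow> x \<in> N"
  shows "linear_bijection (poly_ring I) T Cst i W (carrier T) q"
    and "(\<And>f k. f \<in> W \<Longrightarrow> hcomp d k f \<in> W) \<Longrightarrow> (\<And>f k. f \<in> N \<Longrightarrow> hcomp d k f \<in> N) \<Longrightarrow>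
      q ` (W \<inter> homog I d k) = q ` homog I d k"
proof -
  interpret T: ring T by (rule T)
  interpret R: cring "poly_ring I :: ('x, 'f) mpol ring" by (rule cring_poly_ring)
  have WI: "w \<in> polys I" if "w \<in> W" for w using mpol_subspaceD(1)[OF W that] .
  have NI: "n \<in> polys I" if "n \<in> N" for n using mpol_subspaceD(1)[OF N that] .
  have qT: "q x \<in> carrier T" if "x \<in> polys I" for x using carr that by simp
  have q_N: "q (w + n) = q w" if "w \<in> W" "n \<in> N" for w n
    using q_add[OF WI NI, OF that] q_zero[OF NI[OF that(2)]] that qT[OF WI[OF that(1)]] by simp
  show "linear_bijection (poly_ring I) T Cst i W (carrier T) q"
  proof
    show "F_subspace (poly_ring I) Cst W" using W by (simp add: mpol_subspace_F)
    show "carrier T \<subseteq> carrier T" by simp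
    show "bij_betw q W (carrier T)"
      unfolding bij_betw_def
    proof
      show "inj_on q W"
      proof (rule inj_onI)
        fix x y assume x: "x \<in> W" and y: "y \<in> W" and e: "q x = q y"
        have d: "x - y \<in> W" by (rule mpol_subspace_diff[OF W x y])
        have "q y = q ((x - y) + y)" using e by simp
        also have "\<dots> = q (x - y) \<oplus>\<^bsub>T\<^esub> q y" by (rule q_add[OF WI[OF d] WI[OF y]])
        finally have "q (x - y) = \<zero>\<^bsub>T\<^esub>"
          using qT[OF WI[OF y]] qT[OF WI[OF d]] by (metis T.add.r_cancel_one')
        then have "x - y \<in> N" using q_zero[OF WI[OF d]] by simp
        then have "x - y = 0" using d WN by blast
        then show "x = y" by simp
      qed
      show "q ` W = carrier T"
      proof (intro subset_antisym subsetI)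
        fix y assume "y \<in> q ` W" then show "y \<in> carrier T" using qT WI by auto
      next
        fix y assume "y \<in> carrier T"
        then obtain f where f: "f \<in> polys I" "y = q f" using carr by blast
        then obtain w n where "w \<in> W" "n \<in> N" "f = w + n" using sum by blast
        then show "y \<in> q ` W" using q_N f(2) by blast
      qed
    qed
    show "q (x \<oplus>\<^bsub>poly_ring I\<^esub> y) = q x \<oplus>\<^bsub>T\<^esub> q y" if "x \<in> W" "y \<in> W" for x y
      using q_add that WI by simp
    show "q (Cst c \<otimes>\<^bsub>poly_ring I\<^esub> x) = i c \<otimes>\<^bsub>T\<^esub> q x" if "x \<in> W" for c x
      using q_scale that WI by simp
    show "q \<zero>\<^bsub>poly_ring I\<^esub> = \<zero>\<^bsub>T\<^esub>" using q_zero[OF polys_zero] mpol_subspaceD(2)[OF N] by simp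
  qed
  assume hW: "\<And>f k. f \<in> W \<Longrightarrow> hcomp d k f \<in> W" and hN: "\<And>f k. f \<in> N \<Longrightarrow> hcomp d k f \<in> N"
  show "q ` (W \<inter> homog I d k) = q ` homog I d k"
  proof (intro subset_antisym subsetI)
    fix y assume "y \<in> q ` homog I d k"
    then obtain f where f: "f \<in> homog I d k" "y = q f" by blast
    then have "f \<in> polys I" by (simp add: homog_def)
    then obtain w n where wn: "w \<in> W" "n \<in> N" "f = w + n" using sum by blast
    have "f = hcomp d k w + hcomp d k n" using hcomp_id[OF f(1)] wn(3) hcomp_add by metis
    then have "y = q (hcomp d k w)" using q_N[OF hW[OF wn(1)] hN[OF wn(2)]] f(2) by metis
    moreover have "hcomp d k w \<in> W \<inter> homog I d k" using hW[OF wn(1)] hcomp_homog[OF WI[OF wn(1)]] by simp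
    ultimately show "y \<in> q ` (W \<inter> homog I d k)" by blast
  qed auto
qed

subsection \<open>Degrees\<close>

lemma mon_deg_superset: "finite S \<Longrightarrow> keys m \<subseteq> S \<Longrightarrow> mon_deg m = (\<Sum>x\<in>S. lookup m x)"
  unfolding mon_deg_def by (rule sum.mono_neutral_left) (auto simp: in_keys_iff)

lemma mon_deg_add: "mon_deg (m + n) = mon_deg m + mon_deg n"
proof -
  let ?S = "keys m \<union> keys n"
  have "mon_deg (m + n) = (\<Sum>x\<in>?S. lookup (m + n) x)" by (rule mon_deg_superset) (auto simp: keys_add)
  then show ?thesis by (simp add: lookup_add sum.distrib mon_deg_superset[of ?S m] mon_deg_superset[of ?S n])
qed

lemma homog_mult: "f \<in> homog I dg a \<Longrightarrow> g \<in> homog I dg b \<Longrightarrow> f * g \<in> homog I dg (a + b)"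
proof -
  assume f: "f \<in> homog I dg a" and g: "g \<in> homog I dg b"
  have "dg m = a + b" if mfg: "m \<in> keys (f * g)" for m
  proof -
    obtain m1 m2 where "m = m1 + m2" "m1 \<in> keys f" "m2 \<in> keys g" using mfg keys_mult[of f g] by blast
    then show ?thesis using f g by (simp add: homog_def mon_deg_add)
  qed
  then show ?thesis using f g by (simp add: homog_def polys_mult)
qed

lemma homog_Cst: "Cst c \<in> homog I dg 0"
  by (auto simp: homog_def Cst_def mon_deg_def intro: polys_single polys_zero split: if_splits)

lemma homog_power: "f \<in> homog I dg a \<Longrightarrow> f ^ n \<in> homog I dg (int n * a)"
proof (induction n)
  case 0
  show ?case using homog_Cst[of 1 I] by (simp add: Cst_one)
next
  case (Suc n)
  then have "f * f ^ n \<in> homog I dg (a + int n * a)" by (intro homog_mult) auto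
  then show ?case by (simp add: algebra_simps)
qed

lemma homog_lin_poly: "S \<subseteq> I \<Longrightarrow> lin_poly S a \<in> homog I dg 1"
proof -
  assume S: "S \<subseteq> I"
  have "Cst (a x) * Vr x \<in> homog I dg (0 + 1)" if "x \<in> S" for x
  proof (rule homog_mult[OF homog_Cst])
    show "Vr x \<in> homog I dg 1" using that S
      by (auto simp: homog_def polys_Vr) (auto simp: Vr_def mon_deg_def split: if_splits)
  qed
  then show ?thesis unfolding lin_poly_def by (intro mpol_subspace_sum[OF mpol_subspace_homog]) auto
qed

lemma homog_prod: "finite S \<Longrightarrow> (\<And>x. x \<in> S \<Longrightarrow> f x \<in> homog I dg (a x)) \<Longrightarrow> (\<Prod>x\<in>S. f x) \<in> homog I dg (\<Sum>x\<in>S. a x)"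
proof (induction S rule: finite_induct)
  case empty
  show ?case using homog_Cst[of 1 I] by (simp add: Cst_one)
next
  case (insert x S)
  then have "f x * (\<Prod>x\<in>S. f x) \<in> homog I dg (a x + (\<Sum>x\<in>S. a x))" by (intro homog_mult) auto
  then show ?case using insert(1,2) by simp
qed

lemma hcomp_single: "hcomp d k (single m c) = (if d m = k then single m c else 0)"
  by (rule poly_mapping_eqI) (simp add: lookup_hcomp lookup_single when_def)

lemma hcomp_zero: "hcomp d k 0 = 0"
  by (rule poly_mapping_eqI) (simp add: lookup_hcomp)

lemma diff_op_single_hcomp:
  "diff_op (single m c) (hcomp dg k f) = hcomp dg (k - dg m) (diff_op (single m c) f)"
proof (induction f rule: mpol_induct)
  case (single n e)
  show ?case
  proof (cases "falling m n = (0::'b)")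
    case True
    then show ?thesis by (simp add: hcomp_single diff_op_single diff_op_zero_right hcomp_zero)
  next
    case False
    have "lookup m x \<le> lookup n x" for x
    proof (rule ccontr)
      assume "\<not> lookup m x \<le> lookup n x"
      then have "x \<in> keys m" "lookup n x choose lookup m x = 0" by (auto simp: in_keys_iff binomial_eq_0)
      then have "falling m n = (0::'b)" unfolding falling_def by (intro prod_zero bexI[of _ x]) (auto simp: binomial_eq_0)
      then show False using False by simp
    qed
    then have "n = (n - m) + m" by (intro poly_mapping_eqI) (simp add: lookup_add lookup_minus)
    then have "dg n = dg (n - m) + dg m" using mon_deg_add[of "n - m" m] by simp
    then show ?thesis by (auto simp: hcomp_single diff_op_single diff_op_zero_right)
  qed
next
  case (add p q)
  then show ?case by (simp add: hcomp_add diff_op_add_right)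
qed

lemma diff_op_hcomp:
  assumes "D \<in> homog I dg j"
  shows "diff_op D (hcomp dg k f) = hcomp dg (k - j) (diff_op D f)"
proof -
  have "hcomp d k (\<Sum>i\<in>S. g i) = (\<Sum>i\<in>S. hcomp d k (g i))" for d k S and g :: "('a \<Rightarrow>\<^sub>0 nat) \<Rightarrow> ('a, 'b) mpol"
    by (induction S rule: infinite_finite_induct) (auto simp: hcomp_zero hcomp_add)
  note hs = this
  have "diff_op (\<Sum>m\<in>keys D. single m (lookup D m)) (hcomp dg k f) = hcomp dg (k - j) (diff_op (\<Sum>m\<in>keys D. single m (lookup D m)) f)"
    unfolding diff_op_sum_left hs diff_op_single_hcomp
    by (rule sum.cong) (use assms in \<open>auto simp: homog_def\<close>)
  then show ?thesis using sum_singles[of D] by simp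
qed

text \<open>
  A variant for points other than zero: scaling by zero leaves the reciprocal plane.
\<close>

lemma sum_powers_eq_0':
  fixes c :: "nat \<Rightarrow> 'f::field_char_0"
  assumes "\<And>z. z \<noteq> 0 \<Longrightarrow> (\<Sum>j\<le>J. c j * z ^ j) = 0" "j \<le> J"
  shows "c j = 0"
proof -
  have "(\<Sum>i\<le>Suc J. (case i of 0 \<Rightarrow> 0 | Suc i \<Rightarrow> c i) * z ^ i) = 0" for z
  proof -
    have "(\<Sum>i\<le>Suc J. (case i of 0 \<Rightarrow> 0 | Suc i \<Rightarrow> c i) * z ^ i) = z * (\<Sum>i\<le>J. c i * z ^ i)"
      by (simp add: sum.atMost_Suc_shift sum_distrib_left mult_ac del: sum.atMost_Suc)
    then show ?thesis using assms(1)[of z] by (cases "z = 0") auto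
  qed
  from sum_powers_eq_0[where c = "\<lambda>i. case i of 0 \<Rightarrow> 0 | Suc i \<Rightarrow> c i", OF this, of "Suc j"]
  show ?thesis using assms(2) by simp
qed

lemma ev_scaled: "ev (\<lambda>x. z * s x) p = (\<Sum>m\<in>keys p. z ^ mon_deg m * (lookup p m * mon_val s m))"
proof -
  have "mon_val (\<lambda>x. z * s x) m = z ^ mon_deg m * mon_val s m" for m
    unfolding mon_val_def mon_deg_def by (simp add: power_mult_distrib prod.distrib power_sum)
  then show ?thesis unfolding eval_poly_def mon_val_def[symmetric] by (simp add: mult_ac)
qed

lemma ev_scaled_hcomp:
  assumes "\<And>m. m \<in> keys p \<Longrightarrow> mon_deg m \<le> J"
  shows "ev (\<lambda>x. z * s x) p = (\<Sum>j\<le>J. ev s (hcomp dg (int j) p) * z ^ j)"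
proof -
  have "ev (\<lambda>x. z * s x) p = (\<Sum>m\<in>keys p. z ^ mon_deg m * (lookup p m * mon_val s m))" by (rule ev_scaled)
  also have "\<dots> = (\<Sum>j\<le>J. \<Sum>m\<in>{m \<in> keys p. mon_deg m = j}. z ^ mon_deg m * (lookup p m * mon_val s m))"
    using assms by (intro sum.group[symmetric]) auto
  also have "\<dots> = (\<Sum>j\<le>J. ev s (hcomp dg (int j) p) * z ^ j)"
  proof (rule sum.cong[OF refl])
    fix j
    have "ev s (hcomp dg (int j) p) = (\<Sum>m\<in>{m \<in> keys p. mon_deg m = j}. lookup p m * mon_val s m)"
      unfolding eval_poly_def mon_val_def[symmetric] keys_hcomp by (rule sum.cong) (auto simp: lookup_hcomp)
    then show "(\<Sum>m\<in>{m \<in> keys p. mon_deg m = j}. z ^ mon_deg m * (lookup p m * mon_val s m)) = ev s (hcomp dg (int j) p) * z ^ j"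
      by (simp add: sum_distrib_left mult_ac)
  qed
  finally show ?thesis .
qed

section \<open>The Orlik-Terao algebra and the four spaces\<close>

subsection \<open>Functions on the reciprocal plane\<close>

context framed_space
begin

text \<open>
  The numerator of \<open>psi\<close>, as a linear form on the annihilator of \<open>L\<close>.
\<close>

definition psi_poly :: "'e \<Rightarrow> (nat, 'f) mpol" where
  "psi_poly e = lin_poly {..<pdim X} (\<lambda>j. pbas X j (vec X e))"

lemma psi_eq: "psi X e = Fraction_Field.Fract (psi_poly e) 1"
  unfolding psi_def psi_poly_def lin_poly_def ..

lemma ev_psi_poly: "ev a (psi_poly e) = (\<Sum>j<pdim X. a j * pbas X j (vec X e))"
  unfolding psi_poly_def ev_lin_poly by (simp add: mult.commute)

lemma pbas_Ann: "j < pdim X \<Longrightarrow> pbas X j \<in> Ann"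
  using FR unfolding frame_of_def by blast

text \<open>
  The linear forms \<open>\<psi>\<^sub>e\<close> parametrize the subspace \<open>D\<close>, in the
  coordinates given by \<open>pbas X\<close>.
\<close>

lemma D_iff: "t \<in> D \<longleftrightarrow> (\<exists>a. t = (\<lambda>e. ev a (psi_poly e)))"
proof
  assume "t \<in> D"
  then obtain \<phi> where \<phi>: "\<phi> \<in> Ann" "t = (\<lambda>e. \<phi> (vec X e))" unfolding D_def by blast
  have "\<exists>!a. a \<in> {..<pdim X} \<rightarrow>\<^sub>E UNIV \<and> \<phi> = (\<lambda>x. \<Sum>j<pdim X. a j * pbas X j x)"
    using FR \<phi>(1) unfolding frame_of_def by blast
  then obtain a where "\<phi> = (\<lambda>x. \<Sum>j<pdim X. a j * pbas X j x)" by blast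
  then show "\<exists>a. t = (\<lambda>e. ev a (psi_poly e))" unfolding \<phi>(2) ev_psi_poly by blast
next
  assume "\<exists>a. t = (\<lambda>e. ev a (psi_poly e))"
  then obtain a where a: "t = (\<lambda>e. \<Sum>j<pdim X. a j * pbas X j (vec X e))" unfolding ev_psi_poly by blast
  have "(\<lambda>x. \<Sum>j<pdim X. a j * pbas X j x) \<in> Ann"
  proof (rule AnnI)
    show "Vector_Spaces.linear (smul A) (*) (\<lambda>x. \<Sum>j<pdim X. a j * pbas X j x)"
      by (intro VF.linear_compose_sum ballI VF.linear_compose_scale_right AnnD(1) pbas_Ann) auto
    show "(\<Sum>j<pdim X. a j * pbas X j x) = 0" if "x \<in> L" for x
      using AnnD(2)[OF pbas_Ann that] by (intro sum.neutral) auto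
  qed
  then show "t \<in> D" unfolding a D_def by (rule rev_image_eqI) simp
qed

lemma psi_eq_0: "psi X e = 0 \<longleftrightarrow> psi_poly e = 0"
  unfolding psi_eq Zero_fract_def by (simp add: eq_fract)

abbreviation "\<Phi> \<equiv> SymVd_to_OT A X"

lemma rat_const_hom: "coeff_hom (rat_const :: 'f \<Rightarrow> 'f ratfun)"
  by unfold_locales (auto simp: rat_const_def Cst_add Cst_mult Cst_one One_fract_def)

interpretation rc: coeff_hom "rat_const :: 'f \<Rightarrow> 'f ratfun" by (rule rat_const_hom)

text \<open>
  The image of \<open>p\<close> in the field of rational functions is a fraction \<open>N / Q\<close>
  whose value can be computed at all points where no \<open>\<psi>\<^sub>e\<close> vanishes, and these
  are the points that give the reciprocal plane.
\<close>

lemma fraction_representation: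
  assumes nz: "\<forall>e\<in>E. psi X e \<noteq> 0" and "p \<in> polys E"
  shows "\<exists>N Q. Q \<noteq> 0 \<and> eval_poly rat_const (\<lambda>e. inverse (psi X e)) p = Fraction_Field.Fract N Q \<and>
    (\<forall>a. (\<forall>e\<in>E. ev a (psi_poly e) \<noteq> 0) \<longrightarrow> ev a Q \<noteq> 0 \<and> ev (\<lambda>e. 1 / ev a (psi_poly e)) p * ev a Q = ev a N)"
  using assms(2)
proof (induction rule: polys_induct)
  case (Cst c)
  show ?case
    by (rule exI[of _ "Cst c"], rule exI[of _ 1])
       (simp add: rc.eval_Cst id_hom.eval_Cst id_hom.eval_one, simp add: rat_const_def)
next
  case (Vr e)
  have "psi_poly e \<noteq> 0" using nz Vr psi_eq_0 by blast
  then show ?case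
    using Vr by (intro exI[of _ 1] exI[of _ "psi_poly e"])
       (simp add: rc.eval_Vr psi_eq id_hom.eval_Vr id_hom.eval_one)
next
  case (add p q)
  then obtain N Q N' Q' where
    1: "Q \<noteq> 0" "eval_poly rat_const (\<lambda>e. inverse (psi X e)) p = Fraction_Field.Fract N Q"
      "\<And>a. (\<forall>e\<in>E. ev a (psi_poly e) \<noteq> 0) \<Longrightarrow> ev a Q \<noteq> 0 \<and> ev (\<lambda>e. 1 / ev a (psi_poly e)) p * ev a Q = ev a N"
    and 2: "Q' \<noteq> 0" "eval_poly rat_const (\<lambda>e. inverse (psi X e)) q = Fraction_Field.Fract N' Q'"
      "\<And>a. (\<forall>e\<in>E. ev a (psi_poly e) \<noteq> 0) \<Longrightarrow> ev a Q' \<noteq> 0 \<and> ev (\<lambda>e. 1 / ev a (psi_poly e)) q * ev a Q' = ev a N'"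
    by blast
  show ?case
  proof (rule exI[of _ "N * Q' + N' * Q"], rule exI[of _ "Q * Q'"], intro conjI allI impI)
    show "Q * Q' \<noteq> 0" using 1(1) 2(1) by simp
    show "eval_poly rat_const (\<lambda>e. inverse (psi X e)) (p + q) = Fraction_Field.Fract (N * Q' + N' * Q) (Q * Q')"
      unfolding rc.eval_add 1(2) 2(2) using 1(1) 2(1) by simp
    fix a assume a: "\<forall>e\<in>E. ev a (psi_poly e) \<noteq> 0"
    note x = 1(3)[OF a] 2(3)[OF a]
    show "ev a (Q * Q') \<noteq> 0" using x by (simp add: id_hom.eval_mult)
    show "ev (\<lambda>e. 1 / ev a (psi_poly e)) (p + q) * ev a (Q * Q') = ev a (N * Q' + N' * Q)"
      unfolding id_hom.eval_add id_hom.eval_mult conjunct2[OF x(1), symmetric] conjunct2[OF x(2), symmetric]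
      by (simp add: algebra_simps)
  qed
next
  case (mult p q)
  then obtain N Q N' Q' where
    1: "Q \<noteq> 0" "eval_poly rat_const (\<lambda>e. inverse (psi X e)) p = Fraction_Field.Fract N Q"
      "\<And>a. (\<forall>e\<in>E. ev a (psi_poly e) \<noteq> 0) \<Longrightarrow> ev a Q \<noteq> 0 \<and> ev (\<lambda>e. 1 / ev a (psi_poly e)) p * ev a Q = ev a N"
    and 2: "Q' \<noteq> 0" "eval_poly rat_const (\<lambda>e. inverse (psi X e)) q = Fraction_Field.Fract N' Q'"
      "\<And>a. (\<forall>e\<in>E. ev a (psi_poly e) \<noteq> 0) \<Longrightarrow> ev a Q' \<noteq> 0 \<and> ev (\<lambda>e. 1 / ev a (psi_poly e)) q * ev a Q' = ev a N'"
    by blast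
  show ?case
  proof (rule exI[of _ "N * N'"], rule exI[of _ "Q * Q'"], intro conjI allI impI)
    show "Q * Q' \<noteq> 0" using 1(1) 2(1) by simp
    show "eval_poly rat_const (\<lambda>e. inverse (psi X e)) (p * q) = Fraction_Field.Fract (N * N') (Q * Q')"
      unfolding rc.eval_mult 1(2) 2(2) by simp
    fix a assume a: "\<forall>e\<in>E. ev a (psi_poly e) \<noteq> 0"
    note x = 1(3)[OF a] 2(3)[OF a]
    show "ev a (Q * Q') \<noteq> 0" using x by (simp add: id_hom.eval_mult)
    show "ev (\<lambda>e. 1 / ev a (psi_poly e)) (p * q) * ev a (Q * Q') = ev a (N * N')"
      unfolding id_hom.eval_mult conjunct2[OF x(1), symmetric] conjunct2[OF x(2), symmetric]
      by (simp add: algebra_simps)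
  qed
qed

text \<open>
  If \<open>p\<close> vanishes on the reciprocal plane, the numerator \<open>N\<close> is zero where no
  \<open>\<psi>\<^sub>e\<close> vanishes, so \<open>N\<close> times the product of the
  \<open>\<psi>\<^sub>e\<close> is zero as a function. If some \<open>\<psi>\<^sub>e\<close> is zero,
  both sides hold for all \<open>p\<close>: the algebra is zero and the reciprocal plane is empty.
\<close>

lemma \<Phi>_eq_0: assumes p: "p \<in> polys E" shows "\<Phi> p = 0 \<longleftrightarrow> p \<in> recip_ideal"
proof (cases "\<forall>e\<in>E. psi X e \<noteq> 0")
  case True
  obtain N Q where NQ: "Q \<noteq> 0" "eval_poly rat_const (\<lambda>e. inverse (psi X e)) p = Fraction_Field.Fract N Q"
    "\<And>a. (\<forall>e\<in>E. ev a (psi_poly e) \<noteq> 0) \<Longrightarrow> ev a Q \<noteq> 0 \<and> ev (\<lambda>e. 1 / ev a (psi_poly e)) p * ev a Q = ev a N"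
    using fraction_representation[OF True p] by blast
  have 0: "\<Phi> p = 0 \<longleftrightarrow> N = 0"
    unfolding SymVd_to_OT_def NQ(2) using True NQ(1) by (simp add: Zero_fract_def eq_fract)
  show ?thesis
  proof
    assume "\<Phi> p = 0"
    then have N: "N = 0" using 0 by simp
    have "ev w p = 0" if w: "w \<in> recip E D" for w
    proof -
      obtain t where t: "t \<in> D" "\<forall>e\<in>E. w e * t e = 1" using w unfolding recip_def by blast
      obtain a where a: "t = (\<lambda>e. ev a (psi_poly e))" using t(1) D_iff by blast
      have nz: "\<forall>e\<in>E. ev a (psi_poly e) \<noteq> 0" using t(2) a by auto
      have "ev w p = ev (\<lambda>e. 1 / ev a (psi_poly e)) p"
        by (rule eval_poly_cong_vars[OF p]) (use t(2) a nz in \<open>auto simp: field_simps\<close>)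
      then show ?thesis using NQ(3)[OF nz] N by (auto simp: id_hom.eval_zero)
    qed
    then show "p \<in> recip_ideal" using p unfolding recip_ideal_def by blast
  next
    assume pK: "p \<in> recip_ideal"
    have "ev a (N * (\<Prod>e\<in>E. psi_poly e)) = 0" for a
    proof (cases "\<forall>e\<in>E. ev a (psi_poly e) \<noteq> 0")
      case nz: True
      have "(\<lambda>e. ev a (psi_poly e)) \<in> D" using D_iff by blast
      then have "(\<lambda>e. 1 / ev a (psi_poly e)) \<in> recip E D"
        unfolding recip_def using nz by (auto intro!: bexI[of _ "\<lambda>e. ev a (psi_poly e)"])
      then have "ev (\<lambda>e. 1 / ev a (psi_poly e)) p = 0" using pK unfolding recip_ideal_def by blast
      then have "ev a N = 0" using NQ(3)[OF nz] by simp
      then show ?thesis by (simp add: id_hom.eval_mult)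
    next
      case False
      then obtain e where e: "e \<in> E" "ev a (psi_poly e) = 0" by blast
      have "(\<Prod>e\<in>E. psi_poly e) = psi_poly e * (\<Prod>e\<in>E - {e}. psi_poly e)" using finE e(1) by (rule prod.remove)
      then show ?thesis using e(2) by (simp add: id_hom.eval_mult)
    qed
    then have "N * (\<Prod>e\<in>E. psi_poly e) = 0" by (rule ev_eq_0_imp)
    moreover have "(\<Prod>e\<in>E. psi_poly e) \<noteq> 0" using True finE by (simp add: psi_eq_0)
    ultimately show "\<Phi> p = 0" using 0 by simp
  qed
next
  case False
  then obtain e where e: "e \<in> E" "psi_poly e = 0" using psi_eq_0 by blast
  have "t e = 0" if "t \<in> D" for t using that e(2) unfolding D_iff by (auto simp: id_hom.eval_zero)
  then have "recip E D = {}" unfolding recip_def using e(1) by fastforce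
  then have "p \<in> recip_ideal" using p by (simp add: recip_ideal_def)
  moreover have "\<Phi> p = 0" unfolding SymVd_to_OT_def if_not_P[OF False] by (rule refl)
  ultimately show ?thesis by simp
qed

lemma \<Phi>_add: "\<Phi> (p + q) = \<Phi> p + \<Phi> q"
  and \<Phi>_mult: "\<Phi> (p * q) = \<Phi> p * \<Phi> q"
  and \<Phi>_diff: "\<Phi> (p - q) = \<Phi> p - \<Phi> q"
  and \<Phi>_zero: "\<Phi> 0 = 0"
  unfolding SymVd_to_OT_def by (simp_all add: rc.eval_add rc.eval_mult rc.eval_diff rc.eval_zero)

lemma carrier_OT: "carrier (OT A X) = \<Phi> ` polys E"
proof (cases "\<forall>e\<in>E. psi X e \<noteq> 0")
  case True
  let ?G = "(\<lambda>e. inverse (psi X e)) ` E"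
  have \<Phi>: "\<Phi> = eval_poly rat_const (\<lambda>e. inverse (psi X e))"
    using True by (simp add: SymVd_to_OT_def[abs_def])
  have "x \<in> \<Phi> ` polys E" if "x \<in> subalgebra_gen rat_const ?G" for x
    using that
  proof (induction rule: subalgebra_gen.induct)
    case (const c)
    have "rat_const c = \<Phi> (Cst c)" by (simp add: \<Phi> rc.eval_Cst)
    then show ?case using polys_Cst by blast
  next
    case (gen g)
    then obtain e where "e \<in> E" "g = inverse (psi X e)" by blast
    then have "g = \<Phi> (Vr e)" "Vr e \<in> polys E" by (simp_all add: \<Phi> rc.eval_Vr polys_Vr)
    then show ?case by blast
  next
    case (add a b)
    then obtain p q where "p \<in> polys E" "a = \<Phi> p" "q \<in> polys E" "b = \<Phi> q" by blast
    then show ?case using \<Phi>_add polys_add by (intro image_eqI[of _ _ "p + q"]) auto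
  next
    case (mult a b)
    then obtain p q where "p \<in> polys E" "a = \<Phi> p" "q \<in> polys E" "b = \<Phi> q" by blast
    then show ?case using \<Phi>_mult polys_mult by (intro image_eqI[of _ _ "p * q"]) auto
  qed
  moreover have "\<Phi> p \<in> subalgebra_gen rat_const ?G" if "p \<in> polys E" for p
    using that
  proof (induction rule: polys_induct)
    case (Cst c)
    show ?case by (simp add: \<Phi> rc.eval_Cst subalgebra_gen.const)
  next
    case (Vr e)
    then show ?case by (auto simp: \<Phi> rc.eval_Vr intro: subalgebra_gen.gen)
  next
    case (add p q)
    then show ?case by (simp add: \<Phi>_add subalgebra_gen.add)
  next
    case (mult p q)
    then show ?case by (simp add: \<Phi>_mult subalgebra_gen.mult)
  qed
  ultimately have "subalgebra_gen rat_const ?G = \<Phi> ` polys E" by blast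
  then show ?thesis using True by (simp add: OT_def)
next
  case False
  have "\<Phi> p = 0" for p unfolding SymVd_to_OT_def if_not_P[OF False] by (rule refl)
  then have "\<Phi> ` polys E = {0}" using polys_zero by auto
  moreover have "carrier (OT A X) = {0}" unfolding OT_def if_not_P[OF False] by simp
  ultimately show ?thesis by simp
qed

lemma OT_simps [simp]:
  "x \<otimes>\<^bsub>OT A X\<^esub> y = x * y" "x \<oplus>\<^bsub>OT A X\<^esub> y = x + y" "\<zero>\<^bsub>OT A X\<^esub> = 0"
  by (auto simp: OT_def)

lemma one_OT: "\<one>\<^bsub>OT A X\<^esub> = \<Phi> 1"
  by (simp add: OT_def SymVd_to_OT_def rc.eval_one)

lemma cring_OT: "cring (OT A X)"
proof (rule cringI)
  show "abelian_group (OT A X)"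
  proof (rule abelian_groupI)
    fix x assume "x \<in> carrier (OT A X)"
    then obtain p where p: "p \<in> polys E" "x = \<Phi> p" unfolding carrier_OT by blast
    have "\<Phi> (- p) + \<Phi> p = 0" unfolding \<Phi>_add[symmetric] by (simp add: \<Phi>_zero)
    then show "\<exists>y\<in>carrier (OT A X). y \<oplus>\<^bsub>OT A X\<^esub> x = \<zero>\<^bsub>OT A X\<^esub>"
      unfolding carrier_OT using p polys_uminus by auto
  next
    fix x y assume "x \<in> carrier (OT A X)" "y \<in> carrier (OT A X)"
    then obtain p q where "p \<in> polys E" "x = \<Phi> p" "q \<in> polys E" "y = \<Phi> q" unfolding carrier_OT by blast
    then show "x \<oplus>\<^bsub>OT A X\<^esub> y \<in> carrier (OT A X)"
      unfolding carrier_OT using \<Phi>_add polys_add by (intro image_eqI[of _ _ "p + q"]) auto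
  next
    show "\<zero>\<^bsub>OT A X\<^esub> \<in> carrier (OT A X)"
      unfolding carrier_OT using \<Phi>_zero polys_zero by (intro image_eqI[of _ _ 0]) auto
  qed (auto simp: algebra_simps)
  show "comm_monoid (OT A X)"
  proof (rule comm_monoidI)
    fix x y assume "x \<in> carrier (OT A X)" "y \<in> carrier (OT A X)"
    then obtain p q where "p \<in> polys E" "x = \<Phi> p" "q \<in> polys E" "y = \<Phi> q" unfolding carrier_OT by blast
    then show "x \<otimes>\<^bsub>OT A X\<^esub> y \<in> carrier (OT A X)"
      unfolding carrier_OT using \<Phi>_mult polys_mult by (intro image_eqI[of _ _ "p * q"]) auto
  next
    show "\<one>\<^bsub>OT A X\<^esub> \<in> carrier (OT A X)" unfolding carrier_OT one_OT using polys_one by blast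
    fix x assume "x \<in> carrier (OT A X)"
    then obtain p where p: "p \<in> polys E" "x = \<Phi> p" unfolding carrier_OT by blast
    have "\<Phi> 1 * \<Phi> p = \<Phi> p" unfolding \<Phi>_mult[symmetric] by simp
    then show "\<one>\<^bsub>OT A X\<^esub> \<otimes>\<^bsub>OT A X\<^esub> x = x" using p by (simp add: one_OT)
  qed (auto simp: mult_ac)
qed (auto simp: distrib_right)

lemma minus_OT: "x \<in> carrier (OT A X) \<Longrightarrow> y \<in> carrier (OT A X) \<Longrightarrow> x \<ominus>\<^bsub>OT A X\<^esub> y = x - y"
proof -
  assume x: "x \<in> carrier (OT A X)" and y: "y \<in> carrier (OT A X)"
  interpret R: cring "OT A X" by (rule cring_OT)
  obtain p where p: "p \<in> polys E" "y = \<Phi> p" using y unfolding carrier_OT by blast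
  have "- y = \<Phi> (- p)" using \<Phi>_diff[of 0 p] p by (simp add: \<Phi>_zero)
  then have "- y \<in> carrier (OT A X)" unfolding carrier_OT using p polys_uminus by blast
  then have "\<ominus>\<^bsub>OT A X\<^esub> y = - y" by (intro R.minus_equality) (use y in auto)
  then show ?thesis by (simp add: R.minus_eq)
qed

text \<open>
  By \<open>OT_ideal_eq\<close> this is the ideal generated by the image of
  \<open>L\<^sup>\<bottom>\<close>; the description by representatives makes membership explicit.
\<close>

definition kernel_image :: "'f ratfun set" where
  "kernel_image = \<Phi> ` {p \<in> polys E. restr A X p = 0}"

lemma restr_zero: "restr A X 0 = 0"
  by (simp add: restr_def' Cst_hom.eval_zero)

lemma ideal_kernel_image: "ideal kernel_image (OT A X)"
proof (rule idealI)
  interpret R: cring "OT A X" by (rule cring_OT)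
  show "ring (OT A X)" by (rule R.ring_axioms)
  have sub: "kernel_image \<subseteq> carrier (OT A X)" unfolding kernel_image_def carrier_OT by blast
  show "subgroup kernel_image (add_monoid (OT A X))"
  proof
    show "kernel_image \<subseteq> carrier (add_monoid (OT A X))" using sub by simp
    show "\<one>\<^bsub>add_monoid (OT A X)\<^esub> \<in> kernel_image"
      unfolding kernel_image_def using polys_zero restr_zero \<Phi>_zero by (intro image_eqI[of _ _ 0]) auto
    fix x y assume "x \<in> kernel_image" "y \<in> kernel_image"
    then obtain p q where "p \<in> polys E" "restr A X p = 0" "x = \<Phi> p" "q \<in> polys E" "restr A X q = 0" "y = \<Phi> q"
      unfolding kernel_image_def by blast
    then show "x \<otimes>\<^bsub>add_monoid (OT A X)\<^esub> y \<in> kernel_image"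
      unfolding kernel_image_def using \<Phi>_add restr_add polys_add by (intro image_eqI[of _ _ "p + q"]) auto
  next
    fix x assume x: "x \<in> kernel_image"
    then obtain p where p: "p \<in> polys E" "restr A X p = 0" "x = \<Phi> p" unfolding kernel_image_def by blast
    have m: "- x = \<Phi> (- p)" using \<Phi>_diff[of 0 p] p by (simp add: \<Phi>_zero)
    then have m': "- x \<in> kernel_image" unfolding kernel_image_def
      using p restr_diff[of 0 p] polys_uminus by (intro image_eqI[of _ _ "- p"]) (auto simp: restr_zero)
    then have "\<ominus>\<^bsub>OT A X\<^esub> x = - x" using sub x by (intro R.minus_equality) auto
    then show "inv\<^bsub>add_monoid (OT A X)\<^esub> x \<in> kernel_image" using m' by (simp add: a_inv_def)
  qed
  show l: "x \<otimes>\<^bsub>OT A X\<^esub> a \<in> kernel_image" if ax: "a \<in> kernel_image" "x \<in> carrier (OT A X)" for a x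
  proof -
    obtain p q where "p \<in> polys E" "restr A X p = 0" "a = \<Phi> p" "q \<in> polys E" "x = \<Phi> q"
      using ax unfolding kernel_image_def carrier_OT by blast
    then show ?thesis unfolding kernel_image_def
      using \<Phi>_mult[of q p] restr_mult[of q p] polys_mult[of q E p] by (intro image_eqI[of _ _ "q * p"]) auto
  qed
  show "a \<otimes>\<^bsub>OT A X\<^esub> x \<in> kernel_image" if "a \<in> kernel_image" "x \<in> carrier (OT A X)" for a x
    using l[OF that] by (simp add: mult.commute)
qed

lemma OT_ideal_eq: "OT_ideal A X = kernel_image"
proof -
  interpret R: cring "OT A X" by (rule cring_OT)
  let ?S = "(\<lambda>\<phi>. \<Phi> (sym_covec A X \<phi>)) ` Ann"
  have SC: "?S \<subseteq> carrier (OT A X)" unfolding carrier_OT using sym_covec_polys by blast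
  have "?S \<subseteq> kernel_image" unfolding kernel_image_def using sym_covec_polys restr_sym_covec by blast
  then have 1: "OT_ideal A X \<subseteq> kernel_image" unfolding OT_ideal_def by (rule R.genideal_minimal[OF ideal_kernel_image])
  have idl: "ideal (OT_ideal A X) (OT A X)" unfolding OT_ideal_def by (rule R.genideal_ideal[OF SC])
  interpret J: ideal "OT_ideal A X" "OT A X" by (rule idl)
  have gen: "\<Phi> (sym_covec A X \<phi>) \<in> OT_ideal A X" if "\<phi> \<in> Ann" for \<phi>
    unfolding OT_ideal_def using R.genideal_self[OF SC] that by blast
  have "\<Phi> p \<in> OT_ideal A X" if "p \<in> ann_ideal" for p
    using that
  proof (induction rule: ann_ideal.induct)
    case zero
    show ?case using additive_subgroup.zero_closed[OF ideal.axioms(1)[OF idl]] by (simp add: \<Phi>_zero)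
  next
    case (step p \<phi> q)
    have "\<Phi> q \<in> carrier (OT A X)" unfolding carrier_OT using step by blast
    then have "\<Phi> (sym_covec A X \<phi>) * \<Phi> q \<in> OT_ideal A X" using J.I_r_closed[OF gen[OF step(2)]] by simp
    then show ?case
      using additive_subgroup.a_closed[OF ideal.axioms(1)[OF idl] step(4)] by (simp add: \<Phi>_add \<Phi>_mult)
  qed
  then have "kernel_image \<subseteq> OT_ideal A X" unfolding kernel_image_def using restr_eq_0 by blast
  then show ?thesis using 1 by blast
qed

abbreviation "qO \<equiv> SymLd_to_OTbar A X"

lemma \<Phi>_carrier: "p \<in> polys E \<Longrightarrow> \<Phi> p \<in> carrier (OT A X)"
  unfolding carrier_OT by blast

lemmas OTq = quotient_ring_facts[OF cring.axioms(1)[OF cring_OT] ideal_kernel_image]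

lemma OTbar_eq: "SymVd_to_OTbar A X p = kernel_image +>\<^bsub>OT A X\<^esub> \<Phi> p" "OTbar A X = OT A X Quot kernel_image"
  by (simp_all add: SymVd_to_OTbar_def OTbar_def OT_ideal_eq)

text \<open>
  The map to the reduced Orlik-Terao algebra is well defined on \<open>Sym L\<^sup>*\<close>:
  polynomials with the same restriction differ by an element of the ideal.
\<close>

lemma qO_eq: assumes "p \<in> polys E" shows "qO (restr A X p) = kernel_image +>\<^bsub>OT A X\<^esub> \<Phi> p"
  unfolding SymLd_to_OTbar_def OTbar_eq
proof (rule the_equality)
  show "\<exists>r\<in>polys E. restr A X r = restr A X p \<and> kernel_image +>\<^bsub>OT A X\<^esub> \<Phi> p = kernel_image +>\<^bsub>OT A X\<^esub> \<Phi> r"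
    using assms by blast
  fix y assume "\<exists>r\<in>polys E. restr A X r = restr A X p \<and> y = kernel_image +>\<^bsub>OT A X\<^esub> \<Phi> r"
  then obtain r where r: "r \<in> polys E" "restr A X r = restr A X p" "y = kernel_image +>\<^bsub>OT A X\<^esub> \<Phi> r" by blast
  have "\<Phi> r \<ominus>\<^bsub>OT A X\<^esub> \<Phi> p = \<Phi> (r - p)" using minus_OT \<Phi>_carrier r(1) assms by (simp add: \<Phi>_diff)
  also have "\<dots> \<in> kernel_image" unfolding kernel_image_def using r assms restr_diff polys_diff by (intro imageI) auto
  finally show "y = kernel_image +>\<^bsub>OT A X\<^esub> \<Phi> p" using OTq(5)[OF \<Phi>_carrier \<Phi>_carrier] r(1,3) assms by blast
qed

lemma qO_lift: "f \<in> polys B \<Longrightarrow> qO f = kernel_image +>\<^bsub>OT A X\<^esub> \<Phi> (lift f)"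
  using qO_eq[OF lift_polys] restr_lift by metis

lemma qO_add: "f \<in> polys B \<Longrightarrow> g \<in> polys B \<Longrightarrow> qO (f + g) = qO f \<oplus>\<^bsub>OTbar A X\<^esub> qO g"
  unfolding OTbar_eq using OTq(3)[OF \<Phi>_carrier \<Phi>_carrier, OF lift_polys lift_polys]
  by (simp add: qO_lift polys_add lift_add \<Phi>_add)

lemma qO_scale: "f \<in> polys B \<Longrightarrow> qO (Cst c * f) = OTbar_const A X c \<otimes>\<^bsub>OTbar A X\<^esub> qO f"
  unfolding OTbar_const_def OTbar_eq using OTq(4)[OF \<Phi>_carrier \<Phi>_carrier, OF polys_Cst lift_polys]
  by (simp add: qO_lift polys_mult polys_Cst lift_mult lift_Cst \<Phi>_mult)

lemma qO_carrier: "carrier (OTbar A X) = qO ` polys B"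
proof -
  have "(\<lambda>x. kernel_image +>\<^bsub>OT A X\<^esub> x) ` \<Phi> ` polys E = qO ` polys B"
  proof (intro subset_antisym subsetI)
    fix y assume "y \<in> (\<lambda>x. kernel_image +>\<^bsub>OT A X\<^esub> x) ` \<Phi> ` polys E"
    then obtain p where p: "p \<in> polys E" "y = kernel_image +>\<^bsub>OT A X\<^esub> \<Phi> p" by blast
    then have "y = qO (restr A X p)" by (simp add: qO_eq)
    then show "y \<in> qO ` polys B" using restr_polys[OF p(1)] by blast
  next
    fix y assume "y \<in> qO ` polys B"
    then show "y \<in> (\<lambda>x. kernel_image +>\<^bsub>OT A X\<^esub> x) ` \<Phi> ` polys E" using qO_lift lift_polys by auto
  qed
  then show ?thesis unfolding OTbar_eq OTq(2) carrier_OT .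
qed

lemma K_dual_iff: "f \<in> K_dual A X \<longleftrightarrow> f \<in> polys B \<and> qO f = \<zero>\<^bsub>OTbar A X\<^esub>"
  unfolding K_dual_def by blast

text \<open>
  An element of \<open>Sym L\<^sup>*\<close> dies in the reduced algebra if its pullback equals, on the
  reciprocal plane, a polynomial that restricts to zero on \<open>L\<close>; subtracting that polynomial
  does not change the restriction.
\<close>

lemma K_eq: "K_dual A X = restr A X ` recip_ideal"
proof (intro subset_antisym subsetI)
  fix f assume "f \<in> K_dual A X"
  then have f: "f \<in> polys B" "qO f = \<zero>\<^bsub>OTbar A X\<^esub>" using K_dual_iff by auto
  then have "\<Phi> (lift f) \<in> kernel_image"
    using OTq(6)[OF \<Phi>_carrier[OF lift_polys[OF f(1)]]] by (simp add: qO_lift OTbar_eq)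
  then obtain p where p: "p \<in> polys E" "restr A X p = 0" "\<Phi> (lift f) = \<Phi> p" unfolding kernel_image_def by blast
  have "\<Phi> (lift f - p) = 0" using p(3) by (simp add: \<Phi>_diff)
  then have "lift f - p \<in> recip_ideal" using \<Phi>_eq_0[OF polys_diff[OF lift_polys[OF f(1)] p(1)]] by simp
  moreover have "restr A X (lift f - p) = f" using p(2) by (simp add: restr_diff restr_lift[OF f(1)])
  ultimately show "f \<in> restr A X ` recip_ideal" by (intro image_eqI) auto
next
  fix f assume "f \<in> restr A X ` recip_ideal"
  then obtain p where p: "p \<in> recip_ideal" "f = restr A X p" by blast
  have pE: "p \<in> polys E" using p(1) recip_ideal_def by blast
  have "\<Phi> p = 0" using \<Phi>_eq_0[OF pE] p(1) by simp
  then have "\<Phi> p \<in> kernel_image" unfolding kernel_image_def using polys_zero restr_zero \<Phi>_zero by (intro image_eqI[of _ _ 0]) auto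
  then have "qO f = \<zero>\<^bsub>OTbar A X\<^esub>"
    using OTq(6)[OF \<Phi>_carrier[OF pE]] by (simp add: p(2) qO_eq[OF pE] OTbar_eq)
  then show "f \<in> K_dual A X" using restr_polys[OF pE] p(2) by (simp add: K_dual_iff)
qed

subsection \<open>Homogeneity and high degrees\<close>

lemma recip_ideal_closed: "p \<in> recip_ideal \<Longrightarrow> q \<in> recip_ideal \<Longrightarrow> p + q \<in> recip_ideal" "p \<in> recip_ideal \<Longrightarrow> r \<in> polys E \<Longrightarrow> r * p \<in> recip_ideal" "0 \<in> recip_ideal"
  unfolding recip_ideal_def by (auto simp: polys_add polys_mult polys_zero id_hom.eval_add id_hom.eval_mult id_hom.eval_zero)

lemma mpol_subspace_K: "mpol_subspace B (K_dual A X)"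
  unfolding mpol_subspace_def K_eq
proof (intro conjI ballI allI)
  show "restr A X ` recip_ideal \<subseteq> polys B" using restr_polys recip_ideal_def by auto
  show "0 \<in> restr A X ` recip_ideal" using recip_ideal_closed(3) restr_zero by (intro image_eqI[of _ _ 0]) auto
  show "x + y \<in> restr A X ` recip_ideal" if xy: "x \<in> restr A X ` recip_ideal" "y \<in> restr A X ` recip_ideal" for x y
  proof -
    obtain p q where pq: "p \<in> recip_ideal" "x = restr A X p" "q \<in> recip_ideal" "y = restr A X q" using xy by blast
    have "p + q \<in> recip_ideal" using recip_ideal_closed(1)[OF pq(1,3)] .
    moreover have "restr A X (p + q) = x + y" using pq by (simp add: restr_add)
    ultimately show ?thesis by (metis imageI)
  qed
  show "Cst c * x \<in> restr A X ` recip_ideal" if x: "x \<in> restr A X ` recip_ideal" for c x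
  proof -
    obtain p where p: "p \<in> recip_ideal" "x = restr A X p" using x by blast
    have "Cst c * p \<in> recip_ideal" using recip_ideal_closed(2)[OF p(1) polys_Cst] .
    moreover have "restr A X (Cst c * p) = Cst c * x" using p(2) by (simp add: restr_mult restr_Cst)
    ultimately show ?thesis by (metis imageI)
  qed
qed

lemma mpol_subspace_P: "mpol_subspace B (P_minus A X)"
  unfolding mpol_subspace_def P_minus_def
  by (auto simp: polys_zero polys_add polys_mult polys_Cst diff_op_zero_right diff_op_add_right diff_op_Cst_right)

lemma hcomp_P: "f \<in> P_minus A X \<Longrightarrow> hcomp dg k f \<in> P_minus A X"
proof -
  assume f: "f \<in> P_minus A X"
  have "diff_op (sym_vec A X \<alpha> ^ n) (hcomp dg k f) = hcomp dg (k - int n) (diff_op (sym_vec A X \<alpha> ^ n) f)" for \<alpha> n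
    using diff_op_hcomp[OF homog_power[OF homog_lin_poly[of B B "rep \<alpha>"]], of n k f] by (simp add: sym_vec_eq)
  then show ?thesis using f unfolding P_minus_def by (simp add: hcomp_polys hcomp_zero)
qed

text \<open>
  The reciprocal plane is a cone: scaling a point of \<open>D\<close> by \<open>1 / z\<close> scales its
  reciprocal by \<open>z\<close>.
\<close>

lemma hcomp_recip_ideal: assumes p: "p \<in> recip_ideal" shows "hcomp dg k p \<in> recip_ideal"
proof -
  have pE: "p \<in> polys E" using p recip_ideal_def by blast
  (* A bound for the degree of p; adding nat k makes k one of the degrees in the expansion. *)
  define J where "J = Max (mon_deg ` keys p \<union> {0}) + nat k"
  have J: "mon_deg m \<le> J" if "m \<in> keys p" for m
    unfolding J_def using that by (intro trans_le_add1 Max_ge) auto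
  have "ev w (hcomp dg k p) = 0" if w: "w \<in> recip E D" for w
  proof (cases "k < 0")
    case True
    then have "hcomp dg k p = 0" by (intro poly_mapping_eqI) (auto simp: lookup_hcomp)
    then show ?thesis by (simp add: id_hom.eval_zero)
  next
    case False
    obtain t where t: "t \<in> D" "\<forall>e\<in>E. w e * t e = 1" using w unfolding recip_def by blast
    have "(\<Sum>j\<le>J. ev w (hcomp dg (int j) p) * z ^ j) = 0" if z: "z \<noteq> 0" for z
    proof -
      have "(\<lambda>e. (1 / z) * t e) \<in> D" using fs.subspace_scale[OF subspace_D t(1), of "1 / z"] .
      then have "(\<lambda>e. z * w e) \<in> recip E D"
        unfolding recip_def using t(2) z by (auto intro!: bexI[of _ "\<lambda>e. (1 / z) * t e"])
      then have "ev (\<lambda>e. z * w e) p = 0" using p unfolding recip_ideal_def by blast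
      then show ?thesis using ev_scaled_hcomp[where z = z and s = w, OF J] by simp
    qed
    then have "ev w (hcomp dg (int (nat k)) p) = 0"
      using sum_powers_eq_0'[where c = "\<lambda>j. ev w (hcomp dg (int j) p)" and J = J and j = "nat k"] by (simp add: J_def)
    then show ?thesis using False by simp
  qed
  then show ?thesis using hcomp_polys[OF pE] unfolding recip_ideal_def by blast
qed

lemma restr_hcomp: "hcomp dg k (restr A X p) = restr A X (hcomp dg k p)"
proof (induction p rule: mpol_induct)
  case (single m c)
  have "restr A X (single m c) = Cst c * (\<Prod>e\<in>keys m. lin_poly B (dv e) ^ lookup m e)"
    unfolding restr_def' Cst_hom.eval_single mon_val_def ..
  also have "\<dots> \<in> homog B dg (0 + (\<Sum>e\<in>keys m. int (lookup m e) * 1))"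
    by (intro homog_mult homog_Cst homog_prod homog_power homog_lin_poly) auto
  finally have d: "restr A X (single m c) \<in> homog B dg (dg m)" by (simp add: mon_deg_def)
  then show ?case using hcomp_id[OF d] hcomp_other[OF d, of k] by (auto simp: hcomp_single restr_zero)
next
  case (add p q)
  then show ?case by (simp add: hcomp_add restr_add)
qed

lemma hcomp_K: "f \<in> K_dual A X \<Longrightarrow> hcomp dg k f \<in> K_dual A X"
  unfolding K_eq using hcomp_recip_ideal restr_hcomp by blast

lemma sym_vec_polys: "sym_vec A X \<alpha> \<in> polys B"
  unfolding sym_vec_eq by (rule lin_poly_polys)

lemma ideal_R: "ideal (R_ideal A X) (poly_ring B)"
  and R_gen: "\<alpha> \<in> L \<Longrightarrow> \<alpha> \<noteq> 0 \<Longrightarrow> sym_vec A X \<alpha> ^ (mult_num A \<alpha> - 1) \<in> R_ideal A X"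
  and R_min: "ideal J (poly_ring B) \<Longrightarrow> (\<And>\<alpha>. \<alpha> \<in> L \<Longrightarrow> \<alpha> \<noteq> 0 \<Longrightarrow> sym_vec A X \<alpha> ^ (mult_num A \<alpha> - 1) \<in> J) \<Longrightarrow> R_ideal A X \<subseteq> J"
proof -
  interpret R: cring "poly_ring B :: ('v, 'f) mpol ring" by (rule cring_poly_ring)
  let ?S = "{sym_vec A X \<alpha> ^ (mult_num A \<alpha> - 1) | \<alpha>. \<alpha> \<in> L \<and> \<alpha> \<noteq> 0}"
  have S: "?S \<subseteq> carrier (poly_ring B)" using sym_vec_polys polys_power by auto
  show "ideal (R_ideal A X) (poly_ring B)" unfolding R_ideal_def by (rule R.genideal_ideal[OF S])
  show "sym_vec A X \<alpha> ^ (mult_num A \<alpha> - 1) \<in> R_ideal A X" if "\<alpha> \<in> L" "\<alpha> \<noteq> 0"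
    unfolding R_ideal_def using R.genideal_self[OF S] that by blast
  show "R_ideal A X \<subseteq> J" if "ideal J (poly_ring B)" "\<And>\<alpha>. \<alpha> \<in> L \<Longrightarrow> \<alpha> \<noteq> 0 \<Longrightarrow> sym_vec A X \<alpha> ^ (mult_num A \<alpha> - 1) \<in> J"
    unfolding R_ideal_def by (rule R.genideal_minimal[OF that(1)]) (use that(2) in blast)
qed

lemma mpol_subspace_R: "mpol_subspace B (R_ideal A X)"
  using mpol_subspace_ideal(1)[OF ideal_R] .

text \<open>
  An operator in the ideal pairs to zero with \<open>f\<close> together with all its multiples, and this
  means that it annihilates \<open>f\<close>.
\<close>

lemma P_eq: "P_minus A X = {f \<in> polys B. \<forall>D\<in>R_ideal A X. sym_pairing f D = 0}"
proof (intro subset_antisym subsetI)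
  fix f assume f: "f \<in> P_minus A X"
  have fB: "f \<in> polys B" using f P_minus_def by blast
  let ?J = "{D \<in> polys B. diff_op D f = 0}"
  have "ideal ?J (poly_ring B)"
  proof (rule ideal_poly_ringI)
    show "mpol_subspace B ?J"
      unfolding mpol_subspace_def
      by (auto simp: polys_zero polys_add polys_mult polys_Cst diff_op_zero_left diff_op_add_left diff_op_mult diff_op_Cst)
    show "q * p \<in> ?J" if "p \<in> ?J" "q \<in> polys B" for p q
      using that by (simp add: polys_mult diff_op_mult diff_op_zero_right)
  qed
  then have "R_ideal A X \<subseteq> ?J"
    by (rule R_min) (use f sym_vec_polys polys_power in \<open>auto simp: P_minus_def\<close>)
  then have "sym_pairing f D = 0" if "D \<in> R_ideal A X" for D using that by (auto simp: sym_pairing_def)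
  then show "f \<in> {f \<in> polys B. \<forall>D\<in>R_ideal A X. sym_pairing f D = 0}" using fB by blast
next
  fix f assume "f \<in> {f \<in> polys B. \<forall>D\<in>R_ideal A X. sym_pairing f D = 0}"
  then have fB: "f \<in> polys B" and f: "\<And>D. D \<in> R_ideal A X \<Longrightarrow> sym_pairing f D = 0" by auto
  have "diff_op (sym_vec A X \<alpha> ^ (mult_num A \<alpha> - 1)) f = 0" if "\<alpha> \<in> L" "\<alpha> \<noteq> 0" for \<alpha>
  proof (rule pairing_nondegenerate)
    show "diff_op (sym_vec A X \<alpha> ^ (mult_num A \<alpha> - 1)) f \<in> polys B" by (rule diff_op_polys[OF fB])
    fix G :: "('v, 'f) mpol" assume G: "G \<in> polys B"
    have "G * sym_vec A X \<alpha> ^ (mult_num A \<alpha> - 1) \<in> R_ideal A X"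
      by (rule mpol_subspace_ideal(2)[OF ideal_R R_gen[OF that] G])
    then show "sym_pairing (diff_op (sym_vec A X \<alpha> ^ (mult_num A \<alpha> - 1)) f) G = 0"
      using f[of "G * sym_vec A X \<alpha> ^ (mult_num A \<alpha> - 1)"] unfolding sym_pairing_def diff_op_mult by blast
  qed
  then show "f \<in> P_minus A X" using fB unfolding P_minus_def by blast
qed

text \<open>
  In a monomial of larger degree some basis element of \<open>L\<close> has an exponent greater than the
  number of coordinates, so the monomial is a multiple of one of the generators of
  \<open>R_ideal\<close>.
\<close>

definition deg_bound :: nat where "deg_bound = card B * card E"

lemma R_high: assumes m: "keys m \<subseteq> B" "deg_bound < mon_deg m" shows "single m 1 \<in> R_ideal A X"
proof -
  have "\<exists>b\<in>B. card E < lookup m b"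
  proof (rule ccontr)
    assume "\<not> (\<exists>b\<in>B. card E < lookup m b)"
    then have "(\<Sum>b\<in>B. lookup m b) \<le> (\<Sum>b\<in>B. card E)" by (intro sum_mono) auto
    then have "mon_deg m \<le> deg_bound" unfolding deg_bound_def mon_deg_superset[OF finB m(1)] by simp
    then show False using m(2) by simp
  qed
  then obtain b where b: "b \<in> B" "card E < lookup m b" by blast
  define k where "k = mult_num A b - 1"
  have b0: "b \<noteq> 0" using b(1) indB V.dependent_zero by blast
  have "mult_num A b \<le> card E" unfolding mult_num_eq supp_def using finE by (intro card_mono) auto
  then have k: "k \<le> lookup m b" using b(2) k_def by simp
  have "lin_poly B (rep b) = (\<Sum>c\<in>B. if c = b then Vr c else 0)"
    unfolding lin_poly_def using V.representation_basis[OF indB b(1)]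
    by (intro sum.cong) (auto simp: Cst_one Cst_zero)
  then have "sym_vec A X b = Vr b" using b(1) finB by (simp add: sym_vec_eq)
  then have "Vr b ^ k \<in> R_ideal A X" using R_gen[of b] b(1) b0 BL unfolding k_def by auto
  moreover have "m = (m - single b k) + single b k"
    by (rule poly_mapping_eqI) (use k in \<open>auto simp: lookup_add lookup_minus lookup_single when_def\<close>)
  then have "single m 1 = single (m - single b k) 1 * (Vr b ^ k :: ('v, 'f) mpol)"
    unfolding Vr_power by (simp add: mult_single)
  moreover have "single (m - single b k) (1::'f) \<in> polys B"
    using m(1) by (intro polys_single) (auto simp: in_keys_iff lookup_minus)
  ultimately show ?thesis using mpol_subspace_ideal(2)[OF ideal_R] by metis
qed

lemma P_K_disjoint: "P_minus A X \<inter> K_dual A X = {0}"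
proof (intro subset_antisym subsetI)
  fix f assume "f \<in> P_minus A X \<inter> K_dual A X"
  then show "f \<in> {0}" using P_inter_K unfolding K_eq by blast
qed (use mpol_subspaceD(2)[OF mpol_subspace_P] mpol_subspaceD(2)[OF mpol_subspace_K] in auto)

lemma P_K_sum: "f \<in> polys B \<Longrightarrow> \<exists>p\<in>P_minus A X. \<exists>k\<in>K_dual A X. f = p + k"
proof -
  assume "f \<in> polys B"
  then obtain g p where "g \<in> P_minus A X" "p \<in> recip_ideal" "f = g + restr A X p" using P_plus_K by blast
  then show ?thesis unfolding K_eq by (intro bexI[of _ g] bexI[of _ "restr A X p"]) auto
qed

text \<open>
  Since \<open>P_minus\<close> is orthogonal to \<open>R_ideal\<close>, which contains all monomials of
  high degree, it has no elements of high degree. So a monomial of high degree has no component in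
  \<open>P_minus\<close>.
\<close>

lemma K_high: assumes m: "keys m \<subseteq> B" "deg_bound < mon_deg m" shows "single m 1 \<in> K_dual A X"
proof -
  let ?f = "single m (1::'f)"
  have fD: "?f \<in> homog B dg (dg m)" using polys_single[OF m(1)] by (simp add: homog_def)
  obtain p k where pk: "p \<in> P_minus A X" "k \<in> K_dual A X" "?f = p + k" using P_K_sum[OF polys_single[OF m(1)]] by blast
  let ?p = "hcomp dg (dg m) p"
  have pP: "?p \<in> P_minus A X" by (rule hcomp_P[OF pk(1)])
  have pB: "?p \<in> polys B" by (rule mpol_subspaceD(1)[OF mpol_subspace_P pP])
  have "?p = 0"
  proof (rule poly_mapping_eqI)
    fix n show "lookup ?p n = lookup 0 n"
    proof (cases "n \<in> keys ?p")
      case True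
      then have n: "keys n \<subseteq> B" using pB unfolding polys_def by blast
      have "mon_deg n = mon_deg m" using True unfolding keys_hcomp by simp
      then have "single n 1 \<in> R_ideal A X" using R_high[OF n] m(2) by simp
      then have "sym_pairing ?p (single n 1) = 0" using pP unfolding P_eq by blast
      then show ?thesis by (simp add: pairing_single_right mfact_nonzero)
    qed (simp add: in_keys_iff)
  qed
  then have "?f = hcomp dg (dg m) k" using hcomp_id[OF fD] pk(3) hcomp_add[of dg "dg m" p k] by simp
  then show ?thesis using hcomp_K[OF pk(2)] by metis
qed

sublocale dual_decomposition B "P_minus A X" "K_dual A X" "E_dual A X" "R_ideal A X" deg_bound
  by unfold_locales
     (fact finB mpol_subspace_P mpol_subspace_K mpol_subspace_R P_K_disjoint P_K_sum E_dual_def P_eq K_high R_high hcomp_P hcomp_K)+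

subsection \<open>Isomorphisms and dualities\<close>

lemma deg_eq: "deg_SymLd X k = homog B dg k" "deg_SymL X k = homog B dn k"
  by (auto simp: deg_SymLd_def deg_SymL_def homog_def)

abbreviation "qR \<equiv> SymL_to_R A X"

lemmas Rq = quotient_ring_facts[OF cring.axioms(1)[OF cring_poly_ring] ideal_R]

lemma R_facts:
  "ring (R_minus A X)" "carrier (R_minus A X) = qR ` polys B"
  "x \<in> polys B \<Longrightarrow> y \<in> polys B \<Longrightarrow> qR (x + y) = qR x \<oplus>\<^bsub>R_minus A X\<^esub> qR y"
  "x \<in> polys B \<Longrightarrow> qR (Cst c * x) = R_const A X c \<otimes>\<^bsub>R_minus A X\<^esub> qR x"
  "x \<in> polys B \<Longrightarrow> qR x = \<zero>\<^bsub>R_minus A X\<^esub> \<longleftrightarrow> x \<in> R_ideal A X"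
  using Rq(1,2) Rq(3)[of x y] Rq(4)[of "Cst c" x] Rq(6)[of x] polys_Cst[of c B]
  unfolding R_minus_def SymL_to_R_def R_const_def by simp_all

lemma ring_OTbar: "ring (OTbar A X)"
  unfolding OTbar_eq by (rule OTq(1))

lemma bij_O: "linear_bijection (poly_ring B) (OTbar A X) Cst (OTbar_const A X) (P_minus A X) (carrier (OTbar A X)) qO"
  and deg_O: "qO ` (P_minus A X \<inter> homog B dg k) = qO ` homog B dg k"
proof -
  have z: "qO x = \<zero>\<^bsub>OTbar A X\<^esub> \<longleftrightarrow> x \<in> K_dual A X" if "x \<in> polys B" for x using that K_dual_iff by blast
  note c = complement_bijection[OF mpol_subspace_P mpol_subspace_K P_K_disjoint P_K_sum ring_OTbar qO_carrier qO_add qO_scale z]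
  show "linear_bijection (poly_ring B) (OTbar A X) Cst (OTbar_const A X) (P_minus A X) (carrier (OTbar A X)) qO"
    by (rule c(1)) (assumption | simp)+
  show "qO ` (P_minus A X \<inter> homog B dg k) = qO ` homog B dg k" by (rule c(2)) (assumption | rule hcomp_P hcomp_K)+
qed

lemma bij_R: "linear_bijection (poly_ring B) (R_minus A X) Cst (R_const A X) (E_dual A X) (carrier (R_minus A X)) qR"
  and deg_R: "qR ` (E_dual A X \<inter> homog B dn k) = qR ` homog B dn k"
proof -
  note c = complement_bijection[OF subspace_E mpol_subspace_R E_I_disjoint E_I_sum R_facts]
  show "linear_bijection (poly_ring B) (R_minus A X) Cst (R_const A X) (E_dual A X) (carrier (R_minus A X)) qR"
    by (rule c(1)) (assumption | simp)+
  show "qR ` (E_dual A X \<inter> homog B dn k) = qR ` homog B dn k" by (rule c(2)) (assumption | rule E_hom I_hom)+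
qed

lemma graded_P: "graded_space (poly_ring B) Cst (P_minus A X) (\<lambda>k. P_minus A X \<inter> homog B dg k)"
  by (rule graded_poly_ring[OF mpol_subspace_P hcomp_P])

lemma graded_E: "graded_space (poly_ring B) Cst (E_dual A X) (\<lambda>k. E_dual A X \<inter> homog B dn k)"
  by (rule graded_poly_ring[OF subspace_E E_hom])

lemma P_R_pairing_eq:
  assumes f: "f \<in> P_minus A X" and G: "G \<in> E_dual A X"
  shows "P_R_pairing f (qR G) = sym_pairing f G"
proof -
  have "qR G = {r + G | r. r \<in> R_ideal A X}"
    unfolding SymL_to_R_def a_r_coset_def' by auto
  moreover have "sym_pairing f (r + G) = sym_pairing f G" if "r \<in> R_ideal A X" for r
    using P_I_orthogonal[OF f that] by (simp add: pairing_add_right)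
  ultimately have "(\<lambda>D. sym_pairing f D) ` qR G = {sym_pairing f G}"
    using mpol_subspaceD(2)[OF mpol_subspace_R] by (auto simp: image_iff)
  then show ?thesis unfolding P_R_pairing_def by simp
qed

text \<open>
  Representatives of the same class differ by an element of \<open>K_dual\<close>, to which
  \<open>E_dual\<close> is orthogonal.
\<close>

lemma OTbar_E_pairing_eq:
  assumes f: "f \<in> P_minus A X" and G: "G \<in> E_dual A X"
  shows "OTbar_E_pairing A X (qO f) G = sym_pairing f G"
proof -
  have fB: "f \<in> polys B" by (rule mpol_subspaceD(1)[OF mpol_subspace_P f])
  have "sym_pairing g G = sym_pairing f G" if g: "g \<in> polys B" "qO g = qO f" for g
  proof -
    obtain p k where pk: "p \<in> P_minus A X" "k \<in> K_dual A X" "g = p + k" using P_K_sum[OF g(1)] by blast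
    have 1: "qO g = qO p \<oplus>\<^bsub>OTbar A X\<^esub> qO k"
      unfolding pk(3) by (rule qO_add[OF mpol_subspaceD(1)[OF mpol_subspace_P pk(1)] mpol_subspaceD(1)[OF mpol_subspace_K pk(2)]])
    have 2: "qO p \<in> carrier (OTbar A X)" unfolding qO_carrier using mpol_subspaceD(1)[OF mpol_subspace_P pk(1)] by (rule imageI)
    have 3: "qO k = \<zero>\<^bsub>OTbar A X\<^esub>" using pk(2) K_dual_iff by blast
    have "qO p \<oplus>\<^bsub>OTbar A X\<^esub> qO k = qO p"
      unfolding 3 by (rule abelian_monoid.r_zero[OF abelian_group.axioms(1)[OF ring.is_abelian_group[OF ring_OTbar]] 2])
    then have "qO p = qO f" using 1 g(2) by metis
    then have pf: "p = f" by (rule linear_bijection.g_inj[OF bij_O pk(1) f])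
    have "sym_pairing k G = 0" by (rule K_E_orthogonal[OF pk(2) G])
    then show ?thesis unfolding pk(3) pf pairing_add_left by simp
  qed
  then have "(\<lambda>f. sym_pairing f G) ` {g \<in> polys B. qO g = qO f} \<subseteq> {sym_pairing f G}"
    by blast
  moreover have "f \<in> {g \<in> polys B. qO g = qO f}" using fB by simp
  then have "sym_pairing f G \<in> (\<lambda>f. sym_pairing f G) ` {g \<in> polys B. qO g = qO f}"
    by (rule imageI)
  ultimately have "(\<lambda>f. sym_pairing f G) ` {g \<in> polys B. qO g = qO f} = {sym_pairing f G}"
    by blast
  then show ?thesis unfolding OTbar_E_pairing_def by simp
qed

lemma degree_spaces:
  "P_deg A X = (\<lambda>k. P_minus A X \<inter> homog B dg k)"
  "E_deg A X = (\<lambda>k. E_dual A X \<inter> homog B dn k)"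
  "OTbar_deg A X = (\<lambda>k. qO ` (P_minus A X \<inter> homog B dg k))"
  "R_deg A X = (\<lambda>k. qR ` (E_dual A X \<inter> homog B dn k))"
  unfolding deg_O deg_R by (auto simp: P_deg_def E_deg_def OTbar_deg_def R_deg_def deg_eq)

lemma direct_sum:
  "internal_direct_sum (poly_ring B) Cst (carrier (poly_ring B)) (P_minus A X) (K_dual A X)"
  unfolding internal_direct_sum_def mpol_subspace_F[symmetric] poly_ring_simps
proof (intro conjI mpol_subspace_P mpol_subspace_K P_K_disjoint subset_antisym subsetI)
  fix f :: "('v, 'f) mpol" assume "f \<in> polys B"
  then show "f \<in> {x + y | x y. x \<in> P_minus A X \<and> y \<in> K_dual A X}" using P_K_sum by blast
next
  fix f :: "('v, 'f) mpol" assume "f \<in> {x + y | x y. x \<in> P_minus A X \<and> y \<in> K_dual A X}"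
  then show "f \<in> polys B"
    using mpol_subspaceD(1)[OF mpol_subspace_P] mpol_subspaceD(1)[OF mpol_subspace_K] polys_add by blast
qed

lemma graded_isos:
  "graded_iso (poly_ring B) Cst (P_minus A X) (P_deg A X)
     (OTbar A X) (OTbar_const A X) (carrier (OTbar A X)) (OTbar_deg A X) qO"
  "graded_iso (poly_ring B) Cst (E_dual A X) (E_deg A X)
     (R_minus A X) (R_const A X) (carrier (R_minus A X)) (R_deg A X) qR"
  unfolding degree_spaces
  by (rule linear_bijection.graded_iso_image[OF bij_O graded_P],
      rule linear_bijection.graded_iso_image[OF bij_R graded_E])

lemma graded_duals:
  "graded_dual (poly_ring B) Cst (P_minus A X) (P_deg A X)
     (poly_ring B) Cst (E_dual A X) (E_deg A X) sym_pairing"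
  "graded_dual (poly_ring B) Cst (P_minus A X) (P_deg A X)
     (R_minus A X) (R_const A X) (carrier (R_minus A X)) (R_deg A X) P_R_pairing"
  "graded_dual (OTbar A X) (OTbar_const A X) (carrier (OTbar A X)) (OTbar_deg A X)
     (poly_ring B) Cst (E_dual A X) (E_deg A X) (OTbar_E_pairing A X)"
  unfolding degree_spaces
  by (rule graded_dual_P_E,
      rule linear_bijection.graded_dual_image_right[OF bij_R graded_dual_P_E P_R_pairing_eq],
      assumption+,
      rule linear_bijection.graded_dual_image[OF bij_O graded_dual_P_E OTbar_E_pairing_eq],
      assumption+)

end

theorem theorem1p8:
  fixes A :: "('f::field_char_0, 'v::ab_group_add, 'e) linspace"
    and X :: "('f, 'v, 'e) frame"
  assumes "linear_space A" and "frame_of A X"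
  shows
    "internal_direct_sum (poly_ring (bas X)) Cst (carrier (poly_ring (bas X))) (P_minus A X) (K_dual A X)
     \<and> graded_iso (poly_ring (bas X)) Cst (P_minus A X) (P_deg A X)
         (OTbar A X) (OTbar_const A X) (carrier (OTbar A X)) (OTbar_deg A X) (SymLd_to_OTbar A X)
     \<and> graded_iso (poly_ring (bas X)) Cst (E_dual A X) (E_deg A X)
         (R_minus A X) (R_const A X) (carrier (R_minus A X)) (R_deg A X) (SymL_to_R A X)
     \<and> graded_dual (poly_ring (bas X)) Cst (P_minus A X) (P_deg A X) (poly_ring (bas X)) Cst (E_dual A X) (E_deg A X) sym_pairing
     \<and> graded_dual (poly_ring (bas X)) Cst (P_minus A X) (P_deg A X)
         (R_minus A X) (R_const A X) (carrier (R_minus A X)) (R_deg A X) P_R_pairing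
     \<and> graded_dual (OTbar A X) (OTbar_const A X) (carrier (OTbar A X)) (OTbar_deg A X)
         (poly_ring (bas X)) Cst (E_dual A X) (E_deg A X) (OTbar_E_pairing A X)"
proof -
  interpret framed_space A X using assms by unfold_locales
  show ?thesis by (intro conjI direct_sum graded_isos graded_duals)
qed

end
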